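(* Let $\mu$ be a stochastic measure on a measurable space $(\mathsf{X},\mathcal{B})$. Assume that there exists a real-valued finite measure $\mathsf{m}$ on $(\mathsf{X},\mathcal{B})$ with the following property: if a measurable function $g:\mathsf{X}\to\mathbb{R}$ is such that $\int_{\mathsf{X}}2^{\lambda|g|}\,d\mathsf{m}<+\infty$ for all real $\lambda>0$, then $g$ is integrable with respect to $\mu$ on $\mathsf{X}$. Let measurable functions $f_k:\mathsf{X}\to\mathbb{R}$, $k\ge1$, be such that $$\sup_{x\in\mathsf{X}}\sum_{k=1}^\infty (f_k(x))^2<\infty.$$ Then $$\sum_{k=1}^\infty\Bigl(\int_{\mathsf{X}}f_k\,d\mu\Bigr)^2<+\infty\quad\text{almost surely}.$$
   Context: Let $(\Omega,\mathcal{F},\mathsf{P})$ be a complete probability space and $\mathsf{L}_0=\mathsf{L}_0(\Omega,\mathcal{F},\mathsf{P})$ the set of all real-valued random variables on it, with convergence in probability. For a set $\mathsf{X}$ with a $\sigma$-algebra $\mathcal{B}$ of its subsets, a stochastic measure (SM) is a $\sigma$-additive mapping $\mu:\mathcal{B}\to\mathsf{L}_0$ (i.e. for pairwise disjoint $A_n\in\mathcal{B}$, $\mu(\bigcup_n A_n)=\sum_n\mu(A_n)$ with the series converging in probability). No moment existence or martingale property is assumed. Integral of deterministic functions: for a simple measurable function $f=\sum_i c_i\mathbf{1}_{A_i}$ and $A\in\mathcal{B}$ set $\int_A f\,d\mu=\sum_i c_i\,\mu(A\cap A_i)$. A measurable $g:\mathsf{X}\to\mathbb{R}$ is integrable with respect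 to $\mu$ on $\mathsf{X}$ if there are simple functions $g_n\to g$ pointwise such that for every $A\in\mathcal{B}$ the sequence $\int_A g_n\,d\mu$ converges in probability; the limit is denoted $\int_A g\,d\mu$ (it does not depend on the choice of the sequence). Every bounded measurable function is integrable with respect to any SM. *)

theory Defs
  imports "HOL-Probability.Probability"
begin

definition converges_in_prob :: "'w measure \<Rightarrow> (nat \<Rightarrow> 'w \<Rightarrow> real) \<Rightarrow> ('w \<Rightarrow> real) \<Rightarrow> bool" where
  "converges_in_prob M Y Z \<longleftrightarrow>
     (\<forall>\<epsilon>>0. (\<lambda>n. measure M {\<omega> \<in> space M. \<bar>Y n \<omega> - Z \<omega>\<bar> > \<epsilon>}) \<longlonglongrightarrow> 0)"

(* Random variables are represented by functions, not by almost-sure equivalence classes;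
   limits in probability, hence the values of \<mu> on unions, are determined only up to
   almost-sure equality. The measure argument N serves only as a measurable space
   (space N, sets N). Taking all sets A n empty yields \<mu> {} = 0 almost surely, so
   finite additivity is included. *)
definition stochastic_measure ::
    "'w measure \<Rightarrow> 'x measure \<Rightarrow> ('x set \<Rightarrow> 'w \<Rightarrow> real) \<Rightarrow> bool" where
  "stochastic_measure M N \<mu> \<longleftrightarrow>
     (\<forall>A\<in>sets N. \<mu> A \<in> borel_measurable M) \<and>
     (\<forall>A::nat \<Rightarrow> 'x set. range A \<subseteq> sets N \<longrightarrow> disjoint_family A \<longrightarrow>
        converges_in_prob M (\<lambda>n \<omega>. \<Sum>i<n. \<mu> (A i) \<omega>) (\<mu> (\<Union>i. A i)))"

(* Written with the canonical representation f = (\<Sum>c. c * indicator (f -` {c})), as in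
   simple_integral; by finite additivity any other representation gives an almost surely
   equal random variable. *)
definition sm_simple_integral ::
    "'x measure \<Rightarrow> ('x set \<Rightarrow> 'w \<Rightarrow> real) \<Rightarrow> 'x set \<Rightarrow> ('x \<Rightarrow> real) \<Rightarrow> 'w \<Rightarrow> real" where
  "sm_simple_integral N \<mu> A f \<omega> =
     (\<Sum>c\<in>f ` space N. c * \<mu> (A \<inter> (f -` {c} \<inter> space N)) \<omega>)"

definition sm_approximating ::
    "'w measure \<Rightarrow> 'x measure \<Rightarrow> ('x set \<Rightarrow> 'w \<Rightarrow> real) \<Rightarrow> ('x \<Rightarrow> real) \<Rightarrow> (nat \<Rightarrow> 'x \<Rightarrow> real) \<Rightarrow> bool" where
  "sm_approximating M N \<mu> g s \<longleftrightarrow>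
     (\<forall>n. simple_function N (s n)) \<and>
     (\<forall>x\<in>space N. (\<lambda>n. s n x) \<longlonglongrightarrow> g x) \<and>
     (\<forall>A\<in>sets N. \<exists>Z\<in>borel_measurable M.
        converges_in_prob M (\<lambda>n. sm_simple_integral N \<mu> A (s n)) Z)"

definition sm_integrable ::
    "'w measure \<Rightarrow> 'x measure \<Rightarrow> ('x set \<Rightarrow> 'w \<Rightarrow> real) \<Rightarrow> ('x \<Rightarrow> real) \<Rightarrow> bool" where
  "sm_integrable M N \<mu> g \<longleftrightarrow>
     g \<in> borel_measurable N \<and> (\<exists>s. sm_approximating M N \<mu> g s)"

definition has_sm_integral ::
    "'w measure \<Rightarrow> 'x measure \<Rightarrow> ('x set \<Rightarrow> 'w \<Rightarrow> real) \<Rightarrow> 'x set \<Rightarrow> ('x \<Rightarrow> real) \<Rightarrow> ('w \<Rightarrow> real) \<Rightarrow> bool" where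
  "has_sm_integral M N \<mu> A g Z \<longleftrightarrow>
     Z \<in> borel_measurable M \<and>
     (\<exists>s. sm_approximating M N \<mu> g s \<and>
        converges_in_prob M (\<lambda>n. sm_simple_integral N \<mu> A (s n)) Z)"

(* A version of the integral; meaningful if g is integrable and A is measurable. *)
definition sm_integral ::
    "'w measure \<Rightarrow> 'x measure \<Rightarrow> ('x set \<Rightarrow> 'w \<Rightarrow> real) \<Rightarrow> 'x set \<Rightarrow> ('x \<Rightarrow> real) \<Rightarrow> 'w \<Rightarrow> real" where
  "sm_integral M N \<mu> A g = (SOME Z. has_sm_integral M N \<mu> A g Z)"

lemma has_sm_integral_sm_integral:
  assumes "sm_integrable M N \<mu> g" and "A \<in> sets N"
  shows "has_sm_integral M N \<mu> A g (sm_integral M N \<mu> A g)"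
proof -
  have "\<exists>Z. has_sm_integral M N \<mu> A g Z"
    using assms unfolding sm_integrable_def sm_approximating_def has_sm_integral_def by blast
  then show ?thesis
    unfolding sm_integral_def by (rule someI_ex)
qed

end

theory Submission
  imports Defs
begin

text \<open>
  Write \<open>T g\<close> for the integral of \<open>g\<close> over the whole space. The theorem follows if the square functions
  \<open>\<Sum>k<n. (T (f k))\<^sup>2\<close> are bounded in probability uniformly in \<open>n\<close> (\<open>AE_summable_of_tight_partial_sums\<close>), for their
  limit is then finite almost surely. The bound comes from three facts.

  First, the values of a stochastic measure are bounded in probability (\<open>mu_bounded\<close>). If they were not,
  successive bisections would produce partitions of which arbitrarily many cells have large measure, with a
  probability bounded below (\<open>growing_count\<close>). Out of such partitions, random selections of cells yield
  infinitely many disjoint sets whose measures do not tend to zero (\<open>crowded_split\<close>, \<open>not_crowded\<close>), which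
  contradicts countable additivity. Random rounding carries the bound from sets to simple functions with
  values in \<open>[-1, 1]\<close> (\<open>coefficients_bounded\<close>).

  Second, an operator with this boundedness property maps families with \<open>\<Sum>k. (f k)\<^sup>2 \<le> 1\<close> to families whose
  square function is bounded in probability (\<open>square_function_bounded\<close>). Outside a small event the
  boundedness is of weak type, by an argument of Nikishin (\<open>nikishin_finite\<close>). A random sign combination of
  the \<open>f k\<close> is the sum of a bounded function and a remainder that is small in mean square; the
  remainders form a new family of the same kind, and the resulting iteration converges
  (\<open>square_function_iteration\<close>). All this concerns finitely many cells at a time, with constants that
  do not depend on their number.

  Third, the integrals of the \<open>f k\<close> are limits in probability of integrals of uniformly approximating simple
  functions (\<open>integral_limit_of_uniform_approximation\<close>), whichever approximating sequence defines
  them; this rests on a gliding hump argument (\<open>null_sequence_limit\<close>) and on the first fact. The hypothesis on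
  the measure \<open>m\<close> makes the functions \<open>f k\<close>, which are bounded, integrable.
\<close>

section \<open>Averages over random subsets and random signs\<close>

text \<open>
  The expectation of \<open>\<phi> T\<close> for a random subset \<open>T\<close> of \<open>I\<close> that contains each \<open>i\<close> independently
  with probability \<open>p i\<close>. As a finite sum it can be interchanged with integrals over \<open>\<Omega>\<close>, and
  statements about it follow by induction on \<open>I\<close> from the recursion in \<open>subset_avg_insert\<close>.
\<close>
definition subset_avg :: "'i set \<Rightarrow> ('i \<Rightarrow> real) \<Rightarrow> ('i set \<Rightarrow> real) \<Rightarrow> real" where
  "subset_avg I p \<phi> = (\<Sum>T\<in>Pow I. (\<Prod>i\<in>T. p i) * (\<Prod>i\<in>I - T. 1 - p i) * \<phi> T)"

lemma subset_avg_empty [simp]: "subset_avg {} p \<phi> = \<phi> {}"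
  by (simp add: subset_avg_def)

lemma subset_avg_cong:
  assumes "\<And>T. T \<subseteq> I \<Longrightarrow> \<phi> T = \<psi> T"
  shows "subset_avg I p \<phi> = subset_avg I p \<psi>"
  unfolding subset_avg_def using assms by (intro sum.cong) auto

text \<open>Conditioning on whether the new point \<open>a\<close> belongs to the random set.\<close>
lemma subset_avg_insert:
  assumes "finite I" "a \<notin> I"
  shows "subset_avg (insert a I) p \<phi> =
    p a * subset_avg I p (\<lambda>T. \<phi> (insert a T)) + (1 - p a) * subset_avg I p \<phi>"
proof -
  let ?h = "\<lambda>T. (\<Prod>i\<in>T. p i) * (\<Prod>i\<in>insert a I - T. 1 - p i) * \<phi> T"
  have fin: "finite T" "a \<notin> T" if "T \<in> Pow I" for T
    using that assms by (auto intro: finite_subset)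
  have "subset_avg (insert a I) p \<phi> = sum ?h (Pow I) + sum ?h (insert a ` Pow I)"
    unfolding subset_avg_def Pow_insert
    using assms by (intro sum.union_disjoint) auto
  also have "sum ?h (insert a ` Pow I) = (\<Sum>T\<in>Pow I. ?h (insert a T))"
    using assms by (subst sum.reindex) (auto simp: inj_on_def)
  also have "\<dots> = p a * subset_avg I p (\<lambda>T. \<phi> (insert a T))"
    unfolding subset_avg_def sum_distrib_left
  proof (intro sum.cong refl)
    fix T assume T: "T \<in> Pow I"
    have "insert a I - insert a T = I - T" using assms T by auto
    then show "?h (insert a T) = p a * ((\<Prod>i\<in>T. p i) * (\<Prod>i\<in>I - T. 1 - p i) * \<phi> (insert a T))"
      using fin[OF T] by simp
  qed
  also have "sum ?h (Pow I) = (1 - p a) * subset_avg I p \<phi>"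
    unfolding subset_avg_def sum_distrib_left
  proof (intro sum.cong refl)
    fix T assume T: "T \<in> Pow I"
    have "insert a I - T = insert a (I - T)" using assms T by auto
    then show "?h T = (1 - p a) * ((\<Prod>i\<in>T. p i) * (\<Prod>i\<in>I - T. 1 - p i) * \<phi> T)"
      using assms by simp
  qed
  finally show ?thesis by simp
qed

lemma subset_avg_add: "subset_avg I p (\<lambda>T. \<phi> T + \<psi> T) = subset_avg I p \<phi> + subset_avg I p \<psi>"
  by (simp add: subset_avg_def algebra_simps sum.distrib)

lemma subset_avg_cmult: "subset_avg I p (\<lambda>T. c * \<phi> T) = c * subset_avg I p \<phi>"
  by (simp add: subset_avg_def algebra_simps sum_distrib_left)

lemma subset_avg_const: "finite I \<Longrightarrow> subset_avg I p (\<lambda>T. c) = c"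
  by (induction I rule: finite_induct) (auto simp: subset_avg_insert algebra_simps)

lemma subset_avg_mono:
  assumes "\<And>i. i \<in> I \<Longrightarrow> 0 \<le> p i \<and> p i \<le> 1" "\<And>T. T \<subseteq> I \<Longrightarrow> \<phi> T \<le> \<psi> T"
  shows "subset_avg I p \<phi> \<le> subset_avg I p \<psi>"
  unfolding subset_avg_def
  using assms by (intro sum_mono mult_left_mono mult_nonneg_nonneg prod_nonneg) auto

lemma subset_avg_le_witness:
  assumes "finite I" "\<And>i. i \<in> I \<Longrightarrow> 0 \<le> p i \<and> p i \<le> 1" "subset_avg I p \<phi> \<le> c"
  shows "\<exists>T\<subseteq>I. \<phi> T \<le> c"
proof (rule ccontr)
  assume "\<not> ?thesis"
  then have gt: "\<phi> T > c" if "T \<subseteq> I" for T using that by auto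
  \<comment> \<open>the sum is finite, so strict inequality everywhere leaves a uniform gap \<open>e\<close>\<close>
  define e where "e = Min ((\<lambda>T. \<phi> T - c) ` Pow I)"
  have fin: "finite (Pow I)" using assms by simp
  have e: "e \<le> \<phi> T - c" if "T \<subseteq> I" for T
    unfolding e_def using fin that by (intro Min_le) auto
  have "e > 0" unfolding e_def using fin gt by (subst Min_gr_iff) auto
  have "c + e = subset_avg I p (\<lambda>T. c + e)" by (simp add: subset_avg_const assms)
  also have "\<dots> \<le> subset_avg I p \<phi>" using e assms by (intro subset_avg_mono) (auto simp: algebra_simps)
  finally show False using assms \<open>e > 0\<close> by simp
qed

lemma subset_avg_ge_witness:
  assumes "finite I" "\<And>i. i \<in> I \<Longrightarrow> 0 \<le> p i \<and> p i \<le> 1" "subset_avg I p \<phi> \<ge> c"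
  shows "\<exists>T\<subseteq>I. \<phi> T \<ge> c"
proof -
  have "\<exists>T\<subseteq>I. -1 * \<phi> T \<le> - c"
    using assms by (intro subset_avg_le_witness[where p = p]) (auto simp only: subset_avg_cmult)
  then show ?thesis by auto
qed

lemma subset_avg_markov:
  assumes "finite I" "\<And>i. i \<in> I \<Longrightarrow> 0 \<le> p i \<and> p i \<le> 1" "a > 0" "\<And>T. T \<subseteq> I \<Longrightarrow> \<phi> T \<ge> 0"
  shows "subset_avg I p (\<lambda>T. of_bool (\<phi> T \<ge> a)) \<le> subset_avg I p \<phi> / a"
proof -
  have "subset_avg I p (\<lambda>T. of_bool (\<phi> T \<ge> a)) \<le> subset_avg I p (\<lambda>T. (1/a) * \<phi> T)"
    using assms by (intro subset_avg_mono) (auto simp: of_bool_def field_simps)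
  then show ?thesis unfolding subset_avg_cmult by simp
qed

definition rsign :: "'i set \<Rightarrow> 'i \<Rightarrow> real" where "rsign T i = (if i \<in> T then 1 else - 1)"

lemma subset_avg_insert_rsign:
  assumes "finite I" "a \<notin> I"
  shows "subset_avg (insert a I) p (\<lambda>T. \<phi> (\<Sum>i\<in>insert a I. rsign T i * x i)) =
    p a * subset_avg I p (\<lambda>T. \<phi> (x a + (\<Sum>i\<in>I. rsign T i * x i))) +
    (1 - p a) * subset_avg I p (\<lambda>T. \<phi> (- x a + (\<Sum>i\<in>I. rsign T i * x i)))"
proof -
  have "(\<Sum>i\<in>I. rsign (insert a T) i * x i) = (\<Sum>i\<in>I. rsign T i * x i)" for T
    using assms by (intro sum.cong) (auto simp: rsign_def)
  moreover have "rsign (insert a T) a = 1" for T by (simp add: rsign_def)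
  moreover have "rsign T a = -1" if "T \<subseteq> I" for T using that assms by (auto simp: rsign_def)
  ultimately show ?thesis
    using assms by (simp add: subset_avg_insert cong: subset_avg_cong)
qed

text \<open>
  The sum of the independent signs has mean \<open>\<Sum> (2 p i - 1) x i\<close> and variance
  \<open>\<Sum> 4 p i (1 - p i) (x i)\<^sup>2\<close>. The free point \<open>b\<close> is there for the induction: a new sign moves it.
\<close>
lemma rsign_sum_square:
  assumes "finite I"
  shows "subset_avg I p (\<lambda>T. ((\<Sum>i\<in>I. rsign T i * x i) - b)\<^sup>2) =
    (\<Sum>i\<in>I. 4 * p i * (1 - p i) * (x i)\<^sup>2) + ((\<Sum>i\<in>I. (2 * p i - 1) * x i) - b)\<^sup>2"
  using assms
proof (induction I arbitrary: b rule: finite_induct)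
  case (insert a I)
  have "subset_avg (insert a I) p (\<lambda>T. ((\<Sum>i\<in>insert a I. rsign T i * x i) - b)\<^sup>2) =
     p a * subset_avg I p (\<lambda>T. ((\<Sum>i\<in>I. rsign T i * x i) - (b - x a))\<^sup>2) +
     (1 - p a) * subset_avg I p (\<lambda>T. ((\<Sum>i\<in>I. rsign T i * x i) - (b + x a))\<^sup>2)"
    by (subst subset_avg_insert_rsign[OF insert(1,2), where \<phi>="\<lambda>s. (s - b)\<^sup>2"])
      (simp add: algebra_simps)
  also have "\<dots> = (\<Sum>i\<in>insert a I. 4 * p i * (1 - p i) * (x i)\<^sup>2) + ((\<Sum>i\<in>insert a I. (2 * p i - 1) * x i) - b)\<^sup>2"
    unfolding insert.IH using insert(1,2) by (simp add: power2_eq_square algebra_simps)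
  finally show ?case .
qed simp

lemma rsign_sum_square_half:
  assumes "finite I"
  shows "subset_avg I (\<lambda>_. 1/2) (\<lambda>T. (\<Sum>i\<in>I. rsign T i * x i)\<^sup>2) = (\<Sum>i\<in>I. (x i)\<^sup>2)"
  using rsign_sum_square[OF assms, of "\<lambda>_. 1/2" x 0] by simp

lemma rsign_sum_fourth:
  assumes "finite I"
  shows "subset_avg I (\<lambda>_. 1/2) (\<lambda>T. (\<Sum>i\<in>I. rsign T i * x i)^4) \<le> 3 * (\<Sum>i\<in>I. (x i)\<^sup>2)\<^sup>2"
  using assms
proof (induction I rule: finite_induct)
  case (insert a I)
  let ?S = "\<lambda>T. \<Sum>i\<in>I. rsign T i * x i" and ?q = "\<Sum>i\<in>I. (x i)\<^sup>2"
  let ?A = "subset_avg I (\<lambda>_. 1/2)"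
  have "subset_avg (insert a I) (\<lambda>_. 1/2) (\<lambda>T. (\<Sum>i\<in>insert a I. rsign T i * x i)^4) =
     1/2 * ?A (\<lambda>T. (x a + ?S T)^4) + 1/2 * ?A (\<lambda>T. (- x a + ?S T)^4)"
    by (subst subset_avg_insert_rsign[OF insert(1,2), where \<phi>="\<lambda>s. s^4"]) simp
  also have "\<dots> = ?A (\<lambda>T. 1/2 * (x a + ?S T)^4 + 1/2 * (- x a + ?S T)^4)"
    by (simp only: subset_avg_add subset_avg_cmult)
  also have "(\<lambda>T. 1/2 * (x a + ?S T)^4 + 1/2 * (- x a + ?S T)^4) =
      (\<lambda>T. ?S T^4 + (6 * (x a)\<^sup>2 * (?S T)\<^sup>2 + (x a)^4))"
    by (rule ext) (simp add: power4_eq_xxxx power2_eq_square algebra_simps)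
  also have "?A \<dots> = ?A (\<lambda>T. ?S T^4) + (6 * (x a)\<^sup>2 * ?q + (x a)^4)"
    by (simp only: subset_avg_add subset_avg_cmult rsign_sum_square_half[OF insert(1)] subset_avg_const[OF insert(1)])
  also have "\<dots> \<le> 3 * ?q\<^sup>2 + (6 * (x a)\<^sup>2 * ?q + (x a)^4)" using insert.IH by simp
  also have "\<dots> \<le> 3 * ((x a)\<^sup>2 + ?q)\<^sup>2"
  proof -
    have "3 * ((x a)\<^sup>2 + ?q)\<^sup>2 = 3 * ?q\<^sup>2 + (6 * (x a)\<^sup>2 * ?q + 3 * ((x a)\<^sup>2)\<^sup>2)"
      by (simp add: power2_sum algebra_simps)
    moreover have "(x a)^4 = ((x a)\<^sup>2)\<^sup>2" by (simp flip: power_mult)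
    ultimately show ?thesis using zero_le_power2[of "(x a)\<^sup>2"] by linarith
  qed
  finally show ?case using insert(1,2) by simp
qed simp

text \<open>
  A random sign sum is comparable to its square function with probability at least \<open>3/14\<close>
  (Paley and Zygmund). With \<open>z\<close> the squared sum divided by \<open>\<Sum> (x i)\<^sup>2\<close>, the parabola
  \<open>4/7 z - 1/14 z\<^sup>2 - 1/7\<close> lies below the indicator of \<open>z > 1/4\<close>: it is at most \<open>0\<close> for \<open>z \<le> 1/4\<close>, and its
  maximum, attained at \<open>z = 4\<close>, is \<open>1\<close>. Since \<open>z\<close> has mean \<open>1\<close> and second moment at most \<open>3\<close>, the
  parabola has mean at least \<open>4/7 - 3/14 - 1/7\<close>.
\<close>
lemma rsign_sum_not_small:
  assumes "finite I" "R \<ge> 0" "(\<Sum>i\<in>I. (x i)\<^sup>2) > R\<^sup>2"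
  shows "subset_avg I (\<lambda>_. 1/2) (\<lambda>T. of_bool (\<bar>\<Sum>i\<in>I. rsign T i * x i\<bar> > R / 2)) \<ge> 3/14"
proof -
  let ?S = "\<lambda>T. \<Sum>i\<in>I. rsign T i * x i" and ?q = "\<Sum>i\<in>I. (x i)\<^sup>2"
  let ?A = "subset_avg I (\<lambda>_. 1/2)"
  have q: "?q > 0" using assms by (smt (verit) zero_le_power2)
  have "3/14 \<le> (4/7/?q) * ?q - (1/14/?q\<^sup>2) * (3 * ?q\<^sup>2) - 1/7"
    using q by (simp add: field_simps)
  also have "\<dots> \<le> (4/7/?q) * ?q - (1/14/?q\<^sup>2) * ?A (\<lambda>T. ?S T^4) - 1/7"
    using mult_left_mono[OF rsign_sum_fourth[OF assms(1), of x], of "1/14/?q\<^sup>2"] by simp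
  also have "\<dots> = ?A (\<lambda>T. (4/7/?q) * (?S T)\<^sup>2 + ((-1/14/?q\<^sup>2) * ?S T^4 + (-1/7)))"
    unfolding subset_avg_add subset_avg_cmult rsign_sum_square_half[OF assms(1)] subset_avg_const[OF assms(1)]
    by simp
  also have "\<dots> \<le> ?A (\<lambda>T. of_bool (\<bar>?S T\<bar> > R / 2))"
  proof (rule subset_avg_mono)
    fix T
    define z where "z = (?S T)\<^sup>2 / ?q"
    have eq: "(4/7/?q) * (?S T)\<^sup>2 + ((-1/14/?q\<^sup>2) * ?S T^4 + (-1/7)) = 4/7*z - 1/14*z\<^sup>2 - 1/7"
      using q by (simp add: z_def power_divide flip: power_mult)
    have z1: "4/7*z - 1/14*z\<^sup>2 - 1/7 \<le> 1"
      using zero_le_power2[of "z - 4"] by (simp add: power2_eq_square algebra_simps)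
    show "(4/7/?q) * (?S T)\<^sup>2 + ((-1/14/?q\<^sup>2) * ?S T^4 + (-1/7)) \<le> of_bool (\<bar>?S T\<bar> > R / 2)"
    proof (cases "\<bar>?S T\<bar> > R / 2")
      case False
      then have "(?S T)\<^sup>2 \<le> (R/2)\<^sup>2"
        using assms by (subst abs_le_square_iff[symmetric]) auto
      then have "(?S T)\<^sup>2 \<le> ?q / 4" using assms by (simp add: power_divide)
      then have "z \<le> 1/4" using q by (simp add: z_def field_simps)
      then have "4/7*z - 1/14*z\<^sup>2 - 1/7 \<le> 0" using zero_le_power2[of z] by linarith
      with False eq show ?thesis by simp
    qed (use eq z1 in simp)
  qed simp
  finally show ?thesis .
qed

text \<open>
  Flipping the sign of \<open>x k\<close> alone changes the sum by \<open>2 \<bar>x k\<bar>\<close>, so at least one of the two sums is at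
  least \<open>\<bar>x k\<bar>\<close> in absolute value.
\<close>
lemma rsign_sum_toggle:
  assumes "finite I" "k \<in> I"
  shows "subset_avg I (\<lambda>_. 1/2) (\<lambda>T. of_bool (\<bar>\<Sum>i\<in>I. rsign T i * x i\<bar> \<ge> \<bar>x k\<bar>)) \<ge> 1/2"
proof -
  define J where "J = I - {k}"
  have J: "finite J" "k \<notin> J" "I = insert k J" using assms by (auto simp: J_def)
  let ?S = "\<lambda>T. \<Sum>i\<in>J. rsign T i * x i"
  let ?A = "subset_avg J (\<lambda>_. 1/2)"
  have "1/2 = 1/2 * ?A (\<lambda>T. 1)" by (simp add: subset_avg_const J)
  also have "\<dots> \<le> 1/2 * ?A (\<lambda>T. of_bool (\<bar>x k + ?S T\<bar> \<ge> \<bar>x k\<bar>) + of_bool (\<bar>- x k + ?S T\<bar> \<ge> \<bar>x k\<bar>))"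
    by (intro mult_left_mono subset_avg_mono) auto
  also have "\<dots> = subset_avg I (\<lambda>_. 1/2) (\<lambda>T. of_bool (\<bar>\<Sum>i\<in>I. rsign T i * x i\<bar> \<ge> \<bar>x k\<bar>))"
    unfolding J(3)
    by (subst subset_avg_insert_rsign[OF J(1,2), where \<phi>="\<lambda>s. of_bool (\<bar>s\<bar> \<ge> \<bar>x k\<bar>)"])
      (simp add: subset_avg_add)
  finally show ?thesis .
qed

lemma subset_avg_sum_mem:
  assumes "finite I"
  shows "subset_avg I (\<lambda>_. \<theta>) (\<lambda>T. \<Sum>i\<in>T. x i) = \<theta> * (\<Sum>i\<in>I. x i)"
  using assms
proof (induction I rule: finite_induct)
  case (insert a I)
  have "subset_avg I (\<lambda>_. \<theta>) (\<lambda>T. \<Sum>i\<in>insert a T. x i) = subset_avg I (\<lambda>_. \<theta>) (\<lambda>T. x a + (\<Sum>i\<in>T. x i))"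
    using insert(1,2) by (intro subset_avg_cong) (auto intro!: sum.insert intro: finite_subset)
  then show ?case using insert
    by (simp add: subset_avg_insert subset_avg_add subset_avg_const algebra_simps)
qed simp

lemma subset_avg_avoid:
  assumes "finite I" "S \<subseteq> I"
  shows "subset_avg I (\<lambda>_. \<theta>) (\<lambda>T. of_bool (S \<inter> T = {})) = (1 - \<theta>) ^ card S"
  using assms
proof (induction I arbitrary: S rule: finite_induct)
  case (insert a I)
  show ?case
  proof (cases "a \<in> S")
    case True
    define S' where "S' = S - {a}"
    have S': "S' \<subseteq> I" "S = insert a S'" "a \<notin> S'" "finite S'"
      using True insert finite_subset by (auto simp: S'_def)
    have "S \<inter> T = {} \<longleftrightarrow> S' \<inter> T = {}" if "T \<subseteq> I" for T using that S' insert by auto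
    then have "subset_avg I (\<lambda>_. \<theta>) (\<lambda>T. of_bool (S \<inter> T = {})) = (1 - \<theta>) ^ card S'"
      using insert.IH[OF S'(1)] by (simp cong: subset_avg_cong)
    then show ?thesis using True insert S'
      by (simp add: subset_avg_insert subset_avg_const)
  next
    case False
    then have "S \<subseteq> I" using insert by auto
    moreover have "S \<inter> insert a T = {} \<longleftrightarrow> S \<inter> T = {}" for T using False by auto
    ultimately show ?thesis using insert
      by (simp add: subset_avg_insert algebra_simps)
  qed
qed simp

lemma subset_avg_half_eq:
  assumes "finite I"
  shows "subset_avg I (\<lambda>_. 1/2) \<phi> = (\<Sum>T\<in>Pow I. \<phi> T) / 2 ^ card I"
  unfolding subset_avg_def sum_divide_distrib
proof (intro sum.cong refl)
  fix T assume "T \<in> Pow I"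
  then have "card T + card (I - T) = card I"
    using assms by (metis PowD card_Diff_subset card_mono finite_subset le_add_diff_inverse)
  then show "(\<Prod>i\<in>T. 1/2) * (\<Prod>i\<in>I-T. 1 - 1/2) * \<phi> T = \<phi> T / 2 ^ card I"
    by (simp add: power_one_over field_simps flip: power_add)
qed

context prob_space begin

text \<open>
  Fubini for the finite average and the probability space. In its consequences below
  the average replaces a choice of \<open>T\<close> that would depend on \<open>\<omega>\<close>: an event of positive probability under
  the average is controlled by the events for the single \<open>T\<close>, which do not depend on \<open>\<omega>\<close>.
\<close>
lemma subset_avg_prob:
  assumes "finite I" "\<And>T. T \<subseteq> I \<Longrightarrow> {\<omega>\<in>space M. P T \<omega>} \<in> events"
  shows "subset_avg I p (\<lambda>T. prob {\<omega>\<in>space M. P T \<omega>}) =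
     (\<integral>\<omega>. subset_avg I p (\<lambda>T. of_bool (P T \<omega>)) \<partial>M)"
    and "integrable M (\<lambda>\<omega>. subset_avg I p (\<lambda>T. of_bool (P T \<omega>)))"
proof -
  have *: "prob {\<omega>\<in>space M. P T \<omega>} = (\<integral>\<omega>. of_bool (P T \<omega>) \<partial>M)"
    "integrable M (\<lambda>\<omega>. of_bool (P T \<omega>) :: real)" if "T \<subseteq> I" for T
  proof -
    have i: "integrable M (indicator {\<omega>\<in>space M. P T \<omega>} :: _ \<Rightarrow> real)"
      using assms(2)[OF that] by (intro integrable_real_indicator) (auto simp: less_top[symmetric])
    have "integrable M (\<lambda>\<omega>. of_bool (P T \<omega>) :: real) \<longleftrightarrow> integrable M (indicator {\<omega>\<in>space M. P T \<omega>} :: _ \<Rightarrow> real)"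
      by (intro Bochner_Integration.integrable_cong) (auto simp: indicator_def)
    with i show "integrable M (\<lambda>\<omega>. of_bool (P T \<omega>) :: real)" by simp
    have "(\<integral>\<omega>. of_bool (P T \<omega>) \<partial>M) = (\<integral>\<omega>. (indicator {\<omega>\<in>space M. P T \<omega>} \<omega> :: real) \<partial>M)"
      by (intro Bochner_Integration.integral_cong) (auto simp: indicator_def)
    then show "prob {\<omega>\<in>space M. P T \<omega>} = (\<integral>\<omega>. of_bool (P T \<omega>) \<partial>M)"
      using assms(2)[OF that] by (simp add: Int_absorb1 subset_eq)
  qed
  show "integrable M (\<lambda>\<omega>. subset_avg I p (\<lambda>T. of_bool (P T \<omega>)))"
    unfolding subset_avg_def using * by (intro Bochner_Integration.integrable_sum integrable_mult_right) auto
  show "subset_avg I p (\<lambda>T. prob {\<omega>\<in>space M. P T \<omega>}) =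
     (\<integral>\<omega>. subset_avg I p (\<lambda>T. of_bool (P T \<omega>)) \<partial>M)"
    unfolding subset_avg_def using *
    by (subst Bochner_Integration.integral_sum) (auto intro!: sum.cong)
qed

lemma prob_le_subset_avg:
  assumes "finite I" "\<And>i. i \<in> I \<Longrightarrow> 0 \<le> p i \<and> p i \<le> 1"
    and P: "\<And>T. T \<subseteq> I \<Longrightarrow> {\<omega>\<in>space M. P T \<omega>} \<in> events"
    and H: "H \<in> events" and AE: "AE \<omega> in M. \<omega> \<in> H \<longrightarrow> c \<le> subset_avg I p (\<lambda>T. of_bool (P T \<omega>))"
    and "c \<ge> 0"
  shows "c * prob H \<le> subset_avg I p (\<lambda>T. prob {\<omega>\<in>space M. P T \<omega>})"
proof -
  have "c * prob H = (\<integral>\<omega>. c * indicator H \<omega> \<partial>M)"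
    using H by (simp add: Int_absorb1 sets.sets_into_space)
  also have "\<dots> \<le> (\<integral>\<omega>. subset_avg I p (\<lambda>T. of_bool (P T \<omega>)) \<partial>M)"
  proof (rule integral_mono_AE)
    show "integrable M (\<lambda>\<omega>. c * indicator H \<omega>)"
      using H by (intro integrable_mult_right integrable_real_indicator) (auto simp: less_top[symmetric])
    show "integrable M (\<lambda>\<omega>. subset_avg I p (\<lambda>T. of_bool (P T \<omega>)))"
      using assms by (intro subset_avg_prob) auto
    have "0 \<le> subset_avg I p (\<lambda>T. of_bool (P T \<omega>))" for \<omega>
      using subset_avg_mono[of I p "\<lambda>_. 0" "\<lambda>T. of_bool (P T \<omega>)"] assms
      by (simp add: subset_avg_const)
    then show "AE \<omega> in M. c * indicator H \<omega> \<le> subset_avg I p (\<lambda>T. of_bool (P T \<omega>))"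
      using AE by (auto simp: indicator_def)
  qed
  finally show ?thesis using subset_avg_prob(1)[OF assms(1) P] by simp
qed

lemma prob_le_of_subset_avg:
  assumes "finite I" "\<And>i. i \<in> I \<Longrightarrow> 0 \<le> p i \<and> p i \<le> 1"
    and P: "\<And>T. T \<subseteq> I \<Longrightarrow> {\<omega>\<in>space M. P T \<omega>} \<in> events"
    and H: "H \<in> events" and AE: "AE \<omega> in M. \<omega> \<in> H \<longrightarrow> c \<le> subset_avg I p (\<lambda>T. of_bool (P T \<omega>))"
    and "c > 0" and le: "\<And>T. T \<subseteq> I \<Longrightarrow> prob {\<omega>\<in>space M. P T \<omega>} \<le> \<delta>"
  shows "prob H \<le> \<delta> / c"
proof -
  have "c * prob H \<le> subset_avg I p (\<lambda>T. prob {\<omega>\<in>space M. P T \<omega>})"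
    using assms by (intro prob_le_subset_avg) auto
  also have "\<dots> \<le> subset_avg I p (\<lambda>T. \<delta>)"
    using assms by (intro subset_avg_mono) auto
  finally show ?thesis using assms by (simp add: subset_avg_const field_simps)
qed

lemma subset_avg_prob_le:
  assumes "finite I"
    and P: "\<And>T. T \<subseteq> I \<Longrightarrow> {\<omega>\<in>space M. P T \<omega>} \<in> events"
    and AE: "AE \<omega> in M. subset_avg I p (\<lambda>T. of_bool (P T \<omega>)) \<le> c"
  shows "subset_avg I p (\<lambda>T. prob {\<omega>\<in>space M. P T \<omega>}) \<le> c"
proof -
  have "integrable M (\<lambda>\<omega>. subset_avg I p (\<lambda>T. of_bool (P T \<omega>)))"
    using assms(1) P by (rule subset_avg_prob(2))
  then have "(\<integral>\<omega>. subset_avg I p (\<lambda>T. of_bool (P T \<omega>)) \<partial>M) \<le> c"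
    using AE by (intro integral_le_const) auto
  then show ?thesis using subset_avg_prob(1)[of I P p] assms(1) P by simp
qed

end

section \<open>Square functions of finite families of random variables\<close>

context prob_space begin

lemma tight_random_variable:
  fixes X :: "'a \<Rightarrow> real"
  assumes [measurable]: "X \<in> borel_measurable M" and "\<delta> > 0"
  shows "\<exists>B>0. prob {\<omega>\<in>space M. \<bar>X \<omega>\<bar> > B} < \<delta>"
proof -
  let ?A = "\<lambda>n::nat. {\<omega>\<in>space M. \<bar>X \<omega>\<bar> > real n}"
  have "(\<lambda>n. prob (?A n)) \<longlonglongrightarrow> prob (\<Inter>n. ?A n)"
    by (intro finite_Lim_measure_decseq) (auto simp: decseq_def)
  moreover have "(\<Inter>n. ?A n) = {}"
  proof -
    have "\<exists>n. \<not> \<bar>X \<omega>\<bar> > real n" for \<omega> using real_arch_simple[of "\<bar>X \<omega>\<bar>"] by (simp add: not_less)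
    then show ?thesis by auto
  qed
  ultimately have "(\<lambda>n. prob (?A n)) \<longlonglongrightarrow> 0" by simp
  then have "\<forall>\<^sub>F n in sequentially. prob (?A n) < \<delta>"
    using assms(2) by (rule order_tendstoD(2))
  then have "\<forall>\<^sub>F n in sequentially. prob (?A n) < \<delta> \<and> n > 0"
    using eventually_gt_at_top[of "0::nat"] by eventually_elim auto
  then obtain n where "prob (?A n) < \<delta>" "n > 0"
    by (auto dest!: eventually_happens)
  then show ?thesis by (intro exI[of _ "real n"]) auto
qed

text \<open>
  An iteration in the spirit of Grothendieck's inequality. Let \<open>L d\<close> be the combination of
  the \<open>w i\<close> with coefficients \<open>d\<close>, let \<open>Q\<close> be the square function of the family \<open>L (c k)\<close>, and form the random
  sign combinations \<open>g T\<close> of the \<open>c k\<close>. If \<open>Q\<close> exceeds \<open>R\<close>, then \<open>\<bar>L (g T)\<bar>\<close> exceeds \<open>R/2\<close> for a fixed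
  proportion of the \<open>T\<close>. Truncate \<open>g T\<close> at the level \<open>43\<close>. The truncated part \<open>u T\<close> is bounded, so the
  weak type assumption applies to it and costs a multiple of \<open>C / R\<close>. By the fourth moment bound the
  remainder \<open>v T\<close> is small in mean square over \<open>T\<close>; after rescaling, the remainders form
  a family \<open>c'\<close> that again satisfies the hypothesis, and its square function exceeds \<open>2 R\<close> wherever the
  truncated parts do not account for the size of \<open>Q\<close>. After \<open>j\<close> steps
  the level has grown to \<open>2^j R\<close>, and the costs form a geometric series. The last term
  is the bound of Cauchy and Schwarz, which is uniform over all families.
\<close>
lemma square_function_iteration:
  fixes w :: "'i \<Rightarrow> 'a \<Rightarrow> real" and c :: "nat \<Rightarrow> 'i \<Rightarrow> real"
  assumes I: "finite I" and w [measurable]: "\<And>i. i \<in> I \<Longrightarrow> w i \<in> borel_measurable M"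
    and G [measurable]: "G \<in> events"
    and weak: "\<And>c r. (\<And>i. i \<in> I \<Longrightarrow> \<bar>c i\<bar> \<le> 1) \<Longrightarrow> r > 0 \<Longrightarrow>
      prob {\<omega>\<in>space M. \<omega> \<in> G \<and> \<bar>\<Sum>i\<in>I. c i * w i \<omega>\<bar> > r} \<le> C / r"
    and sq: "\<And>i. i \<in> I \<Longrightarrow> (\<Sum>k<n. (c k i)\<^sup>2) \<le> 1" and R: "R > 0"
  shows "prob {\<omega>\<in>space M. \<omega> \<in> G \<and> (\<Sum>k<n. (\<Sum>i\<in>I. c k i * w i \<omega>)\<^sup>2) > R\<^sup>2} \<le>
    (\<Sum>l<j. 4816/3 * C / (2^l * R)) +
    prob {\<omega>\<in>space M. real (card I) * (\<Sum>i\<in>I. (w i \<omega>)\<^sup>2) > (2^j * R)\<^sup>2}"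
  using sq R
proof (induction j arbitrary: n c R)
  case (0 n c R)
  have "(\<Sum>k<n. (\<Sum>i\<in>I. c k i * w i \<omega>)\<^sup>2) \<le> real (card I) * (\<Sum>i\<in>I. (w i \<omega>)\<^sup>2)" for \<omega>
  proof -
    have "(\<Sum>k<n. (\<Sum>i\<in>I. c k i * w i \<omega>)\<^sup>2) \<le> (\<Sum>k<n. (\<Sum>i\<in>I. (c k i)\<^sup>2) * (\<Sum>i\<in>I. (w i \<omega>)\<^sup>2))"
      by (intro sum_mono Cauchy_Schwarz_ineq_sum)
    also have "\<dots> = (\<Sum>i\<in>I. \<Sum>k<n. (c k i)\<^sup>2) * (\<Sum>i\<in>I. (w i \<omega>)\<^sup>2)"
      by (subst sum.swap) (simp add: sum_distrib_right)
    also have "\<dots> \<le> (\<Sum>i\<in>I. 1) * (\<Sum>i\<in>I. (w i \<omega>)\<^sup>2)"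
      using 0 by (intro mult_right_mono sum_mono sum_nonneg) auto
    finally show ?thesis by simp
  qed
  then show ?case by (auto intro!: finite_measure_mono dest: less_le_trans)
next
  case (Suc j n c R)
  note cc = Suc.prems
  let ?N = "{..<n}"
  let ?A = "subset_avg ?N (\<lambda>_. 1/2)"
  define L where "L = (\<lambda>d \<omega>. \<Sum>i\<in>I. d i * w i \<omega>)"
  have L_meas [measurable]: "L d \<in> borel_measurable M" for d unfolding L_def by measurable
  define g where "g = (\<lambda>T i. \<Sum>k<n. rsign T k * c k i)"
  define u where "u = (\<lambda>T i. max (-43) (min 43 (g T i)))"
  define v where "v = (\<lambda>T i. g T i - u T i)"
  have Lg: "L (g T) \<omega> = (\<Sum>k<n. rsign T k * L (c k) \<omega>)" for T \<omega>
    unfolding L_def g_def sum_distrib_left sum_distrib_right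
    by (subst sum.swap) (simp add: mult.assoc)
  have Luv: "L (g T) \<omega> = L (u T) \<omega> + L (v T) \<omega>" for T \<omega>
    unfolding L_def v_def by (simp add: algebra_simps sum_subtractf)
  \<comment> \<open>\<open>1849 = 43\<^sup>2\<close>: where \<open>v T\<close> does not vanish, \<open>\<bar>g T\<bar>\<close> is at least \<open>43\<close>\<close>
  have v_sq: "(v T i)\<^sup>2 \<le> (1/1849) * (g T i)^4" for T i
  proof (cases "\<bar>g T i\<bar> \<le> 43")
    case True then show ?thesis by (simp add: v_def u_def)
  next
    case False
    have "\<bar>v T i\<bar> \<le> \<bar>g T i\<bar>" using False by (auto simp: v_def u_def)
    then have "(v T i)\<^sup>2 \<le> (g T i)\<^sup>2" by (simp add: abs_le_square_iff)
    also have "\<dots> * 1849 \<le> (g T i)\<^sup>2 * (g T i)\<^sup>2"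
      using False abs_le_square_iff[of 43 "g T i"] by (intro mult_left_mono) auto
    then have "(g T i)\<^sup>2 \<le> (1/1849) * (g T i)^4" by (simp flip: power_add)
    finally show ?thesis .
  qed
  have v_avg: "?A (\<lambda>T. (v T i)\<^sup>2) \<le> 3/1849" if i: "i \<in> I" for i
  proof -
    have "?A (\<lambda>T. (v T i)\<^sup>2) \<le> ?A (\<lambda>T. (1/1849) * (g T i)^4)"
      using v_sq by (intro subset_avg_mono) auto
    also have "\<dots> \<le> (1/1849) * (3 * (\<Sum>k<n. (c k i)\<^sup>2)\<^sup>2)"
      unfolding subset_avg_cmult g_def by (intro mult_left_mono rsign_sum_fourth) auto
    also have "\<dots> \<le> (1/1849) * (3 * 1)"
      using cc(1)[OF i] by (intro mult_left_mono power_le_one) (auto intro: sum_nonneg)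
    finally show ?thesis by simp
  qed
  \<comment> \<open>The remainders are indexed by sets of indices; they are renumbered to allow induction.\<close>
  obtain b :: "nat \<Rightarrow> nat set" where b: "bij_betw b {..<2^n} (Pow ?N)"
    using ex_bij_betw_nat_finite[of "Pow ?N"] by (auto simp: card_Pow atLeast0LessThan)
  \<comment> \<open>\<open>2^n\<close> turns the average into a sum, and \<open>1849/3\<close> normalises the bound \<open>v_avg\<close> to \<open>1\<close>\<close>
  define \<kappa> :: real where "\<kappa> = sqrt (1849 / 3 / 2^n)"
  have \<kappa>: "\<kappa>\<^sup>2 = 1849 / 3 / 2^n" by (simp add: \<kappa>_def)
  define c' where "c' = (\<lambda>l i. \<kappa> * v (b l) i)"
  have reindex: "(\<Sum>l<2^n. (\<kappa> * \<phi> (b l))\<^sup>2) = 1849/3 * ?A (\<lambda>T. (\<phi> T)\<^sup>2)" for \<phi> :: "nat set \<Rightarrow> real"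
  proof -
    have "(\<Sum>l<2^n. (\<kappa> * \<phi> (b l))\<^sup>2) = \<kappa>\<^sup>2 * (\<Sum>l<2^n. (\<phi> (b l))\<^sup>2)"
      by (simp add: power_mult_distrib sum_distrib_left)
    also have "(\<Sum>l<2^n. (\<phi> (b l))\<^sup>2) = (\<Sum>T\<in>Pow ?N. (\<phi> T)\<^sup>2)"
      using sum.reindex_bij_betw[OF b, of "\<lambda>T. (\<phi> T)\<^sup>2"] by simp
    finally show ?thesis by (simp add: \<kappa> subset_avg_half_eq)
  qed
  have c'_sq: "(\<Sum>l<2^n. (c' l i)\<^sup>2) \<le> 1" if "i \<in> I" for i
    unfolding c'_def reindex[of "\<lambda>T. v T i"] using v_avg[OF that] by simp
  have Lc': "(\<Sum>l<2^n. (L (c' l) \<omega>)\<^sup>2) = 1849/3 * ?A (\<lambda>T. (L (v T) \<omega>)\<^sup>2)" for \<omega>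
  proof -
    have "L (c' l) \<omega> = \<kappa> * L (v (b l)) \<omega>" for l
      by (simp add: L_def c'_def sum_distrib_left mult.assoc)
    then show ?thesis using reindex[of "\<lambda>T. L (v T) \<omega>"] by simp
  qed
  let ?U = "{\<omega>\<in>space M. \<omega> \<in> G \<and> ?A (\<lambda>T. of_bool (\<bar>L (u T) \<omega>\<bar> > R / 4)) \<ge> 3/28}"
  let ?V = "{\<omega>\<in>space M. \<omega> \<in> G \<and> (\<Sum>l<2^n. (L (c' l) \<omega>)\<^sup>2) > (2 * R)\<^sup>2}"
  have split: "?A (\<lambda>T. of_bool (\<bar>L (u T) \<omega>\<bar> > R / 4)) \<ge> 3/28 \<or> (\<Sum>l<2^n. (L (c' l) \<omega>)\<^sup>2) > (2 * R)\<^sup>2"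
    if Q: "(\<Sum>k<n. (L (c k) \<omega>)\<^sup>2) > R\<^sup>2" for \<omega>
  proof -
    have "3/14 \<le> ?A (\<lambda>T. of_bool (\<bar>L (g T) \<omega>\<bar> > R / 2))"
      unfolding Lg using Q cc(2) by (intro rsign_sum_not_small) auto
    also have "\<dots> \<le> ?A (\<lambda>T. of_bool (\<bar>L (u T) \<omega>\<bar> > R / 4) + of_bool ((L (v T) \<omega>)\<^sup>2 \<ge> (R/4)\<^sup>2))"
    proof (rule subset_avg_mono)
      fix T
      have "\<bar>L (u T) \<omega>\<bar> > R / 4 \<or> (L (v T) \<omega>)\<^sup>2 \<ge> (R/4)\<^sup>2" if "\<bar>L (g T) \<omega>\<bar> > R / 2"
      proof (rule disjCI)
        assume "\<not> (L (v T) \<omega>)\<^sup>2 \<ge> (R/4)\<^sup>2"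
        then have "\<bar>L (v T) \<omega>\<bar> < R / 4" using abs_le_square_iff[of "R/4" "L (v T) \<omega>"] cc(2) by auto
        then show "\<bar>L (u T) \<omega>\<bar> > R / 4" using that Luv[of T \<omega>] by linarith
      qed
      then show "of_bool (\<bar>L (g T) \<omega>\<bar> > R / 2) \<le>
        of_bool (\<bar>L (u T) \<omega>\<bar> > R / 4) + (of_bool ((L (v T) \<omega>)\<^sup>2 \<ge> (R/4)\<^sup>2) :: real)"
        by auto
    qed simp
    also have "\<dots> \<le> ?A (\<lambda>T. of_bool (\<bar>L (u T) \<omega>\<bar> > R / 4)) + ?A (\<lambda>T. (L (v T) \<omega>)\<^sup>2) / (R/4)\<^sup>2"
      unfolding subset_avg_add using cc(2) by (intro add_left_mono subset_avg_markov) auto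
    finally have *: "3/14 \<le> ?A (\<lambda>T. of_bool (\<bar>L (u T) \<omega>\<bar> > R / 4)) + ?A (\<lambda>T. (L (v T) \<omega>)\<^sup>2) / (R/4)\<^sup>2" .
    \<comment> \<open>\<open>43\<close> is large enough for the second term to be at most half of \<open>3/14\<close>, namely \<open>192/1849 \<le> 3/28\<close>\<close>
    show ?thesis
    proof (rule disjCI)
      assume "\<not> (\<Sum>l<2^n. (L (c' l) \<omega>)\<^sup>2) > (2 * R)\<^sup>2"
      then have "?A (\<lambda>T. (L (v T) \<omega>)\<^sup>2) \<le> 12/1849 * R\<^sup>2" unfolding Lc' by (simp add: power_mult_distrib)
      then have "?A (\<lambda>T. (L (v T) \<omega>)\<^sup>2) / (R/4)\<^sup>2 \<le> 12/1849 * R\<^sup>2 / (R/4)\<^sup>2"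
        using cc(2) by (intro divide_right_mono) auto
      also have "\<dots> = 192/1849" using cc(2) by (simp add: power_divide field_simps)
      also have "\<dots> \<le> 3/28" by simp
      finally show "?A (\<lambda>T. of_bool (\<bar>L (u T) \<omega>\<bar> > R / 4)) \<ge> 3/28" using * by linarith
    qed
  qed
  have [measurable]: "(\<lambda>\<omega>. ?A (\<lambda>T. of_bool (\<bar>L (u T) \<omega>\<bar> > R / 4))) \<in> borel_measurable M"
    by (intro borel_measurable_integrable subset_avg_prob(2)) auto
  have U_ev: "?U \<in> events" by measurable
  have V_ev: "?V \<in> events" by measurable
  have U: "prob ?U \<le> (C / (R/172)) / (3/28)"
  proof (rule prob_le_of_subset_avg[where I = ?N and p = "\<lambda>_. 1/2"
      and P = "\<lambda>T \<omega>. \<omega> \<in> G \<and> \<bar>L (u T) \<omega>\<bar> > R / 4"])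
    show "prob {\<omega>\<in>space M. \<omega> \<in> G \<and> \<bar>L (u T) \<omega>\<bar> > R / 4} \<le> C / (R/172)" for T
    proof -
      have "\<bar>L (u T) \<omega>\<bar> > R / 4 \<longleftrightarrow> \<bar>\<Sum>i\<in>I. (u T i / 43) * w i \<omega>\<bar> > R / 172" for \<omega>
      proof -
        have "(\<Sum>i\<in>I. (u T i / 43) * w i \<omega>) = L (u T) \<omega> / 43"
          by (simp add: L_def sum_divide_distrib)
        then show ?thesis unfolding abs_divide by auto
      qed
      then show ?thesis using cc(2) weak[of "\<lambda>i. u T i / 43" "R/172"] by (auto simp: u_def)
    qed
    show "?U \<in> events" by (rule U_ev)
  qed auto
  have "prob {\<omega>\<in>space M. \<omega> \<in> G \<and> (\<Sum>k<n. (L (c k) \<omega>)\<^sup>2) > R\<^sup>2} \<le> prob (?U \<union> ?V)"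
    using split sets.Un[OF U_ev V_ev] by (intro finite_measure_mono) blast+
  also have "\<dots> \<le> prob ?U + prob ?V" using U_ev V_ev by (rule measure_Un_le)
  also have "prob ?V \<le> (\<Sum>l<j. 4816/3 * C / (2^l * (2 * R))) +
    prob {\<omega>\<in>space M. real (card I) * (\<Sum>i\<in>I. (w i \<omega>)\<^sup>2) > (2^j * (2 * R))\<^sup>2}"
    unfolding L_def by (rule Suc.IH) (use c'_sq cc(2) in auto)
  finally have f1: "prob {\<omega>\<in>space M. \<omega> \<in> G \<and> (\<Sum>k<n. (L (c k) \<omega>)\<^sup>2) > R\<^sup>2} \<le>
    4816/3 * C / R + ((\<Sum>l<j. 4816/3 * C / (2^l * (2 * R))) +
    prob {\<omega>\<in>space M. real (card I) * (\<Sum>i\<in>I. (w i \<omega>)\<^sup>2) > (2^j * (2 * R))\<^sup>2})"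
    using U by simp
  have f2: "(\<Sum>l<Suc j. 4816/3 * C / (2^l * R)) = 4816/3 * C / R + (\<Sum>l<j. 4816/3 * C / (2^l * (2 * R)))"
    unfolding sum.lessThan_Suc_shift by (simp add: mult.assoc)
  have f3: "2 ^ Suc j * R = 2^j * (2 * R)" by simp
  show ?case unfolding f2 f3 using f1 unfolding L_def by linarith
qed

text \<open>
  The number of iteration steps tends to infinity. The last term of the iteration vanishes in the limit
  because the \<open>w i\<close> are fixed.
\<close>
lemma square_function_weak_type:
  fixes w :: "'i \<Rightarrow> 'a \<Rightarrow> real" and c :: "nat \<Rightarrow> 'i \<Rightarrow> real"
  assumes I: "finite I" and w [measurable]: "\<And>i. i \<in> I \<Longrightarrow> w i \<in> borel_measurable M"
    and G [measurable]: "G \<in> events" and "C \<ge> 0"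
    and weak: "\<And>c r. (\<And>i. i \<in> I \<Longrightarrow> \<bar>c i\<bar> \<le> 1) \<Longrightarrow> r > 0 \<Longrightarrow>
      prob {\<omega>\<in>space M. \<omega> \<in> G \<and> \<bar>\<Sum>i\<in>I. c i * w i \<omega>\<bar> > r} \<le> C / r"
    and sq: "\<And>i. i \<in> I \<Longrightarrow> (\<Sum>k<n. (c k i)\<^sup>2) \<le> 1" and R: "R > 0"
  shows "prob {\<omega>\<in>space M. \<omega> \<in> G \<and> (\<Sum>k<n. (\<Sum>i\<in>I. c k i * w i \<omega>)\<^sup>2) > R\<^sup>2} \<le> 9632/3 * C / R"
proof (rule field_le_epsilon)
  fix e :: real assume "e > 0"
  let ?X = "\<lambda>\<omega>. real (card I) * (\<Sum>i\<in>I. (w i \<omega>)\<^sup>2)"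
  obtain B where B: "B > 0" "prob {\<omega>\<in>space M. \<bar>?X \<omega>\<bar> > B} < e"
    using tight_random_variable[of ?X e] \<open>e > 0\<close> by auto
  obtain j where j: "(sqrt B / R) < 2^j" using real_arch_pow[of 2 "sqrt B / R"] by auto
  then have "sqrt B < 2^j * R" using R by (simp add: field_simps)
  then have "(sqrt B)\<^sup>2 < (2^j * R)\<^sup>2" using B by (intro power_strict_mono) auto
  then have "B < (2^j * R)\<^sup>2" using B by simp
  then have "prob {\<omega>\<in>space M. ?X \<omega> > (2^j * R)\<^sup>2} \<le> prob {\<omega>\<in>space M. \<bar>?X \<omega>\<bar> > B}"
    by (intro finite_measure_mono) auto
  moreover have "(\<Sum>l<j. 4816/3 * C / (2^l * R)) \<le> 9632/3 * C / R"
  proof -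
    have "(\<Sum>l<j. 4816/3 * C / (2^l * R)) = (4816/3 * C / R) * (\<Sum>l<j. (1/2)^l)"
      unfolding sum_distrib_left by (intro sum.cong) (auto simp: power_one_over)
    also have "(\<Sum>l<j. (1/2::real)^l) \<le> 2" by (simp add: sum_gp_strict)
    then have "(4816/3 * C / R) * (\<Sum>l<j. (1/2)^l) \<le> (4816/3 * C / R) * 2"
      using R \<open>C \<ge> 0\<close> by (intro mult_left_mono) auto
    finally show ?thesis by simp
  qed
  moreover have step: "prob {\<omega>\<in>space M. \<omega> \<in> G \<and> (\<Sum>k<n. (\<Sum>i\<in>I. c k i * w i \<omega>)\<^sup>2) > R\<^sup>2} \<le>
    (\<Sum>l<j. 4816/3 * C / (2^l * R)) + prob {\<omega>\<in>space M. ?X \<omega> > (2^j * R)\<^sup>2}"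
    by (rule square_function_iteration) (fact I w G weak sq R)+
  ultimately show "prob {\<omega>\<in>space M. \<omega> \<in> G \<and> (\<Sum>k<n. (\<Sum>i\<in>I. c k i * w i \<omega>)\<^sup>2) > R\<^sup>2} \<le> 9632/3 * C / R + e"
    using step B(2) by linarith
qed

text \<open>
  Nikishin's theorem for the combinations \<open>L c\<close> of finitely many random variables: boundedness in
  probability improves to a weak type estimate outside a small set. The bad events, on which some
  \<open>\<bar>L c\<bar>\<close> exceeds \<open>r\<close> although the event has probability at least \<open>R / r\<close>, cannot add up to much when they are
  disjoint: weighting their coefficient vectors proportionally to the probabilities gives a convex
  combination that, with random signs, is larger than \<open>R\<close> at every point of the union for at least half of the signs.
  Removing a maximal disjoint family of bad events leaves the set \<open>G\<close>.
\<close>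
lemma nikishin_finite:
  fixes w :: "'i \<Rightarrow> 'a \<Rightarrow> real"
  assumes I: "finite I" and w [measurable]: "\<And>i. i \<in> I \<Longrightarrow> w i \<in> borel_measurable M"
    and "R > 0"
    and bdd: "\<And>c. (\<And>i. i \<in> I \<Longrightarrow> \<bar>c i\<bar> \<le> 1) \<Longrightarrow>
      prob {\<omega>\<in>space M. \<bar>\<Sum>i\<in>I. c i * w i \<omega>\<bar> > R} \<le> \<delta>"
  shows "\<exists>G\<in>events. prob (space M - G) \<le> 2 * \<delta> \<and>
    (\<forall>c r. (\<forall>i\<in>I. \<bar>c i\<bar> \<le> 1) \<longrightarrow> r > 0 \<longrightarrow>
      prob {\<omega>\<in>space M. \<omega> \<in> G \<and> \<bar>\<Sum>i\<in>I. c i * w i \<omega>\<bar> > r} \<le> R / r)"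
proof -
  define L where "L = (\<lambda>d \<omega>. \<Sum>i\<in>I. d i * w i \<omega>)"
  have L_meas [measurable]: "L d \<in> borel_measurable M" for d unfolding L_def by measurable
  define bad where "bad = (\<lambda>H (c::'i \<Rightarrow> real) r. H \<in> events \<and> (\<forall>i\<in>I. \<bar>c i\<bar> \<le> 1) \<and> (0::real) < r \<and>
    R \<le> r * prob H \<and> (\<forall>\<omega>\<in>H. \<bar>L c \<omega>\<bar> > r))"
  define fam where "fam = (\<lambda>E. \<exists>(n::nat) H c r. (\<forall>k<n. bad (H k) (c k) (r k)) \<and>
    disjoint_family_on H {..<n} \<and> E = (\<Union>k<n. H k))"
  have fam_events: "E \<in> events" if "fam E" for E
    using that unfolding fam_def bad_def by auto
  have fam_prob: "prob E \<le> 2 * \<delta>" if "fam E" for E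
  proof (cases "prob E = 0")
    case True
    have "0 \<le> \<delta>" using bdd[of "\<lambda>_. 0"] by (smt (verit) measure_nonneg)
    with True show ?thesis by simp
  next
    case False
    then have pE: "prob E > 0" by (simp add: zero_less_measure_iff)
    obtain n :: nat and H c r where bad: "\<And>k. k < n \<Longrightarrow> bad (H k) (c k) (r k)"
      and disj: "disjoint_family_on H {..<n}" and E: "E = (\<Union>k<n. H k)"
      using \<open>fam E\<close> unfolding fam_def by metis
    define \<alpha> where "\<alpha> = (\<lambda>k. prob (H k) / prob E)"
    have \<alpha>: "\<alpha> k \<ge> 0" for k by (simp add: \<alpha>_def)
    have "(\<Sum>k<n. prob (H k)) = prob E"
      unfolding E using bad disj by (intro finite_measure_finite_Union[symmetric]) (auto simp: bad_def)
    then have sum_\<alpha>: "(\<Sum>k<n. \<alpha> k) = 1" using pE by (simp add: \<alpha>_def flip: sum_divide_distrib)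
    define h where "h = (\<lambda>T i. \<Sum>k<n. rsign T k * (\<alpha> k * c k i))"
    have h: "\<bar>h T i\<bar> \<le> 1" if "i \<in> I" for T i
    proof -
      have "\<bar>h T i\<bar> \<le> (\<Sum>k<n. \<bar>rsign T k * (\<alpha> k * c k i)\<bar>)" unfolding h_def by (rule sum_abs)
      also have "\<dots> \<le> (\<Sum>k<n. \<alpha> k)"
      proof (rule sum_mono)
        fix k assume "k \<in> {..<n}"
        then have "\<bar>c k i\<bar> \<le> 1" using bad[of k] that by (auto simp: bad_def)
        then have "\<alpha> k * \<bar>c k i\<bar> \<le> \<alpha> k" using \<alpha>[of k] by (simp add: mult_left_le)
        then show "\<bar>rsign T k * (\<alpha> k * c k i)\<bar> \<le> \<alpha> k" using \<alpha>[of k] by (simp add: rsign_def abs_mult)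
      qed
      finally show ?thesis using sum_\<alpha> by simp
    qed
    have Lh: "L (h T) \<omega> = (\<Sum>k<n. rsign T k * (\<alpha> k * L (c k) \<omega>))" for T \<omega>
      unfolding L_def h_def sum_distrib_left sum_distrib_right
      by (subst sum.swap) (simp add: mult.assoc)
    have "prob E \<le> \<delta> / (1/2)"
    proof (rule prob_le_of_subset_avg[where I = "{..<n}" and p = "\<lambda>_. 1/2"
          and P = "\<lambda>T \<omega>. \<bar>L (h T) \<omega>\<bar> > R"])
      show "prob {\<omega>\<in>space M. \<bar>L (h T) \<omega>\<bar> > R} \<le> \<delta>" for T
        unfolding L_def using h by (intro bdd)
      show "AE \<omega> in M. \<omega> \<in> E \<longrightarrow> 1/2 \<le> subset_avg {..<n} (\<lambda>_. 1/2) (\<lambda>T. of_bool (\<bar>L (h T) \<omega>\<bar> > R))"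
      proof (intro AE_I2 impI)
        fix \<omega> assume "\<omega> \<in> E"
        then obtain k where k: "k < n" "\<omega> \<in> H k" unfolding E by auto
        have "R \<le> R / prob E" using pE prob_le_1 \<open>R > 0\<close> by (simp add: field_simps mult_left_le)
        also have "\<dots> \<le> r k * \<alpha> k" using bad[OF k(1)] pE by (simp add: bad_def \<alpha>_def divide_right_mono)
        finally have "R \<le> r k * \<alpha> k" .
        moreover from this have "\<alpha> k > 0" using \<open>R > 0\<close> \<alpha>[of k] by (cases "\<alpha> k = 0") auto
        then have "r k * \<alpha> k < \<bar>L (c k) \<omega>\<bar> * \<alpha> k" using bad[OF k(1)] k(2) by (auto simp: bad_def)
        ultimately have R: "R < \<bar>\<alpha> k * L (c k) \<omega>\<bar>" using \<alpha>[of k] by (simp add: abs_mult mult.commute)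
        have "1/2 \<le> subset_avg {..<n} (\<lambda>_. 1/2) (\<lambda>T. of_bool (\<bar>L (h T) \<omega>\<bar> \<ge> \<bar>\<alpha> k * L (c k) \<omega>\<bar>))"
          unfolding Lh using k by (intro rsign_sum_toggle) auto
        also have "\<dots> \<le> subset_avg {..<n} (\<lambda>_. 1/2) (\<lambda>T. of_bool (\<bar>L (h T) \<omega>\<bar> > R))"
          using R by (intro subset_avg_mono) auto
        finally show "1/2 \<le> subset_avg {..<n} (\<lambda>_. 1/2) (\<lambda>T. of_bool (\<bar>L (h T) \<omega>\<bar> > R))" .
      qed
      show "E \<in> events" using that by (rule fam_events)
    qed auto
    then show ?thesis by simp
  qed
  have fam_extend: "fam (E \<union> H)" if "fam E" "bad H c r" "E \<inter> H = {}" for E H c r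
  proof -
    obtain n :: nat and H' c' r' where *: "\<And>k. k < n \<Longrightarrow> bad (H' k) (c' k) (r' k)"
      "disjoint_family_on H' {..<n}" "E = (\<Union>k<n. H' k)"
      using \<open>fam E\<close> unfolding fam_def by metis
    show ?thesis unfolding fam_def
    proof (intro exI[of _ "Suc n"] exI[of _ "H'(n := H)"] exI[of _ "c'(n := c)"] exI[of _ "r'(n := r)"] conjI allI impI)
      show "bad ((H'(n := H)) k) ((c'(n := c)) k) ((r'(n := r)) k)" if "k < Suc n" for k
        using * \<open>bad H c r\<close> that by (auto simp: less_Suc_eq)
      show "disjoint_family_on (H'(n := H)) {..<Suc n}"
        using *(2,3) that(3) unfolding disjoint_family_on_def by (auto simp: less_Suc_eq) blast+
      show "E \<union> H = (\<Union>k<Suc n. (H'(n := H)) k)"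
        unfolding lessThan_Suc *(3) by auto
    qed
  qed
  \<comment> \<open>A family that is maximal up to null sets: each step nearly exhausts what can still be added.\<close>
  define Ext where "Ext = (\<lambda>E. Sup (prob ` {E'. fam E' \<and> E \<subseteq> E'}))"
  have Ext_upper: "prob E' \<le> Ext E" if "fam E'" "E \<subseteq> E'" for E E'
    unfolding Ext_def using that fam_prob
    by (intro cSup_upper) (auto intro!: bdd_aboveI[where M="2*\<delta>"])
  have "\<exists>E. \<forall>n. fam (E n) \<and> (E n \<subseteq> E (Suc n) \<and> Ext (E n) < prob (E (Suc n)) + 1 / real (Suc n))"
  proof (rule dependent_nat_choice)
    show "\<exists>x. fam x"
      unfolding fam_def by (intro exI[of _ "{}"] exI[of _ "0::nat"]) (auto simp: disjoint_family_on_def)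
    fix E and n :: nat assume "fam E"
    then have "\<exists>y\<in>prob ` {E'. fam E' \<and> E \<subseteq> E'}. Ext E - 1 / real (Suc n) < y"
      unfolding Ext_def using fam_prob
      by (intro less_cSupD) auto
    then show "\<exists>E'. fam E' \<and> (E \<subseteq> E' \<and> Ext E < prob E' + 1 / real (Suc n))" by force
  qed
  then obtain E where fam: "\<And>n. fam (E n)" and mono: "\<And>n. E n \<subseteq> E (Suc n)"
    and Ext: "\<And>n. Ext (E n) < prob (E (Suc n)) + 1 / real (Suc n)" by blast
  have E_events [measurable]: "E n \<in> events" for n using fam fam_events by blast
  define G where "G = space M - (\<Union>n. E n)"
  have G_events [measurable]: "G \<in> events" unfolding G_def by measurable
  have lim: "(\<lambda>n. prob (E n)) \<longlonglongrightarrow> prob (\<Union>n. E n)"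
    using mono by (intro finite_Lim_measure_incseq) (auto intro: incseq_SucI)
  have "(\<Union>n. E n) \<subseteq> space M" using sets.sets_into_space[OF E_events] by blast
  then have "prob (space M - G) = prob (\<Union>n. E n)" unfolding G_def by (simp add: Diff_Diff_Int Int_absorb1)
  also have "\<dots> \<le> 2 * \<delta>" using lim fam_prob[OF fam] by (intro LIMSEQ_le_const2[OF lim]) auto
  finally have "prob (space M - G) \<le> 2 * \<delta>" .
  moreover have "prob {\<omega>\<in>space M. \<omega> \<in> G \<and> \<bar>L c \<omega>\<bar> > r} \<le> R / r" if c: "\<forall>i\<in>I. \<bar>c i\<bar> \<le> 1" and r: "r > 0" for c r
  proof (rule ccontr)
    assume *: "\<not> ?thesis"
    have "R / r \<le> prob (E (Suc n)) - prob (E n) + 1 / real (Suc n)" for n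
    proof -
      let ?H = "{\<omega>\<in>space M. \<bar>L c \<omega>\<bar> > r} - E n"
      have "prob {\<omega>\<in>space M. \<omega> \<in> G \<and> \<bar>L c \<omega>\<bar> > r} \<le> prob ?H"
        by (intro finite_measure_mono) (auto simp: G_def)
      then have H: "R / r \<le> prob ?H" using * by simp
      then have "bad ?H c r" unfolding bad_def using c r by (auto simp: field_simps)
      then have "fam (E n \<union> ?H)" by (intro fam_extend[OF fam]) auto
      then have "prob (E n \<union> ?H) \<le> Ext (E n)" by (intro Ext_upper) auto
      moreover have "prob (E n \<union> ?H) = prob (E n) + prob ?H"
        by (intro finite_measure_Union) auto
      ultimately show ?thesis using H Ext[of n] by linarith
    qed
    moreover have "(\<lambda>n. prob (E (Suc n)) - prob (E n) + 1 / real (Suc n)) \<longlonglongrightarrow> prob (\<Union>n. E n) - prob (\<Union>n. E n) + 0"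
      using lim LIMSEQ_Suc[OF lim] LIMSEQ_inverse_real_of_nat
      by (intro tendsto_intros) (auto simp: inverse_eq_divide)
    ultimately have "R / r \<le> prob (\<Union>n. E n) - prob (\<Union>n. E n) + 0"
      by (intro LIMSEQ_le_const) auto
    then show False using \<open>R > 0\<close> r by (simp add: field_simps)
  qed
  ultimately show ?thesis using G_events unfolding L_def by blast
qed

lemma square_function_bounded:
  fixes w :: "'i \<Rightarrow> 'a \<Rightarrow> real" and c :: "nat \<Rightarrow> 'i \<Rightarrow> real"
  assumes I: "finite I" and w [measurable]: "\<And>i. i \<in> I \<Longrightarrow> w i \<in> borel_measurable M"
    and "R0 > 0"
    and bdd: "\<And>c. (\<And>i. i \<in> I \<Longrightarrow> \<bar>c i\<bar> \<le> 1) \<Longrightarrow>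
      prob {\<omega>\<in>space M. \<bar>\<Sum>i\<in>I. c i * w i \<omega>\<bar> > R0} \<le> \<delta>"
    and sq: "\<And>i. i \<in> I \<Longrightarrow> (\<Sum>k<n. (c k i)\<^sup>2) \<le> 1" and R: "R > 0"
  shows "prob {\<omega>\<in>space M. (\<Sum>k<n. (\<Sum>i\<in>I. c k i * w i \<omega>)\<^sup>2) > R\<^sup>2} \<le> 2 * \<delta> + 9632/3 * R0 / R"
proof -
  have "\<exists>G\<in>events. prob (space M - G) \<le> 2 * \<delta> \<and>
    (\<forall>c r. (\<forall>i\<in>I. \<bar>c i\<bar> \<le> 1) \<longrightarrow> r > 0 \<longrightarrow>
      prob {\<omega>\<in>space M. \<omega> \<in> G \<and> \<bar>\<Sum>i\<in>I. c i * w i \<omega>\<bar> > r} \<le> R0 / r)"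
    by (rule nikishin_finite) (fact I w \<open>R0 > 0\<close> bdd)+
  then obtain G where G [measurable]: "G \<in> events" and PG: "prob (space M - G) \<le> 2 * \<delta>"
    and weak: "\<And>c r. (\<And>i. i \<in> I \<Longrightarrow> \<bar>c i\<bar> \<le> 1) \<Longrightarrow> r > 0 \<Longrightarrow>
      prob {\<omega>\<in>space M. \<omega> \<in> G \<and> \<bar>\<Sum>i\<in>I. c i * w i \<omega>\<bar> > r} \<le> R0 / r"
    by blast
  have "R0 \<ge> 0" using \<open>R0 > 0\<close> by simp
  let ?Q = "\<lambda>\<omega>. \<Sum>k<n. (\<Sum>i\<in>I. c k i * w i \<omega>)\<^sup>2"
  have "prob {\<omega>\<in>space M. ?Q \<omega> > R\<^sup>2} \<le> prob ((space M - G) \<union> {\<omega>\<in>space M. \<omega> \<in> G \<and> ?Q \<omega> > R\<^sup>2})"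
    by (intro finite_measure_mono) auto
  also have "\<dots> \<le> prob (space M - G) + prob {\<omega>\<in>space M. \<omega> \<in> G \<and> ?Q \<omega> > R\<^sup>2}"
    by (intro measure_Un_le) auto
  also have "\<dots> \<le> 2 * \<delta> + 9632/3 * R0 / R"
  proof (rule add_mono[OF PG])
    show "prob {\<omega>\<in>space M. \<omega> \<in> G \<and> ?Q \<omega> > R\<^sup>2} \<le> 9632/3 * R0 / R"
      by (rule square_function_weak_type) (fact I w G \<open>R0 \<ge> 0\<close> weak sq R)+
  qed
  finally show ?thesis .
qed

end

section \<open>Convergence in probability and stochastic measures\<close>

lemma disjoint_family_decseq_Diff:
  assumes "decseq E"
  shows "disjoint_family (\<lambda>i. E i - E (Suc i))"
proof -
  have "(E m - E (Suc m)) \<inter> (E n - E (Suc n)) = {}" if "m < n" for m n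
    using decseqD[OF assms, of "Suc m" n] that by auto
  then show ?thesis unfolding disjoint_family_on_def by (metis Int_commute linorder_neqE_nat)
qed

context prob_space begin

definition tail :: "('a \<Rightarrow> real) \<Rightarrow> real \<Rightarrow> real" where
  "tail X r = prob {\<omega>\<in>space M. \<bar>X \<omega>\<bar> > r}"

lemma tail_nonneg: "tail X r \<ge> 0"
  by (simp add: tail_def)

lemma tail_mono_AE:
  assumes [measurable]: "X \<in> borel_measurable M" "Y \<in> borel_measurable M"
    and "AE \<omega> in M. \<bar>X \<omega>\<bar> > r \<longrightarrow> \<bar>Y \<omega>\<bar> > s"
  shows "tail X r \<le> tail Y s"
  unfolding tail_def using assms(3) by (intro finite_measure_mono_AE) auto

lemma tail_cong_AE:
  assumes [measurable]: "X \<in> borel_measurable M" "Y \<in> borel_measurable M"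
    and "AE \<omega> in M. X \<omega> = Y \<omega>"
  shows "tail X r = tail Y r"
  using assms by (intro antisym tail_mono_AE) auto

lemma tail_antimono: "X \<in> borel_measurable M \<Longrightarrow> r \<le> s \<Longrightarrow> tail X s \<le> tail X r"
  by (intro tail_mono_AE) auto

lemma tail_uminus: "tail (\<lambda>\<omega>. - X \<omega>) r = tail X r"
  by (simp add: tail_def)

lemma tail_add:
  assumes [measurable]: "X \<in> borel_measurable M" "Y \<in> borel_measurable M"
  shows "tail (\<lambda>\<omega>. X \<omega> + Y \<omega>) (r + s) \<le> tail X r + tail Y s"
proof -
  have "tail (\<lambda>\<omega>. X \<omega> + Y \<omega>) (r + s) \<le>
    prob ({\<omega>\<in>space M. \<bar>X \<omega>\<bar> > r} \<union> {\<omega>\<in>space M. \<bar>Y \<omega>\<bar> > s})"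
    unfolding tail_def by (intro finite_measure_mono) auto
  also have "\<dots> \<le> tail X r + tail Y s"
    unfolding tail_def by (intro measure_Un_le) auto
  finally show ?thesis .
qed

lemma tail_diff:
  assumes [measurable]: "X \<in> borel_measurable M" "Y \<in> borel_measurable M"
  shows "tail (\<lambda>\<omega>. X \<omega> - Y \<omega>) (r + s) \<le> tail X r + tail Y s"
  using tail_add[of X "\<lambda>\<omega>. - Y \<omega>" r s] by (simp add: tail_uminus)

lemma converges_in_prob_iff_tail:
  "converges_in_prob M Y Z \<longleftrightarrow> (\<forall>\<epsilon>>0. (\<lambda>n. tail (\<lambda>\<omega>. Y n \<omega> - Z \<omega>) \<epsilon>) \<longlonglongrightarrow> 0)"
  by (simp add: converges_in_prob_def tail_def)

lemma AE_zero_of_tail: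
  assumes [measurable]: "X \<in> borel_measurable M" and "\<And>\<epsilon>. \<epsilon> > 0 \<Longrightarrow> tail X \<epsilon> = 0"
  shows "AE \<omega> in M. X \<omega> = 0"
proof -
  have "AE \<omega> in M. \<not> \<bar>X \<omega>\<bar> > 1 / real (Suc n)" for n
  proof -
    have "{\<omega>\<in>space M. \<bar>X \<omega>\<bar> > 1 / real (Suc n)} \<in> null_sets M"
      using assms(2)[of "1 / real (Suc n)"] by (auto simp: tail_def null_sets_def emeasure_eq_measure)
    then show ?thesis by (auto dest: AE_not_in)
  qed
  then have "AE \<omega> in M. \<forall>n. \<not> \<bar>X \<omega>\<bar> > 1 / real (Suc n)" by (simp add: AE_all_countable)
  then show ?thesis
  proof eventually_elim
    case (elim \<omega>)
    show ?case
    proof (rule ccontr)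
      assume "X \<omega> \<noteq> 0"
      then obtain n where "inverse (real (Suc n)) < \<bar>X \<omega>\<bar>" using reals_Archimedean[of "\<bar>X \<omega>\<bar>"] by auto
      with elim show False by (simp add: inverse_eq_divide)
    qed
  qed
qed

lemma converges_in_prob_eventually_AE:
  assumes Y: "\<And>n. n \<ge> n0 \<Longrightarrow> AE \<omega> in M. Y n \<omega> = W \<omega>"
    and [measurable]: "\<And>n. Y n \<in> borel_measurable M" "Z \<in> borel_measurable M" "W \<in> borel_measurable M"
    and lim: "converges_in_prob M Y Z"
  shows "AE \<omega> in M. Z \<omega> = W \<omega>"
proof -
  have "AE \<omega> in M. W \<omega> - Z \<omega> = 0"
  proof (rule AE_zero_of_tail)
    fix \<epsilon> :: real assume "\<epsilon> > 0"
    then have "(\<lambda>n. tail (\<lambda>\<omega>. Y n \<omega> - Z \<omega>) \<epsilon>) \<longlonglongrightarrow> 0"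
      using lim by (auto simp: converges_in_prob_iff_tail)
    moreover have "tail (\<lambda>\<omega>. Y n \<omega> - Z \<omega>) \<epsilon> = tail (\<lambda>\<omega>. W \<omega> - Z \<omega>) \<epsilon>" if "n \<ge> n0" for n
      using Y[OF that] by (intro tail_cong_AE) auto
    ultimately have "(\<lambda>n. tail (\<lambda>\<omega>. W \<omega> - Z \<omega>) \<epsilon>) \<longlonglongrightarrow> 0"
      by (elim Lim_transform_eventually) (auto intro!: eventually_sequentiallyI[of n0])
    then show "tail (\<lambda>\<omega>. W \<omega> - Z \<omega>) \<epsilon> = 0" by (simp add: LIMSEQ_const_iff)
  qed simp
  then show ?thesis by eventually_elim simp
qed

lemma converges_in_prob_Cauchy:
  assumes [measurable]: "\<And>n. Y n \<in> borel_measurable M" "Z \<in> borel_measurable M"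
    and lim: "converges_in_prob M Y Z" and "\<epsilon> > 0"
  shows "\<exists>n0. \<forall>m\<ge>n0. \<forall>n\<ge>n0. tail (\<lambda>\<omega>. Y m \<omega> - Y n \<omega>) \<epsilon> < \<epsilon>"
proof -
  have "(\<lambda>n. tail (\<lambda>\<omega>. Y n \<omega> - Z \<omega>) (\<epsilon>/2)) \<longlonglongrightarrow> 0"
    using lim \<open>\<epsilon> > 0\<close> by (auto simp: converges_in_prob_iff_tail)
  then obtain n0 where n0: "\<And>n. n \<ge> n0 \<Longrightarrow> tail (\<lambda>\<omega>. Y n \<omega> - Z \<omega>) (\<epsilon>/2) < \<epsilon>/2"
    using \<open>\<epsilon> > 0\<close> order_tendstoD(2)[of _ 0 sequentially "\<epsilon>/2"] by (auto simp: eventually_sequentially)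
  have "tail (\<lambda>\<omega>. Y m \<omega> - Y n \<omega>) \<epsilon> < \<epsilon>" if "m \<ge> n0" "n \<ge> n0" for m n
    using tail_diff[of "\<lambda>\<omega>. Y m \<omega> - Z \<omega>" "\<lambda>\<omega>. Y n \<omega> - Z \<omega>" "\<epsilon>/2" "\<epsilon>/2"] n0[OF that(1)] n0[OF that(2)]
    by simp
  then show ?thesis by blast
qed

end

locale l0_measure = prob_space M for M :: "'w measure" +
  fixes N :: "'x measure" and \<mu> :: "'x set \<Rightarrow> 'w \<Rightarrow> real"
  assumes stochastic: "stochastic_measure M N \<mu>"
begin

lemma measurable_mu [measurable]: "A \<in> sets N \<Longrightarrow> \<mu> A \<in> borel_measurable M"
  using stochastic by (auto simp: stochastic_measure_def)

lemma mu_series: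
  assumes "\<And>i::nat. A i \<in> sets N" "disjoint_family A"
  shows "converges_in_prob M (\<lambda>n \<omega>. \<Sum>i<n. \<mu> (A i) \<omega>) (\<mu> (\<Union>i. A i))"
  using stochastic assms by (auto simp: stochastic_measure_def)

text \<open>The partial sums of the series for a sequence of empty sets are the multiples of \<open>\<mu> {}\<close>.\<close>
lemma mu_empty: "AE \<omega> in M. \<mu> {} \<omega> = 0"
proof (rule AE_zero_of_tail)
  fix \<epsilon> :: real assume e: "\<epsilon> > 0"
  have "converges_in_prob M (\<lambda>n::nat. \<lambda>\<omega>. \<Sum>i<n. \<mu> {} \<omega>) (\<mu> (\<Union>i::nat. {}))"
    by (intro mu_series) (auto simp: disjoint_family_on_def)
  then have lim: "(\<lambda>n::nat. tail (\<lambda>\<omega>. (\<Sum>i<n. \<mu> {} \<omega>) - \<mu> {} \<omega>) \<epsilon>) \<longlonglongrightarrow> 0"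
    using e by (simp add: converges_in_prob_iff_tail)
  have "tail (\<mu> {}) \<epsilon> \<le> tail (\<lambda>\<omega>. (\<Sum>i<n. \<mu> {} \<omega>) - \<mu> {} \<omega>) \<epsilon>" if "n \<ge> 2" for n :: nat
  proof (intro tail_mono_AE AE_I2 impI)
    fix \<omega> assume "\<bar>\<mu> {} \<omega>\<bar> > \<epsilon>"
    also have "\<bar>\<mu> {} \<omega>\<bar> \<le> (real n - 1) * \<bar>\<mu> {} \<omega>\<bar>" using that by (intro mult_le_cancel_right1[THEN iffD2]) auto
    also have "\<dots> = \<bar>(\<Sum>i<n. \<mu> {} \<omega>) - \<mu> {} \<omega>\<bar>"
    proof -
      have "(\<Sum>i<n. \<mu> {} \<omega>) - \<mu> {} \<omega> = (real n - 1) * \<mu> {} \<omega>" by (simp add: algebra_simps)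
      then show ?thesis using that by (simp add: abs_mult)
    qed
    finally show "\<bar>(\<Sum>i<n. \<mu> {} \<omega>) - \<mu> {} \<omega>\<bar> > \<epsilon>" .
  qed auto
  then have "tail (\<mu> {}) \<epsilon> \<le> 0"
    by (intro LIMSEQ_le_const[OF lim]) auto
  then show "tail (\<mu> {}) \<epsilon> = 0" using tail_nonneg[of "\<mu> {}" \<epsilon>] by simp
qed auto

lemma mu_Un:
  assumes [measurable]: "A \<in> sets N" "B \<in> sets N" and disj: "A \<inter> B = {}"
  shows "AE \<omega> in M. \<mu> (A \<union> B) \<omega> = \<mu> A \<omega> + \<mu> B \<omega>"
proof -
  define F where "F = (\<lambda>i::nat. if i = 0 then A else if i = 1 then B else {})"
  have F [measurable]: "F i \<in> sets N" for i by (auto simp: F_def)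
  have "disjoint_family F" using disj by (auto simp: F_def disjoint_family_on_def)
  have "(\<Union>i. F i) = A \<union> B" unfolding F_def by (auto split: if_splits)
  then have lim: "converges_in_prob M (\<lambda>n \<omega>. \<Sum>i<n. \<mu> (F i) \<omega>) (\<mu> (A \<union> B))"
    using mu_series[of F] F \<open>disjoint_family F\<close> by simp
  show ?thesis
  proof (rule converges_in_prob_eventually_AE[OF _ _ _ _ lim])
    fix n :: nat assume "2 \<le> n"
    then obtain k where n: "n = Suc (Suc k)" by (metis One_nat_def Suc_1 Suc_le_D Suc_le_mono)
    have "(\<Sum>i<n. \<mu> (F i) \<omega>) = \<mu> A \<omega> + \<mu> B \<omega> + real k * \<mu> {} \<omega>" for \<omega>
      unfolding n sum.lessThan_Suc_shift by (simp add: F_def)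
    then show "AE \<omega> in M. (\<Sum>i<n. \<mu> (F i) \<omega>) = \<mu> A \<omega> + \<mu> B \<omega>"
      using mu_empty by auto
  qed auto
qed

lemma mu_Diff:
  assumes "A \<in> sets N" "B \<in> sets N" "B \<subseteq> A"
  shows "AE \<omega> in M. \<mu> (A - B) \<omega> = \<mu> A \<omega> - \<mu> B \<omega>"
proof -
  have "A - B \<union> B = A" using assms by auto
  moreover have "AE \<omega> in M. \<mu> (A - B \<union> B) \<omega> = \<mu> (A - B) \<omega> + \<mu> B \<omega>"
    using assms by (intro mu_Un) auto
  ultimately show ?thesis by auto
qed

lemma mu_finite_UN:
  assumes "finite I" "\<And>i. i \<in> I \<Longrightarrow> F i \<in> sets N" "disjoint_family_on F I"
  shows "AE \<omega> in M. \<mu> (\<Union>i\<in>I. F i) \<omega> = (\<Sum>i\<in>I. \<mu> (F i) \<omega>)"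
  using assms
proof (induction I rule: finite_induct)
  case empty
  then show ?case using mu_empty by simp
next
  case (insert a I)
  have "F a \<inter> (\<Union>i\<in>I. F i) = {}"
    using insert.prems(2) insert.hyps(2) by (fastforce simp: disjoint_family_on_def)
  then have "AE \<omega> in M. \<mu> (F a \<union> (\<Union>i\<in>I. F i)) \<omega> = \<mu> (F a) \<omega> + \<mu> (\<Union>i\<in>I. F i) \<omega>"
    using insert by (intro mu_Un) auto
  moreover have "AE \<omega> in M. \<mu> (\<Union>i\<in>I. F i) \<omega> = (\<Sum>i\<in>I. \<mu> (F i) \<omega>)"
    using insert by (intro insert.IH) (auto simp: disjoint_family_on_def)
  ultimately show ?case using insert by auto
qed

lemma mu_exhaustive:
  assumes F: "\<And>i::nat. F i \<in> sets N" "disjoint_family F" and "\<epsilon> > 0"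
  shows "(\<lambda>n. tail (\<mu> (F n)) \<epsilon>) \<longlonglongrightarrow> 0"
proof -
  let ?S = "\<lambda>n \<omega>. \<Sum>i<n. \<mu> (F i) \<omega>" and ?Z = "\<mu> (\<Union>i. F i)"
  note [measurable] = F(1)
  have lim: "(\<lambda>n. tail (\<lambda>\<omega>. ?S n \<omega> - ?Z \<omega>) (\<epsilon>/2)) \<longlonglongrightarrow> 0"
    using mu_series[OF F] \<open>\<epsilon> > 0\<close> by (auto simp: converges_in_prob_iff_tail)
  have le: "tail (\<mu> (F n)) \<epsilon> \<le> tail (\<lambda>\<omega>. ?S (Suc n) \<omega> - ?Z \<omega>) (\<epsilon>/2) + tail (\<lambda>\<omega>. ?S n \<omega> - ?Z \<omega>) (\<epsilon>/2)" for n
    using tail_diff[of "\<lambda>\<omega>. ?S (Suc n) \<omega> - ?Z \<omega>" "\<lambda>\<omega>. ?S n \<omega> - ?Z \<omega>" "\<epsilon>/2" "\<epsilon>/2"] by simp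
  show ?thesis
  proof (rule Lim_null_comparison)
    show "\<forall>\<^sub>F n in sequentially. norm (tail (\<mu> (F n)) \<epsilon>) \<le>
      tail (\<lambda>\<omega>. ?S (Suc n) \<omega> - ?Z \<omega>) (\<epsilon>/2) + tail (\<lambda>\<omega>. ?S n \<omega> - ?Z \<omega>) (\<epsilon>/2)"
      unfolding real_norm_def abs_of_nonneg[OF tail_nonneg] by (intro always_eventually allI le)
    show "(\<lambda>n. tail (\<lambda>\<omega>. ?S (Suc n) \<omega> - ?Z \<omega>) (\<epsilon>/2) + tail (\<lambda>\<omega>. ?S n \<omega> - ?Z \<omega>) (\<epsilon>/2)) \<longlonglongrightarrow> 0"
      using tendsto_add[OF LIMSEQ_Suc[OF lim] lim] by simp
  qed
qed

lemma mu_decseq_empty: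
  assumes [measurable]: "\<And>i::nat. E i \<in> sets N" and dec: "decseq E" and "(\<Inter>i. E i) = {}" and "\<epsilon> > 0"
  shows "(\<lambda>n. tail (\<mu> (E n)) \<epsilon>) \<longlonglongrightarrow> 0"
proof -
  let ?D = "\<lambda>i. E i - E (Suc i)"
  have disj: "disjoint_family ?D" by (rule disjoint_family_decseq_Diff[OF dec])
  have sub: "E (Suc i) \<subseteq> E i" for i using decseqD[OF dec, of i "Suc i"] by simp
  have U: "(\<Union>i. ?D i) = E 0"
  proof (intro equalityI subsetI)
    fix x assume x: "x \<in> E 0"
    from assms(3) obtain i where "x \<notin> E i" by auto
    then show "x \<in> (\<Union>i. ?D i)"
    proof (induction i)
      case (Suc i) then show ?case by (cases "x \<in> E i") auto
    qed (use x in auto)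
  next
    fix x assume "x \<in> (\<Union>i. ?D i)"
    then show "x \<in> E 0" using decseqD[OF dec, of 0] by auto
  qed
  have S: "AE \<omega> in M. (\<Sum>i<n. \<mu> (?D i) \<omega>) = \<mu> (E 0) \<omega> - \<mu> (E n) \<omega>" for n
  proof (induction n)
    case (Suc n)
    then show ?case using mu_Diff[of "E n" "E (Suc n)"] sub by auto
  qed simp
  have "converges_in_prob M (\<lambda>n \<omega>. \<Sum>i<n. \<mu> (?D i) \<omega>) (\<mu> (E 0))"
    using mu_series[of ?D] disj U by simp
  then have "(\<lambda>n. tail (\<lambda>\<omega>. (\<Sum>i<n. \<mu> (?D i) \<omega>) - \<mu> (E 0) \<omega>) \<epsilon>) \<longlonglongrightarrow> 0"
    using \<open>\<epsilon> > 0\<close> by (auto simp: converges_in_prob_iff_tail)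
  moreover have "tail (\<lambda>\<omega>. (\<Sum>i<n. \<mu> (?D i) \<omega>) - \<mu> (E 0) \<omega>) \<epsilon> = tail (\<mu> (E n)) \<epsilon>" for n
  proof -
    have "tail (\<lambda>\<omega>. (\<Sum>i<n. \<mu> (?D i) \<omega>) - \<mu> (E 0) \<omega>) \<epsilon> = tail (\<lambda>\<omega>. - \<mu> (E n) \<omega>) \<epsilon>"
      using S[of n] by (intro tail_cong_AE) auto
    then show ?thesis by (simp add: tail_uminus)
  qed
  ultimately show ?thesis by simp
qed

text \<open>
  Continuity at the empty set, uniformly over all measurable subsets. Otherwise every \<open>E k\<close> contains a
  set of large measure, of which, by \<open>mu_decseq_empty\<close>, a large part already lies in a difference \<open>E k - E l\<close>.
  Repetition gives disjoint sets of large measure, contrary to \<open>mu_exhaustive\<close>.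
\<close>
lemma mu_decseq_empty_uniform:
  assumes E [measurable]: "\<And>i::nat. E i \<in> sets N" and dec: "decseq E" and int: "(\<Inter>i. E i) = {}" and "\<eta> > 0"
  shows "\<exists>k. \<forall>A\<in>sets N. A \<subseteq> E k \<longrightarrow> tail (\<mu> A) \<eta> < \<eta>"
proof (rule ccontr)
  assume "\<not> ?thesis"
  then have *: "\<exists>A\<in>sets N. A \<subseteq> E k \<and> tail (\<mu> A) \<eta> \<ge> \<eta>" for k by (auto simp: not_less)
  have step: "\<exists>l A. k < l \<and> A \<in> sets N \<and> A \<subseteq> E k - E l \<and> tail (\<mu> A) (\<eta>/2) \<ge> \<eta>/2" for k
  proof -
    obtain A where A [measurable]: "A \<in> sets N" and "A \<subseteq> E k" "tail (\<mu> A) \<eta> \<ge> \<eta>" using * by auto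
    have "(\<lambda>l. tail (\<mu> (A \<inter> E l)) (\<eta>/2)) \<longlonglongrightarrow> 0"
      using dec int \<open>\<eta> > 0\<close> by (intro mu_decseq_empty) (auto simp: decseq_def)
    then have "\<forall>\<^sub>F l in sequentially. tail (\<mu> (A \<inter> E l)) (\<eta>/2) < \<eta>/2"
      using \<open>\<eta> > 0\<close> by (intro order_tendstoD(2)) auto
    then have "\<forall>\<^sub>F l in sequentially. tail (\<mu> (A \<inter> E l)) (\<eta>/2) < \<eta>/2 \<and> k < l"
      using eventually_gt_at_top[of k] by eventually_elim auto
    then obtain l where l: "tail (\<mu> (A \<inter> E l)) (\<eta>/2) < \<eta>/2" "k < l"
      by (auto dest!: eventually_happens)
    have "AE \<omega> in M. \<mu> (A \<inter> E l \<union> (A - E l)) \<omega> = \<mu> (A \<inter> E l) \<omega> + \<mu> (A - E l) \<omega>"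
      by (intro mu_Un) auto
    moreover have "A \<inter> E l \<union> (A - E l) = A" by auto
    ultimately have "tail (\<mu> A) \<eta> = tail (\<lambda>\<omega>. \<mu> (A \<inter> E l) \<omega> + \<mu> (A - E l) \<omega>) \<eta>"
      by (intro tail_cong_AE) auto
    also have "\<dots> \<le> tail (\<mu> (A \<inter> E l)) (\<eta>/2) + tail (\<mu> (A - E l)) (\<eta>/2)"
      using tail_add[of "\<mu> (A \<inter> E l)" "\<mu> (A - E l)" "\<eta>/2" "\<eta>/2"] by simp
    finally have "tail (\<mu> (A - E l)) (\<eta>/2) \<ge> \<eta>/2" using l \<open>tail (\<mu> A) \<eta> \<ge> \<eta>\<close> by linarith
    with l \<open>A \<subseteq> E k\<close> show ?thesis by (intro exI[of _ l] exI[of _ "A - E l"]) auto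
  qed
  then obtain nxt F where nxt: "\<And>k. k < nxt k" and F: "\<And>k. F k \<in> sets N"
    "\<And>k. F k \<subseteq> E k - E (nxt k)" "\<And>k. tail (\<mu> (F k)) (\<eta>/2) \<ge> \<eta>/2" by metis
  define r where "r = rec_nat 0 (\<lambda>_. nxt)"
  have r: "r (Suc n) = nxt (r n)" for n by (simp add: r_def)
  have "strict_mono r" unfolding strict_mono_Suc_iff r using nxt by auto
  then have "decseq (\<lambda>n. E (r n))" using dec by (auto simp: decseq_def strict_mono_less_eq)
  from disjoint_family_decseq_Diff[OF this] have "disjoint_family (\<lambda>n. F (r n))"
    using F(2) unfolding disjoint_family_on_def r by blast
  then have "(\<lambda>n. tail (\<mu> (F (r n))) (\<eta>/2)) \<longlonglongrightarrow> 0"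
    using F \<open>\<eta> > 0\<close> by (intro mu_exhaustive) auto
  then have "\<eta>/2 \<le> 0" using F(3) by (intro LIMSEQ_le_const) auto
  then show False using \<open>\<eta> > 0\<close> by simp
qed

end

section \<open>Finitely many large cells in every partition\<close>

context l0_measure begin

text \<open>
  Partitions are indexed families: cells may be empty, and common refinements are indexed by pairs, so
  that cells can be counted without identifying equal ones.
\<close>
definition meas_partition :: "'x set \<Rightarrow> 'i set \<Rightarrow> ('i \<Rightarrow> 'x set) \<Rightarrow> bool" where
  "meas_partition Y I F \<longleftrightarrow> finite I \<and> (\<forall>i\<in>I. F i \<in> sets N) \<and> disjoint_family_on F I \<and> (\<Union>i\<in>I. F i) = Y"

lemma meas_partition_sets: "meas_partition Y I F \<Longrightarrow> i \<in> I \<Longrightarrow> F i \<in> sets N"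
  and meas_partition_finite: "meas_partition Y I F \<Longrightarrow> finite I"
  and meas_partition_union: "meas_partition Y I F \<Longrightarrow> (\<Union>i\<in>I. F i) = Y"
  by (auto simp: meas_partition_def)

lemma meas_partition_subset: "meas_partition Y I F \<Longrightarrow> T \<subseteq> I \<Longrightarrow> meas_partition (\<Union>i\<in>T. F i) T F"
  unfolding meas_partition_def by (auto intro: finite_subset disjoint_family_on_mono)

lemma meas_partition_UN_sets: "meas_partition Y I F \<Longrightarrow> T \<subseteq> I \<Longrightarrow> (\<Union>i\<in>T. F i) \<in> sets N"
  by (auto simp: meas_partition_def intro!: sets.finite_UN intro: finite_subset)

lemma meas_partition_Diff: "meas_partition Y I F \<Longrightarrow> T \<subseteq> I \<Longrightarrow> (\<Union>i\<in>I - T. F i) = Y - (\<Union>i\<in>T. F i)"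
  by (fastforce simp: meas_partition_def disjoint_family_on_def)

lemma meas_partition_prod:
  assumes "meas_partition Y I F" "meas_partition Z J G"
  shows "meas_partition (Y \<inter> Z) (I \<times> J) (\<lambda>(i, j). F i \<inter> G j)"
  using assms unfolding meas_partition_def disjoint_family_on_def by (auto; blast)

lemma meas_partition_sum_AE:
  assumes "meas_partition Y I F" "T \<subseteq> I"
  shows "AE \<omega> in M. \<mu> (\<Union>i\<in>T. F i) \<omega> = (\<Sum>i\<in>T. \<mu> (F i) \<omega>)"
  using meas_partition_subset[OF assms] by (intro mu_finite_UN) (auto simp: meas_partition_def)

lemma meas_partition_sum_inter_AE:
  assumes "meas_partition Y I F" "A \<in> sets N" "A \<subseteq> Y"
  shows "AE \<omega> in M. \<mu> A \<omega> = (\<Sum>i\<in>I. \<mu> (A \<inter> F i) \<omega>)"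
proof -
  have "AE \<omega> in M. \<mu> (\<Union>i\<in>I. A \<inter> F i) \<omega> = (\<Sum>i\<in>I. \<mu> (A \<inter> F i) \<omega>)"
  proof (intro mu_finite_UN)
    show "disjoint_family_on (\<lambda>i. A \<inter> F i) I"
      using assms(1) unfolding meas_partition_def disjoint_family_on_def by blast
  qed (use assms in \<open>auto simp: meas_partition_def\<close>)
  moreover have "(\<Union>i\<in>I. A \<inter> F i) = A" using assms by (auto simp: meas_partition_def)
  ultimately show ?thesis by simp
qed

text \<open>A sign combination of the cell values is a difference of two values of \<open>\<mu>\<close>.\<close>
lemma tail_rsign_sum:
  assumes I: "meas_partition Y I F" and T: "T \<subseteq> I"
  shows "tail (\<lambda>\<omega>. \<Sum>i\<in>I. rsign T i * \<mu> (F i) \<omega>) (r + r) \<le>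
    tail (\<mu> (\<Union>i\<in>T. F i)) r + tail (\<mu> (\<Union>i\<in>I - T. F i)) r"
proof -
  let ?S = "\<lambda>\<omega>. \<Sum>i\<in>I. rsign T i * \<mu> (F i) \<omega>"
  let ?B = "\<Union>i\<in>T. F i" and ?B' = "\<Union>i\<in>I - T. F i"
  have [measurable]: "\<mu> (F i) \<in> borel_measurable M" if "i \<in> I" for i using meas_partition_sets[OF I that] by simp
  have B [measurable]: "?B \<in> sets N" "?B' \<in> sets N"
    using T by (auto intro!: meas_partition_UN_sets[OF I])
  have "AE \<omega> in M. \<mu> ?B \<omega> = (\<Sum>i\<in>T. \<mu> (F i) \<omega>)" "AE \<omega> in M. \<mu> ?B' \<omega> = (\<Sum>i\<in>I - T. \<mu> (F i) \<omega>)"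
    using T by (auto intro!: meas_partition_sum_AE[OF I])
  then have "AE \<omega> in M. ?S \<omega> = \<mu> ?B \<omega> - \<mu> ?B' \<omega>"
  proof eventually_elim
    case (elim \<omega>)
    have "?S \<omega> = (\<Sum>i\<in>I - T. rsign T i * \<mu> (F i) \<omega>) + (\<Sum>i\<in>T. rsign T i * \<mu> (F i) \<omega>)"
      using meas_partition_finite[OF I] T by (intro sum.subset_diff) auto
    also have "\<dots> = (\<Sum>i\<in>I - T. - \<mu> (F i) \<omega>) + (\<Sum>i\<in>T. \<mu> (F i) \<omega>)"
      by (intro arg_cong2[where f = "(+)"] sum.cong) (auto simp: rsign_def)
    finally show ?case using elim by (simp add: sum_negf)
  qed
  then have "tail ?S (r + r) = tail (\<lambda>\<omega>. \<mu> ?B \<omega> - \<mu> ?B' \<omega>) (r + r)"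
    using B by (intro tail_cong_AE) auto
  also have "\<dots> \<le> tail (\<mu> ?B) r + tail (\<mu> ?B') r" using B by (intro tail_diff) auto
  finally show ?thesis .
qed

definition large_count :: "'i set \<Rightarrow> ('i \<Rightarrow> 'x set) \<Rightarrow> real \<Rightarrow> 'w \<Rightarrow> real" where
  "large_count I F r \<omega> = (\<Sum>i\<in>I. of_bool (\<bar>\<mu> (F i) \<omega>\<bar> > r))"

lemma large_count_measurable [measurable]:
  assumes "\<And>i. i \<in> I \<Longrightarrow> F i \<in> sets N"
  shows "large_count I F r \<in> borel_measurable M"
proof -
  have [measurable]: "\<mu> (F i) \<in> borel_measurable M" if "i \<in> I" for i using assms[OF that] by simp
  show ?thesis unfolding large_count_def[abs_def] of_bool_def by measurable
qed

lemma large_count_nonneg: "large_count I F r \<omega> \<ge> 0"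
  unfolding large_count_def by (intro sum_nonneg) auto

lemma large_count_antimono: "r \<le> s \<Longrightarrow> large_count I F s \<omega> \<le> large_count I F r \<omega>"
  unfolding large_count_def by (intro sum_mono) auto

text \<open>
  Existential statements about partitions speak of index sets of natural numbers; this lemma brings
  refinements back to that form.
\<close>
lemma meas_partition_reindex:
  assumes "meas_partition Y I F"
  shows "\<exists>(J::nat set) G. meas_partition Y J G \<and> (\<forall>r \<omega>. large_count J G r \<omega> = large_count I F r \<omega>)"
proof -
  obtain h where h: "bij_betw h {0..<card I} I"
    using ex_bij_betw_nat_finite[OF meas_partition_finite[OF assms]] by auto
  have inj: "inj_on h {0..<card I}" and img: "h ` {0..<card I} = I" using h by (auto simp: bij_betw_def)
  have "meas_partition Y {0..<card I} (F \<circ> h)"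
    unfolding meas_partition_def
  proof (intro conjI ballI)
    show "disjoint_family_on (F \<circ> h) {0..<card I}"
      unfolding disjoint_family_on_def
    proof (intro ballI impI)
      fix a b assume ab: "a \<in> {0..<card I}" "b \<in> {0..<card I}" "a \<noteq> b"
      then have "h a \<noteq> h b" "h a \<in> I" "h b \<in> I" using inj img by (auto dest: inj_onD)
      then show "(F \<circ> h) a \<inter> (F \<circ> h) b = {}"
        using assms by (auto simp: meas_partition_def disjoint_family_on_def)
    qed
    show "(\<Union>i\<in>{0..<card I}. (F \<circ> h) i) = Y"
      using meas_partition_union[OF assms] img by (metis image_comp)
    show "(F \<circ> h) i \<in> sets N" if "i \<in> {0..<card I}" for i
      using meas_partition_sets[OF assms, of "h i"] imageI[OF that, of h] img by simp
  qed simp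
  moreover have "large_count {0..<card I} (F \<circ> h) r \<omega> = large_count I F r \<omega>" for r \<omega>
    unfolding large_count_def o_def by (rule sum.reindex_bij_betw[OF h, of "\<lambda>i. of_bool (\<bar>\<mu> (F i) \<omega>\<bar> > r)"])
  ultimately show ?thesis by blast
qed

text \<open>
  Refinement by \<open>card J\<close> cells lowers the threshold by the factor \<open>card J\<close> at most: a large cell cannot
  consist of small pieces only.
\<close>
lemma large_count_refine_AE:
  fixes r :: real
  assumes I: "meas_partition Y I F" and J: "meas_partition Y J G" and "r \<ge> 0"
  shows "AE \<omega> in M. large_count I F (real (card J) * r) \<omega> \<le> (\<Sum>j\<in>J. large_count I (\<lambda>i. F i \<inter> G j) r \<omega>)"
proof -
  have "\<forall>i\<in>I. AE \<omega> in M. \<mu> (F i) \<omega> = (\<Sum>j\<in>J. \<mu> (F i \<inter> G j) \<omega>)"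
    using meas_partition_sum_inter_AE[OF J] I by (auto simp: meas_partition_def)
  then have "AE \<omega> in M. \<forall>i\<in>I. \<mu> (F i) \<omega> = (\<Sum>j\<in>J. \<mu> (F i \<inter> G j) \<omega>)"
    using meas_partition_finite[OF I] by (subst AE_finite_all) auto
  then show ?thesis
  proof eventually_elim
    case (elim \<omega>)
    have "of_bool (\<bar>\<mu> (F i) \<omega>\<bar> > real (card J) * r) \<le> (\<Sum>j\<in>J. of_bool (\<bar>\<mu> (F i \<inter> G j) \<omega>\<bar> > r) :: real)" if i: "i \<in> I" for i
    proof (cases "\<exists>j\<in>J. \<bar>\<mu> (F i \<inter> G j) \<omega>\<bar> > r")
      case True
      then obtain j where "j \<in> J" "\<bar>\<mu> (F i \<inter> G j) \<omega>\<bar> > r" by auto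
      then have "(1::real) \<le> (\<Sum>j\<in>J. of_bool (\<bar>\<mu> (F i \<inter> G j) \<omega>\<bar> > r))"
        using member_le_sum[of j J "\<lambda>j. of_bool (\<bar>\<mu> (F i \<inter> G j) \<omega>\<bar> > r) :: real"] meas_partition_finite[OF J] by simp
      then show ?thesis by (auto intro: order_trans[of _ 1])
    next
      case False
      have "\<bar>\<mu> (F i) \<omega>\<bar> \<le> (\<Sum>j\<in>J. \<bar>\<mu> (F i \<inter> G j) \<omega>\<bar>)" using elim i by simp
      also have "\<dots> \<le> (\<Sum>j\<in>J. r)" using False by (intro sum_mono) auto
      finally show ?thesis by (simp add: sum_nonneg)
    qed
    then have "large_count I F (real (card J) * r) \<omega> \<le> (\<Sum>i\<in>I. \<Sum>j\<in>J. of_bool (\<bar>\<mu> (F i \<inter> G j) \<omega>\<bar> > r))"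
      unfolding large_count_def by (intro sum_mono)
    then show ?case unfolding large_count_def by (subst sum.swap)
  qed
qed

text \<open>
  With probability at least \<open>d\<close>, suitable partitions of \<open>Y\<close> have arbitrarily many cells of arbitrarily large
  measure. One parameter \<open>R\<close> for both quantities makes the notion stable under finite refinements, since
  \<open>R\<close> may be chosen after the refinement.
\<close>
definition crowded :: "'x set \<Rightarrow> real \<Rightarrow> bool" where
  "crowded Y d \<longleftrightarrow> (\<forall>R>0. \<exists>(I::nat set) F. meas_partition Y I F \<and> prob {\<omega>\<in>space M. large_count I F R \<omega> > R} \<ge> d)"

text \<open>
  A crowded set contains a set of large measure whose removal hardly affects crowdedness. Fix a
  partition \<open>G\<close> of \<open>Y\<close> with many large cells and let \<open>A\<close> be the union of a random selection of its cells,
  each with the small probability \<open>\<theta>\<close>. Where \<open>G\<close> has many large cells, one of them is selected with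
  probability at least \<open>1 - \<theta>\<close>. On the other hand, given another partition with
  many large cells, common refinement with \<open>G\<close> distributes these over the cells of \<open>G\<close>, and by Markov's inequality
  \<open>A\<close> receives at least half of them with probability at most \<open>2 \<theta>\<close>. As \<open>G\<close> has only finitely many unions of
  cells, one choice of \<open>A\<close> serves infinitely many of the latter partitions, hence all thresholds.
\<close>
lemma crowded_split:
  assumes Y: "crowded Y d" and \<theta>: "0 < \<theta>" "\<theta> < 1"
  shows "\<exists>A\<in>sets N. \<exists>B\<in>sets N. A \<subseteq> Y \<and> B \<subseteq> A \<and> tail (\<mu> B) 1 \<ge> (d - 3 * \<theta>) / 4 \<and> crowded (Y - A) (d - 3 * \<theta>)"
proof -
  obtain K where K: "(1 - \<theta>) ^ K < \<theta>" using real_arch_pow_inv[of \<theta> "1 - \<theta>"] \<theta> by auto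
  define R1 where "R1 = max 2 (real K)"
  have "R1 > 0" by (simp add: R1_def)
  with Y obtain J :: "nat set" and G where J: "meas_partition Y J G" and PJ: "prob {\<omega>\<in>space M. large_count J G R1 \<omega> > R1} \<ge> d"
    unfolding crowded_def by blast
  have finJ: "finite J" using J by (rule meas_partition_finite)
  have G [measurable]: "G j \<in> sets N" if "j \<in> J" for j using J that by (rule meas_partition_sets)
  have cntJ [measurable]: "large_count J G r \<in> borel_measurable M" for r by (intro large_count_measurable G)
  define q where "q = real (card J)"
  have q: "q \<ge> 0" by (simp add: q_def)
  \<comment> \<open>The factor \<open>q\<close> compensates for the refinement, and \<open>2\<close> for keeping half of the large cells.\<close>
  define thr where "thr = (\<lambda>m::nat. (q + 2) * real (Suc m))"
  have "\<forall>m. \<exists>(I::nat set) F. meas_partition Y I F \<and> prob {\<omega>\<in>space M. large_count I F (thr m) \<omega> > thr m} \<ge> d"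
  proof
    fix m have "thr m > 0" using q by (simp add: thr_def)
    then show "\<exists>(I::nat set) F. meas_partition Y I F \<and> prob {\<omega>\<in>space M. large_count I F (thr m) \<omega> > thr m} \<ge> d"
      using Y unfolding crowded_def by blast
  qed
  then obtain I :: "nat \<Rightarrow> nat set" and F where I: "\<And>m. meas_partition Y (I m) (F m)"
    and PI: "\<And>m. prob {\<omega>\<in>space M. large_count (I m) (F m) (thr m) \<omega> > thr m} \<ge> d" by metis
  have F: "F m i \<in> sets N" if "i \<in> I m" for m i using I that by (rule meas_partition_sets)
  define C where "C = (\<lambda>m T \<omega>. \<Sum>j\<in>T. large_count (I m) (\<lambda>i. F m i \<inter> G j) (real (Suc m)) \<omega>)"
  have C_meas [measurable]: "C m T \<in> borel_measurable M" if "T \<subseteq> J" for m T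
    unfolding C_def using that by (intro borel_measurable_sum large_count_measurable sets.Int F G) auto
  have cntI [measurable]: "large_count (I m) (F m) r \<in> borel_measurable M" for m r by (intro large_count_measurable F)
  \<comment> \<open>\<open>?bad1\<close>: the selection misses the large cells of \<open>G\<close>; \<open>?bad2\<close>: it takes too many of the others\<close>
  let ?bad1 = "\<lambda>T \<omega>. large_count J G R1 \<omega> > R1 \<and> \<not> (\<exists>j\<in>T. \<bar>\<mu> (G j) \<omega>\<bar> > R1)"
  let ?bad2 = "\<lambda>m T \<omega>. large_count (I m) (F m) (thr m) \<omega> > thr m \<and> \<not> C m (J - T) \<omega> > Suc m"
  have bad1_ev: "{\<omega>\<in>space M. ?bad1 T \<omega>} \<in> events" if "T \<subseteq> J" for T
  proof -
    have [measurable]: "\<mu> (G j) \<in> borel_measurable M" if "j \<in> T" for j using that \<open>T \<subseteq> J\<close> by auto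
    have [simp]: "finite T" using finJ \<open>T \<subseteq> J\<close> finite_subset by auto
    show ?thesis by measurable
  qed
  have bad2_ev: "{\<omega>\<in>space M. ?bad2 m T \<omega>} \<in> events" for m T
  proof -
    have [measurable]: "C m (J - T) \<in> borel_measurable M" by (intro C_meas) auto
    show ?thesis by measurable
  qed
  let ?A = "subset_avg J (\<lambda>_. \<theta>)"
  have bad1: "?A (\<lambda>T. prob {\<omega>\<in>space M. ?bad1 T \<omega>}) \<le> \<theta>"
  proof (rule subset_avg_prob_le[OF finJ bad1_ev], assumption, intro AE_I2)
    fix \<omega>
    define S where "S = {j\<in>J. \<bar>\<mu> (G j) \<omega>\<bar> > R1}"
    have cS: "large_count J G R1 \<omega> = card S"
      unfolding large_count_def S_def of_bool_def using finJ by (simp add: sum.If_cases Int_def)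
    show "?A (\<lambda>T. of_bool (?bad1 T \<omega>)) \<le> \<theta>"
    proof (cases "large_count J G R1 \<omega> > R1")
      case True
      then have "K \<le> card S" using cS by (simp add: R1_def)
      then have "(1 - \<theta>) ^ card S \<le> (1 - \<theta>) ^ K" using \<theta> by (intro power_decreasing) auto
      moreover have "?A (\<lambda>T. of_bool (?bad1 T \<omega>)) = ?A (\<lambda>T. of_bool (S \<inter> T = {}))"
        using True by (intro subset_avg_cong) (auto simp: S_def)
      moreover have "?A (\<lambda>T. of_bool (S \<inter> T = {})) = (1 - \<theta>) ^ card S"
        using finJ by (intro subset_avg_avoid) (auto simp: S_def)
      ultimately show ?thesis using K by simp
    qed (use \<theta> finJ in \<open>simp add: subset_avg_const\<close>)
  qed
  have bad2: "?A (\<lambda>T. prob {\<omega>\<in>space M. ?bad2 m T \<omega>}) \<le> 2 * \<theta>" for m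
  proof (rule subset_avg_prob_le[OF finJ bad2_ev])
    have "AE \<omega> in M. large_count (I m) (F m) (q * real (Suc m)) \<omega> \<le> C m J \<omega>"
      unfolding q_def C_def by (rule large_count_refine_AE[OF I J]) simp
    then show "AE \<omega> in M. ?A (\<lambda>T. of_bool (?bad2 m T \<omega>)) \<le> 2 * \<theta>"
    proof eventually_elim
      case (elim \<omega>)
      show ?case
      proof (cases "large_count (I m) (F m) (thr m) \<omega> > thr m")
        case True
        have "2 * real (Suc m) \<le> thr m" unfolding thr_def using q by (intro mult_right_mono) auto
        also have "thr m < large_count (I m) (F m) (thr m) \<omega>" by fact
        also have "\<dots> \<le> large_count (I m) (F m) (q * real (Suc m)) \<omega>"
          by (intro large_count_antimono) (simp add: thr_def algebra_simps)
        also have "\<dots> \<le> C m J \<omega>" by fact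
        finally have C: "2 * real (Suc m) < C m J \<omega>" .
        have "?A (\<lambda>T. of_bool (?bad2 m T \<omega>)) \<le> ?A (\<lambda>T. of_bool (C m T \<omega> \<ge> C m J \<omega> / 2))"
        proof (rule subset_avg_mono)
          fix T assume "T \<subseteq> J"
          then have "C m J \<omega> = C m T \<omega> + C m (J - T) \<omega>"
            unfolding C_def using finJ by (simp add: sum.subset_diff add.commute)
          then show "of_bool (?bad2 m T \<omega>) \<le> (of_bool (C m T \<omega> \<ge> C m J \<omega> / 2) :: real)"
            using C by (auto simp: of_bool_def)
        qed (use \<theta> in auto)
        also have "\<dots> \<le> ?A (\<lambda>T. C m T \<omega>) / (C m J \<omega> / 2)"
          using C \<theta> finJ by (intro subset_avg_markov) (auto simp: C_def intro!: sum_nonneg large_count_nonneg)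
        also have "?A (\<lambda>T. C m T \<omega>) = \<theta> * C m J \<omega>"
          unfolding C_def by (rule subset_avg_sum_mem[OF finJ])
        finally show ?thesis using C by simp
      qed (use \<theta> finJ in \<open>simp add: subset_avg_const\<close>)
    qed
  qed
  have "\<forall>m. \<exists>T\<subseteq>J. prob {\<omega>\<in>space M. ?bad1 T \<omega>} + prob {\<omega>\<in>space M. ?bad2 m T \<omega>} \<le> 3 * \<theta>"
  proof
    fix m
    show "\<exists>T\<subseteq>J. prob {\<omega>\<in>space M. ?bad1 T \<omega>} + prob {\<omega>\<in>space M. ?bad2 m T \<omega>} \<le> 3 * \<theta>"
    proof (rule subset_avg_le_witness[OF finJ])
      show "?A (\<lambda>T. prob {\<omega>\<in>space M. ?bad1 T \<omega>} + prob {\<omega>\<in>space M. ?bad2 m T \<omega>}) \<le> 3 * \<theta>"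
        unfolding subset_avg_add using bad1 bad2[of m] by linarith
    qed (use \<theta> in simp)
  qed
  from choice[OF this] obtain T where T': "\<forall>m. T m \<subseteq> J \<and>
    prob {\<omega>\<in>space M. ?bad1 (T m) \<omega>} + prob {\<omega>\<in>space M. ?bad2 m (T m) \<omega>} \<le> 3 * \<theta>" by (rule exE)
  have T: "T m \<subseteq> J" for m using spec[OF T', of m] by (rule conjunct1)
  have bad: "prob {\<omega>\<in>space M. ?bad1 (T m) \<omega>} + prob {\<omega>\<in>space M. ?bad2 m (T m) \<omega>} \<le> 3 * \<theta>" for m
    using spec[OF T', of m] by (rule conjunct2)
  have "finite (range T)" using T finJ by (intro finite_subset[of "range T" "Pow J"]) auto
  then obtain m0 where inf: "infinite {m. T m = T m0}"
    using pigeonhole_infinite[of UNIV T] by auto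
  define S where "S = T m0"
  have S: "S \<subseteq> J" "finite S" using T[of m0] finite_subset[OF T finJ] by (auto simp: S_def)
  define A where "A = (\<Union>j\<in>S. G j)"
  have A: "A \<in> sets N" "A \<subseteq> Y"
    using meas_partition_UN_sets[OF J S(1)] J S by (auto simp: A_def meas_partition_def)
  have G_meas [measurable]: "\<mu> (G j) \<in> borel_measurable M" if "j \<in> S" for j using that S by auto
  have half_le: "e / 4 \<le> b \<or> e / 4 \<le> c" if "x \<le> b + c" "1/2 * p \<le> x" "e \<le> p" for x b c p e :: real
    using that by auto
  have "\<exists>B\<in>sets N. B \<subseteq> A \<and> tail (\<mu> B) 1 \<ge> (d - 3 * \<theta>) / 4"
  proof -
    let ?H = "{\<omega>\<in>space M. \<exists>j\<in>S. \<bar>\<mu> (G j) \<omega>\<bar> > R1}"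
    have H [measurable]: "?H \<in> events" using S(2) by measurable
    have "d \<le> prob (?H \<union> {\<omega>\<in>space M. ?bad1 S \<omega>})"
      using H bad1_ev[OF S(1)] by (intro order_trans[OF PJ] finite_measure_mono) auto
    also have "\<dots> \<le> prob ?H + prob {\<omega>\<in>space M. ?bad1 S \<omega>}"
      using H bad1_ev[OF S(1)] by (intro measure_Un_le) auto
    finally have "d \<le> prob ?H + prob {\<omega>\<in>space M. ?bad1 S \<omega>}" .
    then have PH: "d - 3 * \<theta> \<le> prob ?H" using bad[of m0] unfolding S_def[symmetric]
      using measure_nonneg[of M "{\<omega>\<in>space M. ?bad2 m0 S \<omega>}"] by linarith
    \<comment> \<open>Which cell is large depends on \<open>\<omega>\<close>; random signs produce a set \<open>B\<close> that does not.\<close>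
    let ?X = "\<lambda>T \<omega>. \<Sum>j\<in>S. rsign T j * \<mu> (G j) \<omega>"
    have "1/2 * prob ?H \<le> subset_avg S (\<lambda>_. 1/2) (\<lambda>T. prob {\<omega>\<in>space M. \<bar>?X T \<omega>\<bar> > 2})"
    proof (rule prob_le_subset_avg)
      show "AE \<omega> in M. \<omega> \<in> ?H \<longrightarrow> 1/2 \<le> subset_avg S (\<lambda>_. 1/2) (\<lambda>T. of_bool (\<bar>?X T \<omega>\<bar> > 2))"
      proof (intro AE_I2 impI)
        fix \<omega> assume "\<omega> \<in> ?H"
        then obtain j where j: "j \<in> S" "\<bar>\<mu> (G j) \<omega>\<bar> > 2" by (auto simp: R1_def)
        have "1/2 \<le> subset_avg S (\<lambda>_. 1/2) (\<lambda>T. of_bool (\<bar>?X T \<omega>\<bar> \<ge> \<bar>\<mu> (G j) \<omega>\<bar>))"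
          using S j by (intro rsign_sum_toggle) auto
        also have "\<dots> \<le> subset_avg S (\<lambda>_. 1/2) (\<lambda>T. of_bool (\<bar>?X T \<omega>\<bar> > 2))"
          using j by (intro subset_avg_mono) auto
        finally show "1/2 \<le> subset_avg S (\<lambda>_. 1/2) (\<lambda>T. of_bool (\<bar>?X T \<omega>\<bar> > 2))" .
      qed
    qed (use S in auto)
    then have "\<exists>T\<subseteq>S. prob {\<omega>\<in>space M. \<bar>?X T \<omega>\<bar> > 2} \<ge> 1/2 * prob ?H"
      using S by (intro subset_avg_ge_witness) auto
    then obtain T where T: "T \<subseteq> S" and PT: "tail (?X T) 2 \<ge> 1/2 * prob ?H" by (auto simp: tail_def)
    let ?B = "\<Union>j\<in>T. G j" and ?B' = "\<Union>j\<in>S - T. G j"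
    have B [measurable]: "?B \<in> sets N" "?B' \<in> sets N"
      using T S by (auto intro!: meas_partition_UN_sets[OF J])
    have "tail (?X T) 2 \<le> tail (\<mu> ?B) 1 + tail (\<mu> ?B') 1"
      using tail_rsign_sum[OF meas_partition_subset[OF J S(1)] T, of 1] by simp
    then have "(d - 3 * \<theta>) / 4 \<le> tail (\<mu> ?B) 1 \<or> (d - 3 * \<theta>) / 4 \<le> tail (\<mu> ?B') 1"
      using half_le[OF _ PT PH] by blast
    moreover have "?B \<subseteq> A" "?B' \<subseteq> A" using T by (auto simp: A_def)
    ultimately show ?thesis using B by blast
  qed
  moreover have "crowded (Y - A) (d - 3 * \<theta>)"
    unfolding crowded_def
  proof (intro allI impI)
    fix R :: real assume "R > 0"
    obtain m where m: "m \<ge> nat \<lceil>R\<rceil>" "T m = S"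
      using inf unfolding infinite_nat_iff_unbounded_le S_def by blast
    then have R: "R \<le> real (Suc m)" by linarith
    have "meas_partition (\<Union>j\<in>J - S. G j) (J - S) G" using meas_partition_subset[OF J] by auto
    then have "meas_partition (Y \<inter> (Y - A)) (I m \<times> (J - S)) (\<lambda>(i, j). F m i \<inter> G j)"
      unfolding meas_partition_Diff[OF J S(1)] A_def by (intro meas_partition_prod I)
    moreover have "Y \<inter> (Y - A) = Y - A" by auto
    ultimately obtain I' :: "nat set" and F' where I': "meas_partition (Y - A) I' F'"
      and cnt_eq: "\<And>r \<omega>. large_count I' F' r \<omega> = large_count (I m \<times> (J - S)) (\<lambda>(i, j). F m i \<inter> G j) r \<omega>"
      using meas_partition_reindex[of "Y - A" "I m \<times> (J - S)" "\<lambda>(i, j). F m i \<inter> G j"] by auto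
    have "large_count I' F' (Suc m) \<omega> = C m (J - S) \<omega>" for \<omega>
      unfolding cnt_eq unfolding C_def large_count_def
      by (subst sum.swap, subst sum.cartesian_product) (simp add: case_prod_unfold)
    then have C: "C m (J - S) \<omega> \<le> large_count I' F' R \<omega>" for \<omega> using large_count_antimono[OF R, of I' F' \<omega>] by simp
    have [measurable]: "large_count I' F' R \<in> borel_measurable M" using I' by (intro large_count_measurable meas_partition_sets)
    let ?E = "{\<omega>\<in>space M. large_count I' F' R \<omega> > R}"
    have E: "?E \<in> events" by measurable
    have "d \<le> prob (?E \<union> {\<omega>\<in>space M. ?bad2 m S \<omega>})"
    proof (intro order_trans[OF PI[of m]] finite_measure_mono subsetI)
      fix \<omega> assume *: "\<omega> \<in> {\<omega>\<in>space M. large_count (I m) (F m) (thr m) \<omega> > thr m}"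
      show "\<omega> \<in> ?E \<union> {\<omega>\<in>space M. ?bad2 m S \<omega>}"
      proof (cases "C m (J - S) \<omega> > Suc m")
        case True
        then have "large_count I' F' R \<omega> > R" using C[of \<omega>] R by linarith
        then show ?thesis using * by auto
      qed (use * in auto)
    qed (use E bad2_ev in auto)
    also have "\<dots> \<le> prob ?E + prob {\<omega>\<in>space M. ?bad2 m S \<omega>}"
      using E bad2_ev by (intro measure_Un_le) auto
    finally have "d - 3 * \<theta> \<le> prob ?E"
      using bad[of m] measure_nonneg[of M "{\<omega>\<in>space M. ?bad1 S \<omega>}"] unfolding m(2) by linarith
    then show "\<exists>(I::nat set) F. meas_partition (Y - A) I F \<and> prob {\<omega>\<in>space M. large_count I F R \<omega> > R} \<ge> d - 3 * \<theta>"
      using I' by blast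
  qed
  ultimately show ?thesis using A by blast
qed

text \<open>
  Splitting off sets with summable losses \<open>3 \<theta>\<close> never reduces \<open>d\<close> below \<open>d / 2\<close>, and yields infinitely many
  disjoint sets of large measure.
\<close>
lemma not_crowded:
  assumes "d > 0"
  shows "\<not> crowded (space N) d"
proof
  assume c: "crowded (space N) d"
  then obtain I :: "nat set" and F where "prob {\<omega>\<in>space M. large_count I F 1 \<omega> > 1} \<ge> d"
    unfolding crowded_def by (metis zero_less_one)
  then have "d \<le> 1" by (rule order_trans) simp
  define e where "e = (\<lambda>n. d / 2 + d / 2 * (1/2)^n)"
  have "\<exists>Y. \<forall>n. crowded (Y n) (e n) \<and>
    (Y (Suc n) \<subseteq> Y n \<and> (\<exists>B\<in>sets N. B \<subseteq> Y n - Y (Suc n) \<and> tail (\<mu> B) 1 \<ge> d / 8))"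
  proof (rule dependent_nat_choice)
    show "\<exists>Y. crowded Y (e 0)" using c by (auto simp: e_def)
    fix Y and n :: nat assume "crowded Y (e n)"
    define \<theta> where "\<theta> = d / 12 * (1/2)^n"
    have "(1/2::real)^n \<le> 1" by (intro power_le_one) auto
    then have "d / 12 * (1/2)^n \<le> 1/12 * 1" using \<open>d \<le> 1\<close> \<open>d > 0\<close> by (intro mult_mono) auto
    then have \<theta>: "0 < \<theta>" "\<theta> < 1" using \<open>d > 0\<close> by (auto simp: \<theta>_def)
    have e: "e n - 3 * \<theta> = e (Suc n)" by (simp add: e_def \<theta>_def)
    obtain A B where AB: "A \<in> sets N" "B \<in> sets N" "A \<subseteq> Y" "B \<subseteq> A" "tail (\<mu> B) 1 \<ge> e (Suc n) / 4"
      "crowded (Y - A) (e (Suc n))"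
      using crowded_split[OF \<open>crowded Y (e n)\<close> \<theta>] unfolding e by blast
    have "e (Suc n) / 4 \<ge> d / 8" using \<open>d > 0\<close> by (simp add: e_def)
    then show "\<exists>Y'. crowded Y' (e (Suc n)) \<and> (Y' \<subseteq> Y \<and> (\<exists>B\<in>sets N. B \<subseteq> Y - Y' \<and> tail (\<mu> B) 1 \<ge> d / 8))"
      using AB by (intro exI[of _ "Y - A"]) (auto intro!: bexI[of _ B])
  qed
  then obtain Y where sub: "\<And>n. Y (Suc n) \<subseteq> Y n"
    and "\<And>n. \<exists>B\<in>sets N. B \<subseteq> Y n - Y (Suc n) \<and> tail (\<mu> B) 1 \<ge> d / 8" by blast
  then obtain B where B: "\<And>n. B n \<in> sets N" "\<And>n. B n \<subseteq> Y n - Y (Suc n)" "\<And>n. tail (\<mu> (B n)) 1 \<ge> d / 8"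
    by metis
  have "decseq Y" using sub by (intro decseq_SucI)
  from disjoint_family_decseq_Diff[OF this] have "disjoint_family B"
    using B(2) unfolding disjoint_family_on_def by blast
  then have "(\<lambda>n. tail (\<mu> (B n)) 1) \<longlonglongrightarrow> 0" using B by (intro mu_exhaustive) auto
  then have "d / 8 \<le> 0" using B(3) by (intro LIMSEQ_le_const) auto
  with \<open>d > 0\<close> show False by simp
qed

end

section \<open>Boundedness in probability\<close>

context l0_measure begin

lemma large_count_bounded:
  assumes "\<delta> > 0"
  shows "\<exists>R>0. \<forall>(I::nat set) F. meas_partition (space N) I F \<longrightarrow> prob {\<omega>\<in>space M. large_count I F R \<omega> > R} < \<delta>"
  using not_crowded[OF assms] unfolding crowded_def by (auto simp: not_le)

text \<open>
  If the values of \<open>\<mu>\<close> were unbounded, partitions with many large cells could be built by successive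
  bisections. Given a partition \<open>F\<close>, choose \<open>A\<close> so that \<open>\<mu> A\<close> is much larger than all cell values, on an event \<open>D\<close> of
  probability at least \<open>\<delta>/2\<close>. On \<open>D\<close> some cell meets \<open>A\<close> in a set of huge measure, and then its other half has huge measure
  too, so that this cell leaves two large ones behind. Elsewhere no large cell gets lost, because one of
  two halves has at least half the measure; this is why the threshold is \<open>2 t\<close> before and \<open>t\<close> after the
  bisection. The variable \<open>g\<close> counts the bisections for which \<open>D\<close> has occurred.
\<close>
lemma growing_count:
  assumes unbdd: "\<And>R. R > 0 \<Longrightarrow> \<exists>A\<in>sets N. tail (\<mu> A) R > \<delta>" and "\<delta> > 0" and "t > 0"
  shows "\<exists>(I::nat set) F g. meas_partition (space N) I F \<and> g \<in> borel_measurable M \<and> (\<forall>\<omega>. 0 \<le> g \<omega> \<and> g \<omega> \<le> real n) \<and>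
    expectation g \<ge> n * \<delta> / 2 \<and> (AE \<omega> in M. g \<omega> \<le> large_count I F t \<omega>)"
  using \<open>t > 0\<close>
proof (induction n arbitrary: t)
  case 0
  have "meas_partition (space N) {0::nat} (\<lambda>_. space N)" by (auto simp: meas_partition_def disjoint_family_on_def)
  then show ?case
    by (intro exI[of _ "{0::nat}"] exI[of _ "\<lambda>_. space N"] exI[of _ "\<lambda>_. 0"]) (auto simp: large_count_nonneg)
next
  case (Suc n)
  have "2 * t > 0" using Suc.prems by simp
  from Suc.IH[OF this] obtain I :: "nat set" and F g where I: "meas_partition (space N) I F" and g [measurable]: "g \<in> borel_measurable M"
    and g_bd: "\<And>\<omega>. 0 \<le> g \<omega> \<and> g \<omega> \<le> real n" and Eg: "expectation g \<ge> n * \<delta> / 2"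
    and g_le: "AE \<omega> in M. g \<omega> \<le> large_count I F (2 * t) \<omega>"
    by blast
  have F: "F i \<in> sets N" if "i \<in> I" for i using I that by (rule meas_partition_sets)
  have [measurable]: "\<mu> (F i) \<in> borel_measurable M" if "i \<in> I" for i using F[OF that] by simp
  have finI: "finite I" using I by (rule meas_partition_finite)
  let ?W = "\<lambda>\<omega>. \<Sum>i\<in>I. \<bar>\<mu> (F i) \<omega>\<bar>"
  obtain B where B: "B > 0" "tail ?W B < \<delta> / 2"
    using tight_random_variable[of ?W "\<delta> / 2"] \<open>\<delta> > 0\<close> unfolding tail_def by auto
  define R where "R = (real (card I) + 1) * (B + t)"
  have "R > 0" using B Suc.prems by (simp add: R_def)
  then obtain A where A [measurable]: "A \<in> sets N" and tA: "tail (\<mu> A) R > \<delta>" using unbdd by blast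
  define D where "D = {\<omega>\<in>space M. \<bar>\<mu> A \<omega>\<bar> > R \<and> ?W \<omega> \<le> B}"
  have D [measurable]: "D \<in> events" unfolding D_def by measurable
  have "tail (\<mu> A) R \<le> prob (D \<union> {\<omega>\<in>space M. \<bar>?W \<omega>\<bar> > B})"
    unfolding tail_def by (intro finite_measure_mono) (auto simp: D_def sum_nonneg)
  also have "\<dots> \<le> prob D + tail ?W B" unfolding tail_def by (intro measure_Un_le) auto
  finally have PD: "prob D \<ge> \<delta> / 2" using tA B by linarith
  define G where "G = (\<lambda>b. if b then A else space N - A)"
  have G: "meas_partition (space N) UNIV G"
    using sets.sets_into_space[OF A] unfolding meas_partition_def disjoint_family_on_def G_def by (auto simp: UNIV_bool)
  have FA: "F i \<inter> (space N - A) = F i - A" if "i \<in> I" for i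
    using sets.sets_into_space[OF F[OF that]] by auto
  from meas_partition_reindex[OF meas_partition_prod[OF I G]] obtain I' :: "nat set" and F' where
    I': "meas_partition (space N) I' F'" and large_count: "\<And>r \<omega>. large_count I' F' r \<omega> = large_count (I \<times> UNIV) (\<lambda>(i, b). F i \<inter> G b) r \<omega>"
    by auto
  have large_count': "large_count I' F' r \<omega> =
      (\<Sum>i\<in>I. of_bool (\<bar>\<mu> (F i \<inter> A) \<omega>\<bar> > r) + of_bool (\<bar>\<mu> (F i - A) \<omega>\<bar> > r))" for r \<omega>
  proof -
    have "large_count I' F' r \<omega> = (\<Sum>i\<in>I. \<Sum>b\<in>UNIV. of_bool (\<bar>\<mu> (F i \<inter> G b) \<omega>\<bar> > r))"
      unfolding large_count unfolding large_count_def by (subst sum.cartesian_product) (simp add: case_prod_unfold)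
    also have "\<dots> = (\<Sum>i\<in>I. of_bool (\<bar>\<mu> (F i \<inter> A) \<omega>\<bar> > r) + of_bool (\<bar>\<mu> (F i - A) \<omega>\<bar> > r))"
      by (intro sum.cong) (auto simp: UNIV_bool G_def FA)
    finally show ?thesis .
  qed
  define g' where "g' = (\<lambda>\<omega>. g \<omega> + indicator D \<omega>)"
  have intg: "integrable M g"
    using g_bd by (intro integrable_const_bound[where B = "real n"]) (auto intro!: AE_I2)
  have "AE \<omega> in M. \<forall>i\<in>I. \<mu> (F i) \<omega> = \<mu> (F i \<inter> A) \<omega> + \<mu> (F i - A) \<omega>"
  proof (subst AE_finite_all[OF finI], intro ballI)
    fix i assume "i \<in> I"
    then have "AE \<omega> in M. \<mu> ((F i \<inter> A) \<union> (F i - A)) \<omega> = \<mu> (F i \<inter> A) \<omega> + \<mu> (F i - A) \<omega>"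
      using F by (intro mu_Un) auto
    moreover have "(F i \<inter> A) \<union> (F i - A) = F i" by auto
    ultimately show "AE \<omega> in M. \<mu> (F i) \<omega> = \<mu> (F i \<inter> A) \<omega> + \<mu> (F i - A) \<omega>" by simp
  qed
  moreover have "AE \<omega> in M. \<mu> A \<omega> = (\<Sum>i\<in>I. \<mu> (A \<inter> F i) \<omega>)"
    using sets.sets_into_space[OF A] by (intro meas_partition_sum_inter_AE[OF I]) auto
  ultimately have g'_le: "AE \<omega> in M. g' \<omega> \<le> large_count I' F' t \<omega>"
    using g_le
  proof eventually_elim
    case (elim \<omega>)
    let ?c = "\<lambda>i. of_bool (\<bar>\<mu> (F i \<inter> A) \<omega>\<bar> > t) + of_bool (\<bar>\<mu> (F i - A) \<omega>\<bar> > t) :: real"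
    let ?p = "\<lambda>i. of_bool (\<bar>\<mu> (F i) \<omega>\<bar> > 2 * t) :: real"
    have pc: "?p i \<le> ?c i" if "i \<in> I" for i
      using elim(1) that by (auto simp: of_bool_def)
    show ?case
    proof (cases "\<omega> \<in> D")
      case False
      then show ?thesis using elim(3) sum_mono[of I ?p ?c] pc unfolding g'_def large_count' unfolding large_count_def by simp
    next
      case True
      have "\<exists>i0\<in>I. \<bar>\<mu> (F i0 \<inter> A) \<omega>\<bar> > B + t"
      proof (rule ccontr)
        assume *: "\<not> ?thesis"
        have "\<bar>\<mu> A \<omega>\<bar> \<le> (\<Sum>i\<in>I. \<bar>\<mu> (A \<inter> F i) \<omega>\<bar>)" using elim(2) by simp
        also have "\<dots> \<le> (\<Sum>i\<in>I. B + t)" using * by (intro sum_mono) (auto simp: Int_commute not_less)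
        also have "\<dots> \<le> R" using B Suc.prems by (simp add: R_def algebra_simps)
        finally show False using True by (simp add: D_def)
      qed
      then obtain i0 where i0: "i0 \<in> I" "\<bar>\<mu> (F i0 \<inter> A) \<omega>\<bar> > B + t" by auto
      have "\<bar>\<mu> (F i0) \<omega>\<bar> \<le> ?W \<omega>" using i0(1) finI by (intro member_le_sum) auto
      also have "\<dots> \<le> B" using True by (simp add: D_def)
      finally have "\<bar>\<mu> (F i0) \<omega>\<bar> \<le> B" .
      with elim(1) i0 have "\<bar>\<mu> (F i0 - A) \<omega>\<bar> > t" by (auto dest!: bspec[of I _ i0])
      then have c0: "?c i0 = 2" using i0 B by simp
      have "large_count I F (2 * t) \<omega> + 1 = (\<Sum>i\<in>I. ?p i + of_bool (i = i0))"
        using i0 finI by (simp add: large_count_def sum.distrib of_bool_def sum.delta)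
      also have "\<dots> \<le> (\<Sum>i\<in>I. ?c i)"
      proof (rule sum_mono)
        fix i assume "i \<in> I"
        then show "?p i + of_bool (i = i0) \<le> ?c i" using c0 pc[of i] by (cases "i = i0") auto
      qed
      finally show ?thesis using True elim(3) unfolding g'_def large_count' by simp
    qed
  qed
  have "expectation g' = expectation g + prob D"
    unfolding g'_def using intg
    by (subst Bochner_Integration.integral_add) (auto simp: Int_absorb1 sets.sets_into_space[OF D] less_top[symmetric])
  then have "expectation g' \<ge> real (Suc n) * \<delta> / 2" using Eg PD by (simp add: algebra_simps add_divide_distrib)
  moreover have "0 \<le> g' \<omega> \<and> g' \<omega> \<le> real (Suc n)" for \<omega>
    using g_bd[of \<omega>] by (auto simp: g'_def indicator_def)
  moreover have "g' \<in> borel_measurable M" unfolding g'_def by measurable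
  ultimately show ?case using I' g'_le by blast
qed

text \<open>
  The range of a stochastic measure is bounded in probability (Talagrand; Kalton, Peck and Roberts).
  Otherwise a variable \<open>g \<le> n\<close> of mean at least \<open>n \<delta> / 2\<close> bounds the number of large cells from below after \<open>n\<close>
  bisections, so that for large \<open>n\<close> this number exceeds any given bound with probability at least \<open>\<delta> / 4\<close>.
\<close>
lemma mu_bounded:
  assumes "\<delta> > 0"
  shows "\<exists>R>0. \<forall>A\<in>sets N. tail (\<mu> A) R \<le> \<delta>"
proof (rule ccontr)
  assume "\<not> ?thesis"
  then have unbdd: "\<And>R. R > 0 \<Longrightarrow> \<exists>A\<in>sets N. tail (\<mu> A) R > \<delta>" by (auto simp: not_le)
  obtain R where R: "R > 0" and large_count: "\<And>(I::nat set) F. meas_partition (space N) I F \<Longrightarrow> prob {\<omega>\<in>space M. large_count I F R \<omega> > R} < \<delta> / 4"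
    using large_count_bounded[of "\<delta> / 4"] assms by auto
  obtain n :: nat where "n > 4 * R / \<delta>" using reals_Archimedean2 by auto
  then have n: "real n * \<delta> / 4 > R" using assms by (simp add: field_simps)
  then have n0: "n > 0" using R by (cases n) auto
  obtain I :: "nat set" and F g where I: "meas_partition (space N) I F" and g [measurable]: "g \<in> borel_measurable M"
    and g_bd: "\<And>\<omega>. 0 \<le> g \<omega> \<and> g \<omega> \<le> real n" and Eg: "expectation g \<ge> n * \<delta> / 2"
    and g_le: "AE \<omega> in M. g \<omega> \<le> large_count I F R \<omega>"
    using growing_count[OF unbdd assms R, of n] by blast
  let ?E = "{\<omega>\<in>space M. g \<omega> > R}"
  have [measurable]: "large_count I F R \<in> borel_measurable M" using I by (intro large_count_measurable meas_partition_sets)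
  have "expectation g \<le> (\<integral>\<omega>. real n * indicator ?E \<omega> + R \<partial>M)"
  proof (rule integral_mono)
    show "integrable M g"
      using g_bd by (intro integrable_const_bound[where B = "real n"]) (auto intro!: AE_I2)
    show "integrable M (\<lambda>\<omega>. real n * indicator ?E \<omega> + R)"
      by (intro integrable_const_bound[where B = "real n + R"]) (use R in \<open>auto intro!: AE_I2 simp: indicator_def\<close>)
    show "g \<omega> \<le> real n * indicator ?E \<omega> + R" if "\<omega> \<in> space M" for \<omega>
      using g_bd[of \<omega>] that R by (auto simp: indicator_def)
  qed
  also have "\<dots> = real n * prob ?E + R"
  proof -
    have E: "?E \<in> events" by measurable
    have "?E \<inter> space M = ?E" by blast
    moreover have "integrable M (indicator ?E :: _ \<Rightarrow> real)" using E by (simp add: less_top[symmetric])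
    ultimately show ?thesis using E by (subst Bochner_Integration.integral_add) (simp_all add: prob_space)
  qed
  also have "prob ?E \<le> prob {\<omega>\<in>space M. large_count I F R \<omega> > R}"
    using g_le by (intro finite_measure_mono_AE) (auto elim!: AE_mp)
  also have "\<dots> \<le> \<delta> / 4" using large_count[OF I] by simp
  finally have "expectation g \<le> real n * (\<delta> / 4) + R" using n0 by (simp add: mult_left_mono)
  then have "expectation g \<le> real n * \<delta> / 4 + R" by simp
  then show False using n Eg by linarith
qed

text \<open>
  From sets to functions with values in \<open>[-1, 1]\<close>. There is no convexity to rely on, so the coefficients
  are rounded at random: signs with mean \<open>c i\<close> give a combination with the right mean, whose
  variance is at most \<open>\<Sum> (\<mu> (F i))\<^sup>2\<close>. The latter is bounded in probability, because unbiased signs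
  would otherwise produce large values of \<open>\<mu>\<close>.
\<close>
lemma coefficients_bounded:
  assumes "\<delta> > 0"
  shows "\<exists>R>0. \<forall>(I::'i set) F c. meas_partition (space N) I F \<longrightarrow> (\<forall>i\<in>I. \<bar>c i\<bar> \<le> 1) \<longrightarrow>
    tail (\<lambda>\<omega>. \<Sum>i\<in>I. c i * \<mu> (F i) \<omega>) R \<le> \<delta>"
proof -
  define d where "d = \<delta> / 12"
  have "d > 0" using assms by (simp add: d_def)
  then obtain R where R: "R > 0" and bd: "\<And>A. A \<in> sets N \<Longrightarrow> tail (\<mu> A) R \<le> d" using mu_bounded by blast
  have "tail (\<lambda>\<omega>. \<Sum>i\<in>I. c i * \<mu> (F i) \<omega>) (12 * R) \<le> \<delta>"
    if I: "meas_partition (space N) I F" and c: "\<forall>i\<in>I. \<bar>c i\<bar> \<le> 1" for I :: "'i set" and F c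
  proof -
    have finI: "finite I" using I by (rule meas_partition_finite)
    have F: "F i \<in> sets N" if "i \<in> I" for i using I that by (rule meas_partition_sets)
    have [measurable]: "\<mu> (F i) \<in> borel_measurable M" if "i \<in> I" for i using F[OF that] by simp
    let ?S = "\<lambda>T \<omega>. \<Sum>i\<in>I. rsign T i * \<mu> (F i) \<omega>"
    let ?m = "\<lambda>\<omega>. \<Sum>i\<in>I. c i * \<mu> (F i) \<omega>"
    let ?q = "\<lambda>\<omega>. \<Sum>i\<in>I. (\<mu> (F i) \<omega>)\<^sup>2"
    have S: "prob {\<omega>\<in>space M. \<bar>?S T \<omega>\<bar> > 2 * R} \<le> 2 * d" if T: "T \<subseteq> I" for T
    proof -
      have "(\<Union>i\<in>T. F i) \<in> sets N" "(\<Union>i\<in>I - T. F i) \<in> sets N"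
        using T by (auto intro!: meas_partition_UN_sets[OF I])
      then have "tail (\<mu> (\<Union>i\<in>T. F i)) R + tail (\<mu> (\<Union>i\<in>I - T. F i)) R \<le> 2 * d"
        using bd[of "\<Union>i\<in>T. F i"] bd[of "\<Union>i\<in>I - T. F i"] by linarith
      then have "tail (?S T) (2 * R) \<le> 2 * d" using tail_rsign_sum[OF I T, of R] by simp
      then show ?thesis by (simp add: tail_def)
    qed
    let ?Q = "{\<omega>\<in>space M. ?q \<omega> > (4 * R)\<^sup>2}" and ?H = "{\<omega>\<in>space M. \<bar>?m \<omega>\<bar> > 12 * R \<and> ?q \<omega> \<le> (4 * R)\<^sup>2}"
    have "prob ?Q \<le> 2 * d / (3/14)"
    proof (rule prob_le_of_subset_avg[where P = "\<lambda>T \<omega>. \<bar>?S T \<omega>\<bar> > 2 * R" and p = "\<lambda>_. 1/2"])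
      show "AE \<omega> in M. \<omega> \<in> ?Q \<longrightarrow> 3/14 \<le> subset_avg I (\<lambda>_. 1/2) (\<lambda>T. of_bool (\<bar>?S T \<omega>\<bar> > 2 * R))"
        using R rsign_sum_not_small[OF finI, of "4 * R"] by (auto intro!: AE_I2)
    qed (use finI S in auto)
    moreover have "prob ?H \<le> 2 * d / (3/4)"
    proof (rule prob_le_of_subset_avg[where P = "\<lambda>T \<omega>. \<bar>?S T \<omega>\<bar> > 2 * R" and p = "\<lambda>i. (1 + c i) / 2"])
      let ?A = "subset_avg I (\<lambda>i. (1 + c i) / 2)"
      have p: "0 \<le> (1 + c i) / 2 \<and> (1 + c i) / 2 \<le> 1" if "i \<in> I" for i using c that by (auto dest!: bspec)
      have eq: "4 * ((1 + c i) / 2) * (1 - (1 + c i) / 2) = 1 - (c i)\<^sup>2" "2 * ((1 + c i) / 2) - 1 = c i" for i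
        by (simp_all add: field_simps power2_eq_square)
      show "AE \<omega> in M. \<omega> \<in> ?H \<longrightarrow> 3/4 \<le> ?A (\<lambda>T. of_bool (\<bar>?S T \<omega>\<bar> > 2 * R))"
      proof (intro AE_I2 impI)
        fix \<omega> assume H: "\<omega> \<in> ?H"
        have "?A (\<lambda>T. (?S T \<omega> - ?m \<omega>)\<^sup>2) = (\<Sum>i\<in>I. (1 - (c i)\<^sup>2) * (\<mu> (F i) \<omega>)\<^sup>2)"
          unfolding rsign_sum_square[OF finI] eq by simp
        also have "\<dots> \<le> (\<Sum>i\<in>I. 1 * (\<mu> (F i) \<omega>)\<^sup>2)" by (intro sum_mono mult_right_mono) auto
        also have "\<dots> \<le> (4 * R)\<^sup>2" using H by simp
        finally have V: "?A (\<lambda>T. (?S T \<omega> - ?m \<omega>)\<^sup>2) \<le> (4 * R)\<^sup>2" .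
        have "1 = ?A (\<lambda>T. 1)" by (simp add: subset_avg_const finI)
        also have "\<dots> \<le> ?A (\<lambda>T. of_bool (\<bar>?S T \<omega>\<bar> > 2 * R) + of_bool ((?S T \<omega> - ?m \<omega>)\<^sup>2 \<ge> (8 * R)\<^sup>2))"
        proof (rule subset_avg_mono[OF p])
          fix T
          have "(?S T \<omega> - ?m \<omega>)\<^sup>2 \<ge> (8 * R)\<^sup>2" if "\<not> \<bar>?S T \<omega>\<bar> > 2 * R"
          proof -
            have "\<bar>?m \<omega>\<bar> > 12 * R" using H by simp
            then have "\<bar>8 * R\<bar> \<le> \<bar>?S T \<omega> - ?m \<omega>\<bar>" using that R by linarith
            then show ?thesis by (rule abs_le_square_iff[THEN iffD1])
          qed
          then show "1 \<le> of_bool (\<bar>?S T \<omega>\<bar> > 2 * R) + (of_bool ((?S T \<omega> - ?m \<omega>)\<^sup>2 \<ge> (8 * R)\<^sup>2) :: real)"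
            by auto
        qed
        also have "\<dots> \<le> ?A (\<lambda>T. of_bool (\<bar>?S T \<omega>\<bar> > 2 * R)) + ?A (\<lambda>T. (?S T \<omega> - ?m \<omega>)\<^sup>2) / (8 * R)\<^sup>2"
          unfolding subset_avg_add using R p finI by (intro add_left_mono subset_avg_markov) auto
        also have "?A (\<lambda>T. (?S T \<omega> - ?m \<omega>)\<^sup>2) / (8 * R)\<^sup>2 \<le> (4 * R)\<^sup>2 / (8 * R)\<^sup>2"
          using V by (intro divide_right_mono) auto
        also have "(4 * R)\<^sup>2 / (8 * R)\<^sup>2 = 1/4" using R by (simp add: power_mult_distrib)
        finally show "3/4 \<le> ?A (\<lambda>T. of_bool (\<bar>?S T \<omega>\<bar> > 2 * R))" by simp
      qed
      show "0 \<le> (1 + c i) / 2 \<and> (1 + c i) / 2 \<le> 1" if "i \<in> I" for i using p[OF that] .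
    qed (use finI S in auto)
    moreover have "tail ?m (12 * R) \<le> prob (?Q \<union> ?H)"
      unfolding tail_def by (intro finite_measure_mono) auto
    moreover have "prob (?Q \<union> ?H) \<le> prob ?Q + prob ?H" by (intro measure_Un_le) auto
    ultimately show ?thesis by (simp add: d_def)
  qed
  then show ?thesis using R by (intro exI[of _ "12 * R"]) auto
qed

end

section \<open>Integrals of simple functions\<close>

context prob_space begin

lemma tail_sum:
  assumes "finite S" "\<And>i. i \<in> S \<Longrightarrow> X i \<in> borel_measurable M"
  shows "tail (\<lambda>\<omega>. \<Sum>i\<in>S. X i \<omega>) (\<Sum>i\<in>S. r i) \<le> (\<Sum>i\<in>S. tail (X i) (r i))"
  using assms
proof (induction S rule: finite_induct)
  case (insert a S)
  have "tail (\<lambda>\<omega>. X a \<omega> + (\<Sum>i\<in>S. X i \<omega>)) (r a + (\<Sum>i\<in>S. r i)) \<le> tail (X a) (r a) + tail (\<lambda>\<omega>. \<Sum>i\<in>S. X i \<omega>) (\<Sum>i\<in>S. r i)"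
    using insert.prems by (intro tail_add borel_measurable_sum) auto
  then show ?case using insert by simp
qed (simp add: tail_def)

end

context l0_measure begin

abbreviation SI :: "'x set \<Rightarrow> ('x \<Rightarrow> real) \<Rightarrow> 'w \<Rightarrow> real" where
  "SI \<equiv> sm_simple_integral N \<mu>"

lemma SI_measurable [measurable]:
  assumes "simple_function N s" "A \<in> sets N"
  shows "SI A s \<in> borel_measurable M"
proof -
  have "\<mu> (A \<inter> (s -` {c} \<inter> space N)) \<in> borel_measurable M" for c
    using assms simple_functionD(2)[OF assms(1), of "{c}"] by simp
  then show ?thesis unfolding sm_simple_integral_def[abs_def] by measurable
qed

text \<open>The index of a cell records the values of the given functions on it.\<close>
lemma simple_common_partition:
  assumes "finite K" and s: "\<And>k. k \<in> K \<Longrightarrow> simple_function N (s k)"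
  shows "\<exists>(I::('k \<Rightarrow> real) set) F. meas_partition (space N) I F \<and> (\<forall>i\<in>I. F i \<noteq> {}) \<and>
    (\<forall>k\<in>K. \<forall>i\<in>I. \<forall>x\<in>F i. s k x = i k)"
proof -
  define \<Phi> where "\<Phi> = (\<lambda>x. restrict (\<lambda>k. s k x) K)"
  define I where "I = \<Phi> ` space N"
  define F where "F = (\<lambda>v. {x\<in>space N. \<Phi> x = v})"
  have "I \<subseteq> (\<Pi>\<^sub>E k\<in>K. s k ` space N)" by (auto simp: I_def \<Phi>_def)
  then have finI: "finite I"
    using assms by (elim finite_subset) (auto intro!: finite_PiE simp: simple_functionD(1))
  have "F v \<in> sets N" if "v \<in> I" for v
  proof -
    have [measurable]: "s k \<in> borel_measurable N" if "k \<in> K" for k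
      using s[OF that] by (rule borel_measurable_simple_function)
    have "F v = {x\<in>space N. \<forall>k\<in>K. s k x = v k}"
      using that unfolding F_def I_def \<Phi>_def by (auto simp: fun_eq_iff restrict_def)
    also have "\<dots> \<in> sets N" using \<open>finite K\<close> by measurable
    finally show ?thesis .
  qed
  then have "meas_partition (space N) I F"
    using finI unfolding meas_partition_def disjoint_family_on_def by (auto simp: F_def I_def)
  moreover have "\<forall>i\<in>I. F i \<noteq> {}" by (auto simp: I_def F_def)
  moreover have "\<forall>k\<in>K. \<forall>i\<in>I. \<forall>x\<in>F i. s k x = i k" by (auto simp: F_def \<Phi>_def)
  ultimately show ?thesis by blast
qed

lemma simple_common_partition_pair:
  assumes s: "simple_function N s" and t: "simple_function N t"
  shows "\<exists>(I::(bool \<Rightarrow> real) set) F. meas_partition (space N) I F \<and> (\<forall>i\<in>I. F i \<noteq> {}) \<and>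
    (\<forall>i\<in>I. \<forall>x\<in>F i. s x = i True \<and> t x = i False)"
proof -
  have "\<exists>(I::(bool \<Rightarrow> real) set) F. meas_partition (space N) I F \<and> (\<forall>i\<in>I. F i \<noteq> {}) \<and>
    (\<forall>k\<in>UNIV. \<forall>i\<in>I. \<forall>x\<in>F i. (if k then s else t) x = i k)"
    using s t by (intro simple_common_partition) auto
  then obtain I :: "(bool \<Rightarrow> real) set" and F where *: "meas_partition (space N) I F" "\<forall>i\<in>I. F i \<noteq> {}"
    and val: "\<forall>k\<in>UNIV. \<forall>i\<in>I. \<forall>x\<in>F i. (if k then s else t) x = i k" by blast
  have "s x = i True \<and> t x = i False" if "i \<in> I" "x \<in> F i" for i x
    using val[rule_format, of True i x] val[rule_format, of False i x] that by simp
  with * show ?thesis by blast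
qed

lemma SI_partition:
  assumes P: "meas_partition (space N) I F" and ne: "\<And>i. i \<in> I \<Longrightarrow> F i \<noteq> {}"
    and s: "\<And>i x. i \<in> I \<Longrightarrow> x \<in> F i \<Longrightarrow> s x = c i" and A: "A \<in> sets N"
  shows "AE \<omega> in M. SI A s \<omega> = (\<Sum>i\<in>I. c i * \<mu> (A \<inter> F i) \<omega>)"
proof -
  have finI: "finite I" using P by (rule meas_partition_finite)
  have img: "s ` space N = c ` I"
    unfolding meas_partition_union[OF P, symmetric] using ne s by (force simp: image_iff)
  have "AE \<omega> in M. \<forall>y\<in>c ` I. \<mu> (A \<inter> (s -` {y} \<inter> space N)) \<omega> = (\<Sum>i | i \<in> I \<and> c i = y. \<mu> (A \<inter> F i) \<omega>)"
  proof (subst AE_finite_all, use finI in simp, intro ballI)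
    fix y assume "y \<in> c ` I"
    have eq: "A \<inter> (s -` {y} \<inter> space N) = (\<Union>i\<in>{i\<in>I. c i = y}. A \<inter> F i)"
      unfolding meas_partition_union[OF P, symmetric] using s by auto
    show "AE \<omega> in M. \<mu> (A \<inter> (s -` {y} \<inter> space N)) \<omega> = (\<Sum>i | i \<in> I \<and> c i = y. \<mu> (A \<inter> F i) \<omega>)"
      unfolding eq
    proof (rule mu_finite_UN)
      show "disjoint_family_on (\<lambda>i. A \<inter> F i) {i\<in>I. c i = y}"
        using P unfolding meas_partition_def disjoint_family_on_def by blast
    qed (use finI A meas_partition_sets[OF P] in auto)
  qed
  then show ?thesis
  proof eventually_elim
    case (elim \<omega>)
    have "SI A s \<omega> = (\<Sum>y\<in>c ` I. \<Sum>i | i \<in> I \<and> c i = y. c i * \<mu> (A \<inter> F i) \<omega>)"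
      unfolding sm_simple_integral_def img using elim by (intro sum.cong) (auto simp: sum_distrib_left)
    also have "\<dots> = (\<Sum>i\<in>I. c i * \<mu> (A \<inter> F i) \<omega>)"
      using sum.image_gen[OF finI, of "\<lambda>i. c i * \<mu> (A \<inter> F i) \<omega>" c] by simp
    finally show ?case .
  qed
qed

lemma SI_diff:
  assumes s: "simple_function N s" and t: "simple_function N t" and A: "A \<in> sets N"
  shows "AE \<omega> in M. SI A (\<lambda>x. s x - t x) \<omega> = SI A s \<omega> - SI A t \<omega>"
proof -
  obtain I :: "(bool \<Rightarrow> real) set" and F where P: "meas_partition (space N) I F" and ne: "\<And>i. i \<in> I \<Longrightarrow> F i \<noteq> {}"
    and val: "\<And>i x. i \<in> I \<Longrightarrow> x \<in> F i \<Longrightarrow> s x = i True \<and> t x = i False"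
    using simple_common_partition_pair[OF s t] by blast
  have "AE \<omega> in M. SI A s \<omega> = (\<Sum>i\<in>I. i True * \<mu> (A \<inter> F i) \<omega>)"
    using val by (intro SI_partition[OF P ne _ A]) auto
  moreover have "AE \<omega> in M. SI A t \<omega> = (\<Sum>i\<in>I. i False * \<mu> (A \<inter> F i) \<omega>)"
    using val by (intro SI_partition[OF P ne _ A]) auto
  moreover have "AE \<omega> in M. SI A (\<lambda>x. s x - t x) \<omega> = (\<Sum>i\<in>I. (i True - i False) * \<mu> (A \<inter> F i) \<omega>)"
    using val by (intro SI_partition[OF P ne _ A]) auto
  ultimately show ?thesis
    by eventually_elim (simp add: sum_subtractf left_diff_distrib)
qed

lemma SI_Un:
  assumes s: "simple_function N s" and A: "A \<in> sets N" and B: "B \<in> sets N" and disj: "A \<inter> B = {}"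
  shows "AE \<omega> in M. SI (A \<union> B) s \<omega> = SI A s \<omega> + SI B s \<omega>"
proof -
  have "AE \<omega> in M. \<forall>y\<in>s ` space N. \<mu> ((A \<union> B) \<inter> (s -` {y} \<inter> space N)) \<omega> =
      \<mu> (A \<inter> (s -` {y} \<inter> space N)) \<omega> + \<mu> (B \<inter> (s -` {y} \<inter> space N)) \<omega>"
  proof (subst AE_finite_all, use simple_functionD(1)[OF s] in simp, intro ballI)
    fix y
    show "AE \<omega> in M. \<mu> ((A \<union> B) \<inter> (s -` {y} \<inter> space N)) \<omega> =
      \<mu> (A \<inter> (s -` {y} \<inter> space N)) \<omega> + \<mu> (B \<inter> (s -` {y} \<inter> space N)) \<omega>"
      unfolding Int_Un_distrib2
      using A B disj simple_functionD(2)[OF s, of "{y}"] by (intro mu_Un) auto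
  qed
  then show ?thesis
  proof eventually_elim
    case (elim \<omega>)
    then show ?case
      unfolding sm_simple_integral_def sum.distrib[symmetric] distrib_left[symmetric]
      by (intro sum.cong refl) auto
  qed
qed

text \<open>
  On a common partition for \<open>s\<close> and the indicator of \<open>A\<close>, the cells outside \<open>A\<close> contribute nothing and may be
  given the coefficient \<open>0\<close>.
\<close>
lemma SI_bounded:
  assumes "\<delta> > 0"
  shows "\<exists>R>0. \<forall>s A \<eta>. simple_function N s \<longrightarrow> A \<in> sets N \<longrightarrow> (\<forall>x\<in>A. \<bar>s x\<bar> \<le> \<eta>) \<longrightarrow> \<eta> > 0 \<longrightarrow>
    tail (SI A s) (\<eta> * R) \<le> \<delta>"
proof -
  obtain R where R: "R > 0" and bd: "\<And>(I::(bool \<Rightarrow> real) set) F c. meas_partition (space N) I F \<Longrightarrow> (\<forall>i\<in>I. \<bar>c i\<bar> \<le> 1) \<Longrightarrow>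
    tail (\<lambda>\<omega>. \<Sum>i\<in>I. c i * \<mu> (F i) \<omega>) R \<le> \<delta>" using coefficients_bounded[OF assms] by blast
  have "tail (SI A s) (\<eta> * R) \<le> \<delta>"
    if s: "simple_function N s" and A: "A \<in> sets N" and le: "\<forall>x\<in>A. \<bar>s x\<bar> \<le> \<eta>" and "\<eta> > 0" for s A \<eta>
  proof -
    obtain I :: "(bool \<Rightarrow> real) set" and F where P: "meas_partition (space N) I F" and ne: "\<And>i. i \<in> I \<Longrightarrow> F i \<noteq> {}"
      and val: "\<And>i x. i \<in> I \<Longrightarrow> x \<in> F i \<Longrightarrow> s x = i True \<and> indicator A x = i False"
      using simple_common_partition_pair[OF s simple_function_indicator[OF A]] by blast
    have [measurable]: "\<mu> (F i) \<in> borel_measurable M" if "i \<in> I" for i using meas_partition_sets[OF P that] by simp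
    define c where "c = (\<lambda>i. if i False = 1 then i True / \<eta> else 0)"
    have inside: "F i \<subseteq> A" if "i \<in> I" "i False = 1" for i
      using val[OF that(1)] that(2) by (auto simp: indicator_def split: if_splits)
    have outside: "A \<inter> F i = {}" if "i \<in> I" "i False \<noteq> 1" for i
    proof (rule ccontr)
      assume "A \<inter> F i \<noteq> {}"
      then obtain x where "x \<in> A" "x \<in> F i" by auto
      then show False using val[OF that(1), of x] that(2) by simp
    qed
    have "\<bar>c i\<bar> \<le> 1" if i: "i \<in> I" for i
    proof (cases "i False = 1")
      case True
      obtain x where x: "x \<in> F i" using ne[OF i] by auto
      then have "\<bar>s x\<bar> \<le> \<eta>" using le inside[OF i True] by blast
      then have "\<bar>i True\<bar> \<le> \<eta>" using val[OF i x] by simp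
      then show ?thesis using \<open>\<eta> > 0\<close> by (simp add: c_def)
    qed (simp add: c_def)
    then have bd': "tail (\<lambda>\<omega>. \<Sum>i\<in>I. c i * \<mu> (F i) \<omega>) R \<le> \<delta>" by (intro bd P) auto
    have "AE \<omega> in M. SI A s \<omega> = (\<Sum>i\<in>I. i True * \<mu> (A \<inter> F i) \<omega>)"
      using val by (intro SI_partition[OF P ne _ A]) auto
    then have "AE \<omega> in M. SI A s \<omega> = \<eta> * (\<Sum>i\<in>I. c i * \<mu> (F i) \<omega>)"
      using mu_empty
    proof eventually_elim
      case (elim \<omega>)
      have "i True * \<mu> (A \<inter> F i) \<omega> = \<eta> * (c i * \<mu> (F i) \<omega>)" if i: "i \<in> I" for i
      proof (cases "i False = 1")
        case True
        then show ?thesis using inside[OF i True] \<open>\<eta> > 0\<close> by (simp add: c_def Int_absorb1)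
      next
        case False
        then show ?thesis using outside[OF i False] elim by (simp add: c_def)
      qed
      then show ?case using elim by (simp add: sum_distrib_left)
    qed
    then have "tail (SI A s) (\<eta> * R) \<le> tail (\<lambda>\<omega>. \<Sum>i\<in>I. c i * \<mu> (F i) \<omega>) R"
      using s A \<open>\<eta> > 0\<close> by (intro tail_mono_AE) (auto simp: abs_mult)
    then show ?thesis using bd' by simp
  qed
  then show ?thesis using R by blast
qed

lemma SI_decseq_empty_uniform:
  assumes s: "simple_function N s" and E: "\<And>i::nat. E i \<in> sets N" "decseq E" "(\<Inter>i. E i) = {}" and "\<eta> > 0"
  shows "\<exists>k. \<forall>A\<in>sets N. A \<subseteq> E k \<longrightarrow> tail (SI A s) \<eta> < \<eta>"
proof -
  let ?V = "s ` space N"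
  have fin: "finite ?V" using s by (rule simple_functionD(1))
  define n where "n = real (card ?V) + 1"
  define b where "b = (\<Sum>v\<in>?V. \<bar>v\<bar>) + 1"
  have n: "n > 0" by (simp add: n_def)
  have b: "b > 0" by (simp add: b_def sum_nonneg add_nonneg_pos)
  have le_b: "\<bar>v\<bar> \<le> b" if "v \<in> ?V" for v
    using member_le_sum[OF that, of abs] fin by (simp add: b_def)
  \<comment> \<open>\<open>n\<close> exceeds the number of values of \<open>s\<close>, and \<open>b\<close> is a positive bound for them\<close>
  define \<eta>' where "\<eta>' = min (\<eta> / n) (\<eta> / n / b)"
  have "\<eta>' > 0" using n b \<open>\<eta> > 0\<close> by (simp add: \<eta>'_def)
  then obtain k where k: "\<And>A. A \<in> sets N \<Longrightarrow> A \<subseteq> E k \<Longrightarrow> tail (\<mu> A) \<eta>' < \<eta>'"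
    using mu_decseq_empty_uniform[OF E] by blast
  have "tail (SI A s) \<eta> < \<eta>" if A: "A \<in> sets N" "A \<subseteq> E k" for A
  proof -
    let ?S = "\<lambda>v. A \<inter> (s -` {v} \<inter> space N)"
    have S [measurable]: "?S v \<in> sets N" for v using A simple_functionD(2)[OF s, of "{v}"] by auto
    have each: "tail (\<lambda>\<omega>. v * \<mu> (?S v) \<omega>) (\<eta> / n) \<le> \<eta> / n" if v: "v \<in> ?V" for v
    proof -
      have "tail (\<lambda>\<omega>. v * \<mu> (?S v) \<omega>) (\<eta> / n) \<le> tail (\<mu> (?S v)) \<eta>'"
      proof (intro tail_mono_AE AE_I2 impI)
        fix \<omega> assume "\<bar>v * \<mu> (?S v) \<omega>\<bar> > \<eta> / n"
        also have "\<bar>v * \<mu> (?S v) \<omega>\<bar> \<le> b * \<bar>\<mu> (?S v) \<omega>\<bar>"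
          unfolding abs_mult using le_b[OF v] by (intro mult_right_mono) auto
        finally have "\<eta> / n / b < \<bar>\<mu> (?S v) \<omega>\<bar>" using b by (subst pos_divide_less_eq) (auto simp: mult.commute)
        then show "\<bar>\<mu> (?S v) \<omega>\<bar> > \<eta>'" by (simp add: \<eta>'_def)
      qed auto
      also have "\<dots> \<le> \<eta>'" using k[of "?S v"] A S by fastforce
      also have "\<eta>' \<le> \<eta> / n" by (simp add: \<eta>'_def)
      finally show ?thesis .
    qed
    have less: "(\<Sum>v\<in>?V. \<eta> / n) < \<eta>"
    proof -
      have "(\<Sum>v\<in>?V. \<eta> / n) = (n - 1) * (\<eta> / n)" by (simp add: n_def)
      also have "\<dots> < n * (\<eta> / n)" using n \<open>\<eta> > 0\<close> by (intro mult_strict_right_mono) auto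
      finally show ?thesis using n by simp
    qed
    have "tail (SI A s) \<eta> \<le> tail (SI A s) (\<Sum>v\<in>?V. \<eta> / n)"
      using less s A by (intro tail_antimono) auto
    also have "\<dots> \<le> (\<Sum>v\<in>?V. tail (\<lambda>\<omega>. v * \<mu> (?S v) \<omega>) (\<eta> / n))"
      unfolding sm_simple_integral_def[abs_def] by (intro tail_sum fin) measurable
    also have "\<dots> \<le> (\<Sum>v\<in>?V. \<eta> / n)" by (intro sum_mono each)
    also have "\<dots> < \<eta>" by (rule less)
    finally show ?thesis .
  qed
  then show ?thesis by blast
qed

end

section \<open>Independence of the approximating sequence\<close>

context l0_measure begin

lemma SI_empty: "simple_function N s \<Longrightarrow> AE \<omega> in M. SI {} s \<omega> = 0"
  using SI_Un[of s "{}" "{}"] by auto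

text \<open>
  The reason why the integral does not depend on the approximating sequence. Let \<open>E k\<close> be the decreasing
  sets where some \<open>\<bar>d l\<bar>\<close> with \<open>l \<ge> k\<close> exceeds a small constant. The integral of \<open>d n\<close> is small over subsets of
  the complement of \<open>E n\<close>, since \<open>d n\<close> is small there, and, for fixed \<open>n\<close>, over subsets of \<open>E k\<close> with \<open>k\<close> large.
  Were the integrals over the whole space not small, then along a sparse sequence \<open>r\<close> the integral of
  \<open>d (r j)\<close> would be concentrated on \<open>D j = E (r j) - E (r (j + 1))\<close>. For the union \<open>A\<close> of the \<open>D j\<close> with \<open>j\<close> even, the
  integrals of \<open>d (r j)\<close> over \<open>A\<close> would then be alternately large and small, and could not be Cauchy.
\<close>
lemma null_sequence_limit:
  assumes d: "\<And>n::nat. simple_function N (d n)"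
    and null: "\<And>x. x \<in> space N \<Longrightarrow> (\<lambda>n. d n x) \<longlonglongrightarrow> 0"
    and Cauchy: "\<And>A \<epsilon>. A \<in> sets N \<Longrightarrow> \<epsilon> > 0 \<Longrightarrow>
      \<exists>n0. \<forall>m\<ge>n0. \<forall>n\<ge>n0. tail (\<lambda>\<omega>. SI A (d m) \<omega> - SI A (d n) \<omega>) \<epsilon> < \<epsilon>"
    and "\<eta>' > 0"
  shows "(\<lambda>n. tail (SI (space N) (d n)) \<eta>') \<longlonglongrightarrow> 0"
proof (rule ccontr)
  assume "\<not> ?thesis"
  then obtain \<epsilon> where \<epsilon>: "\<epsilon> > 0" and freq: "\<And>n0. \<exists>n\<ge>n0. tail (SI (space N) (d n)) \<eta>' \<ge> \<epsilon>"
    unfolding LIMSEQ_def by (auto simp: tail_nonneg not_less)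
  define \<eta> where "\<eta> = min \<epsilon> \<eta>'"
  have \<eta>: "\<eta> > 0" using \<epsilon> \<open>\<eta>' > 0\<close> by (simp add: \<eta>_def)
  note [measurable] = SI_measurable[OF d]
  let ?good = "\<lambda>n. tail (SI (space N) (d n)) \<eta> \<ge> \<eta>"
  have good: "\<exists>n\<ge>n0. ?good n" for n0
  proof -
    obtain n where "n \<ge> n0" "tail (SI (space N) (d n)) \<eta>' \<ge> \<epsilon>" using freq by blast
    moreover have "tail (SI (space N) (d n)) \<eta> \<ge> tail (SI (space N) (d n)) \<eta>'"
      by (intro tail_antimono) (auto simp: \<eta>_def)
    moreover have "\<eta> \<le> \<epsilon>" by (simp add: \<eta>_def)
    ultimately show ?thesis by (intro exI[of _ n]) linarith
  qed
  obtain R where R: "R > 0" and bd: "\<And>s A \<eta>'. simple_function N s \<Longrightarrow> A \<in> sets N \<Longrightarrow> (\<forall>x\<in>A. \<bar>s x\<bar> \<le> \<eta>') \<Longrightarrow> \<eta>' > 0 \<Longrightarrow>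
    tail (SI A s) (\<eta>' * R) \<le> \<eta> / 8"
    using SI_bounded[of "\<eta> / 8"] \<eta> by auto
  define \<kappa> where "\<kappa> = \<eta> / 8 / R"
  have \<kappa>: "\<kappa> > 0" "\<kappa> * R = \<eta> / 8" using R \<eta> by (auto simp: \<kappa>_def)
  define E where "E = (\<lambda>k. {x\<in>space N. \<exists>l\<ge>k. \<bar>d l x\<bar> > \<kappa>})"
  have [measurable]: "d l \<in> borel_measurable N" for l using d by (rule borel_measurable_simple_function)
  have E [measurable]: "E k \<in> sets N" for k unfolding E_def by measurable
  have dec: "decseq E" by (intro decseq_SucI) (auto simp: E_def intro: Suc_leD)
  have E_sub: "E k \<subseteq> space N" for k by (auto simp: E_def)
  have E_Int: "(\<Inter>k. E k) = {}"
  proof (rule ccontr)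
    assume "(\<Inter>k. E k) \<noteq> {}"
    then obtain x where x: "\<And>k. x \<in> E k" by auto
    then have "x \<in> space N" by (auto simp: E_def)
    then obtain k where "\<And>l. l \<ge> k \<Longrightarrow> \<bar>d l x\<bar> < \<kappa>"
      using null[of x] \<kappa> unfolding LIMSEQ_def by auto
    then show False using x[of k] by (fastforce simp: E_def)
  qed
  have small: "tail (SI A (d n)) (\<eta> / 8) \<le> \<eta> / 8" if "A \<in> sets N" "A \<subseteq> space N - E n" for A n
  proof -
    have "\<forall>x\<in>A. \<bar>d n x\<bar> \<le> \<kappa>" using that(2) by (force simp: E_def not_less)
    then have "tail (SI A (d n)) (\<kappa> * R) \<le> \<eta> / 8" using \<kappa>(1) by (rule bd[OF d that(1)])
    then show ?thesis using \<kappa>(2) by simp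
  qed
  have "\<exists>n'. n < n' \<and> ?good n' \<and> (\<forall>A\<in>sets N. A \<subseteq> E n' \<longrightarrow> tail (SI A (d n)) (\<eta> / 8) < \<eta> / 8)" for n
  proof -
    obtain k where k: "\<And>A. A \<in> sets N \<Longrightarrow> A \<subseteq> E k \<Longrightarrow> tail (SI A (d n)) (\<eta> / 8) < \<eta> / 8"
      using SI_decseq_empty_uniform[OF d E dec E_Int, of "\<eta> / 8" n] \<eta> by auto
    obtain n' where n': "n' \<ge> max k (Suc n)" "?good n'" using good by blast
    then have "E n' \<subseteq> E k" using decseqD[OF dec, of k n'] by simp
    then show ?thesis using k n' by (intro exI[of _ n']) auto
  qed
  then obtain nxt where nxt: "\<And>n. n < nxt n" "\<And>n. ?good (nxt n)"
    and tails: "\<And>n A. A \<in> sets N \<Longrightarrow> A \<subseteq> E (nxt n) \<Longrightarrow> tail (SI A (d n)) (\<eta> / 8) < \<eta> / 8"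
    by metis
  define r where "r = rec_nat (nxt 0) (\<lambda>_. nxt)"
  have r: "r (Suc j) = nxt (r j)" for j by (simp add: r_def)
  have r_good: "?good (r j)" for j using nxt by (cases j) (auto simp: r_def)
  have r_mono: "strict_mono r" unfolding strict_mono_Suc_iff r using nxt by auto
  have decr: "decseq (\<lambda>j. E (r j))" using dec r_mono by (auto simp: decseq_def strict_mono_less_eq)
  define D where "D = (\<lambda>j. E (r j) - E (r (Suc j)))"
  have D [measurable]: "D j \<in> sets N" for j unfolding D_def by measurable
  have D_disj: "D i \<inter> D j = {}" if "i \<noteq> j" for i j
    using disjoint_family_decseq_Diff[OF decr] that unfolding D_def disjoint_family_on_def by auto
  define A where "A = (\<Union>j. D (2 * j))"
  have A [measurable]: "A \<in> sets N" unfolding A_def by measurable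
  have A_sub: "A \<subseteq> space N" using sets.sets_into_space[OF A] .
  have three: "AE \<omega> in M. SI B (d (r j)) \<omega> =
      SI (B - E (r j)) (d (r j)) \<omega> + SI (B \<inter> D j) (d (r j)) \<omega> + SI (B \<inter> E (r (Suc j))) (d (r j)) \<omega>"
    if B [measurable]: "B \<in> sets N" for B j
  proof -
    have sub: "E (r (Suc j)) \<subseteq> E (r j)" using decseqD[OF decr, of j "Suc j"] by simp
    have eq: "B = (B - E (r j) \<union> B \<inter> D j) \<union> B \<inter> E (r (Suc j))" using sub by (auto simp: D_def)
    have "AE \<omega> in M. SI ((B - E (r j) \<union> B \<inter> D j) \<union> B \<inter> E (r (Suc j))) (d (r j)) \<omega> =
       SI (B - E (r j) \<union> B \<inter> D j) (d (r j)) \<omega> + SI (B \<inter> E (r (Suc j))) (d (r j)) \<omega>"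
      using sub by (intro SI_Un d) (auto simp: D_def)
    moreover have "AE \<omega> in M. SI (B - E (r j) \<union> B \<inter> D j) (d (r j)) \<omega> =
       SI (B - E (r j)) (d (r j)) \<omega> + SI (B \<inter> D j) (d (r j)) \<omega>"
      by (intro SI_Un d) (auto simp: D_def)
    ultimately show ?thesis unfolding eq[symmetric] by eventually_elim simp
  qed
  have two: "tail (\<lambda>\<omega>. SI (B - E (r j)) (d (r j)) \<omega> + SI (B \<inter> E (r (Suc j))) (d (r j)) \<omega>) (\<eta> / 4) \<le> \<eta> / 4"
    if B [measurable]: "B \<in> sets N" for B j
  proof -
    have "tail (SI (B - E (r j)) (d (r j))) (\<eta> / 8) \<le> \<eta> / 8"
      using sets.sets_into_space[OF B] by (intro small) auto
    moreover have "tail (SI (B \<inter> E (r (Suc j))) (d (r j))) (\<eta> / 8) \<le> \<eta> / 8"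
      using tails[of "B \<inter> E (r (Suc j))" "r j"] unfolding r by fastforce
    moreover have "tail (\<lambda>\<omega>. SI (B - E (r j)) (d (r j)) \<omega> + SI (B \<inter> E (r (Suc j))) (d (r j)) \<omega>) (\<eta> / 8 + \<eta> / 8) \<le>
      tail (SI (B - E (r j)) (d (r j))) (\<eta> / 8) + tail (SI (B \<inter> E (r (Suc j))) (d (r j))) (\<eta> / 8)"
      by (intro tail_add) measurable
    ultimately show ?thesis by simp
  qed
  have odd: "tail (SI A (d (r j))) (\<eta> / 4) \<le> \<eta> / 4" if "odd j" for j
  proof -
    have "A \<inter> D j = {}" unfolding A_def using D_disj that by (auto simp: dvd_def)
    then have "AE \<omega> in M. SI A (d (r j)) \<omega> = SI (A - E (r j)) (d (r j)) \<omega> + SI (A \<inter> E (r (Suc j))) (d (r j)) \<omega>"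
      using three[OF A, of j] SI_empty[OF d, of "r j"] by auto
    then have "tail (SI A (d (r j))) (\<eta> / 4) =
      tail (\<lambda>\<omega>. SI (A - E (r j)) (d (r j)) \<omega> + SI (A \<inter> E (r (Suc j))) (d (r j)) \<omega>) (\<eta> / 4)"
      by (intro tail_cong_AE) measurable
    then show ?thesis using two[OF A, of j] by simp
  qed
  have even: "tail (SI A (d (r j))) (\<eta> / 2) \<ge> \<eta> / 2" if "even j" for j
  proof -
    let ?X = "\<lambda>B \<omega>. SI (B - E (r j)) (d (r j)) \<omega> + SI (B \<inter> E (r (Suc j))) (d (r j)) \<omega>"
    have "D j \<subseteq> A" using that unfolding A_def by (auto elim!: evenE)
    then have AD: "A \<inter> D j = D j" by auto
    have XD: "space N \<inter> D j = D j" using sets.sets_into_space[OF D] by auto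
    have "AE \<omega> in M. SI (space N) (d (r j)) \<omega> = SI A (d (r j)) \<omega> + (?X (space N) \<omega> - ?X A \<omega>)"
      using three[OF A, of j] three[OF sets.top, of j] unfolding AD XD by eventually_elim simp
    then have "tail (SI (space N) (d (r j))) \<eta> = tail (\<lambda>\<omega>. SI A (d (r j)) \<omega> + (?X (space N) \<omega> - ?X A \<omega>)) (\<eta> / 2 + \<eta> / 2)"
      by (subst tail_cong_AE[where Y = "\<lambda>\<omega>. SI A (d (r j)) \<omega> + (?X (space N) \<omega> - ?X A \<omega>)"]) auto
    also have "\<dots> \<le> tail (SI A (d (r j))) (\<eta> / 2) + tail (\<lambda>\<omega>. ?X (space N) \<omega> - ?X A \<omega>) (\<eta> / 2)"
      by (intro tail_add) measurable
    also have "tail (\<lambda>\<omega>. ?X (space N) \<omega> - ?X A \<omega>) (\<eta> / 4 + \<eta> / 4) \<le> tail (?X (space N)) (\<eta> / 4) + tail (?X A) (\<eta> / 4)"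
      by (intro tail_diff) measurable
    then have "tail (\<lambda>\<omega>. ?X (space N) \<omega> - ?X A \<omega>) (\<eta> / 2) \<le> \<eta> / 2"
      using two[OF A, of j] two[OF sets.top, of j] by simp
    finally show ?thesis using r_good[of j] by simp
  qed
  obtain n0 where n0: "\<And>m n. m \<ge> n0 \<Longrightarrow> n \<ge> n0 \<Longrightarrow> tail (\<lambda>\<omega>. SI A (d m) \<omega> - SI A (d n) \<omega>) (\<eta> / 4) < \<eta> / 4"
    using Cauchy[OF A, of "\<eta> / 4"] \<eta> by auto
  have rn0: "r j \<ge> n0" if "j \<ge> n0" for j
    using strict_mono_imp_increasing[OF r_mono, of j] that by simp
  have "\<eta> / 2 \<le> tail (SI A (d (r (2 * n0)))) (\<eta> / 2)" by (intro even) simp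
  also have "\<dots> \<le> tail (\<lambda>\<omega>. SI A (d (r (2 * n0))) \<omega> - SI A (d (r (Suc (2 * n0)))) \<omega>) (\<eta> / 4) +
      tail (SI A (d (r (Suc (2 * n0))))) (\<eta> / 4)"
    using tail_add[of "\<lambda>\<omega>. SI A (d (r (2 * n0))) \<omega> - SI A (d (r (Suc (2 * n0)))) \<omega>" "SI A (d (r (Suc (2 * n0))))" "\<eta> / 4" "\<eta> / 4"]
    by simp
  also have "\<dots> < \<eta> / 4 + \<eta> / 4"
    by (intro add_less_le_mono n0 rn0 odd) auto
  finally show False by simp
qed

lemma integral_limit_of_uniform_approximation:
  assumes Z: "has_sm_integral M N \<mu> (space N) g Z"
    and t: "\<And>n::nat. simple_function N (t n)"
    and unif: "\<And>e. e > 0 \<Longrightarrow> \<exists>n0. \<forall>n\<ge>n0. \<forall>x\<in>space N. \<bar>t n x - g x\<bar> \<le> e"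
    and "\<eta> > 0"
  shows "(\<lambda>n. tail (\<lambda>\<omega>. SI (space N) (t n) \<omega> - Z \<omega>) \<eta>) \<longlonglongrightarrow> 0"
proof -
  obtain s where s: "\<And>n. simple_function N (s n)" and s_lim: "\<And>x. x \<in> space N \<Longrightarrow> (\<lambda>n. s n x) \<longlonglongrightarrow> g x"
    and s_conv: "\<And>A. A \<in> sets N \<Longrightarrow> \<exists>Z\<in>borel_measurable M. converges_in_prob M (\<lambda>n. SI A (s n)) Z"
    and sZ: "converges_in_prob M (\<lambda>n. SI (space N) (s n)) Z" and Z_meas [measurable]: "Z \<in> borel_measurable M"
    using Z unfolding has_sm_integral_def sm_approximating_def by blast
  note [measurable] = SI_measurable[OF s] SI_measurable[OF t]
  define d where "d = (\<lambda>n x. s n x - t n x)"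
  have d: "simple_function N (d n)" for n unfolding d_def using s t by (intro simple_function_diff)
  note [measurable] = SI_measurable[OF d]
  have dst: "AE \<omega> in M. SI A (d n) \<omega> = SI A (s n) \<omega> - SI A (t n) \<omega>" if "A \<in> sets N" for A n
    unfolding d_def using s t that by (rule SI_diff)
  have t_Cauchy: "\<exists>n0. \<forall>m\<ge>n0. \<forall>n\<ge>n0. tail (\<lambda>\<omega>. SI A (t m) \<omega> - SI A (t n) \<omega>) \<epsilon> \<le> \<epsilon>"
    if A: "A \<in> sets N" and \<epsilon>: "\<epsilon> > 0" for A \<epsilon>
  proof -
    obtain R where R: "R > 0" and bd: "\<And>s A \<eta>'. simple_function N s \<Longrightarrow> A \<in> sets N \<Longrightarrow> (\<forall>x\<in>A. \<bar>s x\<bar> \<le> \<eta>') \<Longrightarrow> \<eta>' > 0 \<Longrightarrow>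
      tail (SI A s) (\<eta>' * R) \<le> \<epsilon>"
      using SI_bounded[OF \<epsilon>] by auto
    have e: "\<epsilon> / R / 2 > 0" using R \<epsilon> by simp
    then obtain n0 where n0: "\<And>n x. n \<ge> n0 \<Longrightarrow> x \<in> space N \<Longrightarrow> \<bar>t n x - g x\<bar> \<le> \<epsilon> / R / 2" using unif by blast
    have "tail (\<lambda>\<omega>. SI A (t m) \<omega> - SI A (t n) \<omega>) \<epsilon> \<le> \<epsilon>" if "m \<ge> n0" "n \<ge> n0" for m n
    proof -
      have tt: "simple_function N (\<lambda>x. t m x - t n x)" using t by (intro simple_function_diff)
      have "AE \<omega> in M. SI A (t m) \<omega> - SI A (t n) \<omega> = SI A (\<lambda>x. t m x - t n x) \<omega>"
        using SI_diff[OF t t A, of m n] by eventually_elim simp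
      then have "tail (\<lambda>\<omega>. SI A (t m) \<omega> - SI A (t n) \<omega>) \<epsilon> = tail (SI A (\<lambda>x. t m x - t n x)) \<epsilon>"
        using A SI_measurable[OF tt A] by (intro tail_cong_AE) auto
      also have "\<epsilon> = \<epsilon> / R * R" using R by simp
      also have "tail (SI A (\<lambda>x. t m x - t n x)) (\<epsilon> / R * R) \<le> \<epsilon>"
      proof (rule bd[OF tt A])
        show "\<forall>x\<in>A. \<bar>t m x - t n x\<bar> \<le> \<epsilon> / R"
        proof
          fix x assume "x \<in> A"
          then have x: "x \<in> space N" using sets.sets_into_space[OF A] by auto
          have "\<bar>t m x - t n x\<bar> \<le> \<bar>t m x - g x\<bar> + \<bar>t n x - g x\<bar>" by linarith
          also have "\<dots> \<le> \<epsilon> / R / 2 + \<epsilon> / R / 2"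
            by (intro add_mono n0 that x)
          finally show "\<bar>t m x - t n x\<bar> \<le> \<epsilon> / R" by simp
        qed
      qed (use R \<epsilon> in simp)
      finally show ?thesis using R by simp
    qed
    then show ?thesis by blast
  qed
  have d_lim: "(\<lambda>n. tail (SI (space N) (d n)) (\<eta>/2)) \<longlonglongrightarrow> 0"
  proof (rule null_sequence_limit[OF d])
    fix x assume x: "x \<in> space N"
    have "(\<lambda>n. t n x) \<longlonglongrightarrow> g x"
    proof (rule LIMSEQ_I)
      fix e :: real assume "e > 0"
      then obtain n0 where n0: "\<forall>n\<ge>n0. \<forall>x\<in>space N. \<bar>t n x - g x\<bar> \<le> e / 2" using unif[of "e / 2"] by auto
      have "norm (t n x - g x) < e" if "n \<ge> n0" for n
      proof -
        have "\<bar>t n x - g x\<bar> \<le> e / 2" using n0 that x by blast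
        then show ?thesis using \<open>e > 0\<close> by simp
      qed
      then show "\<exists>n0. \<forall>n\<ge>n0. norm (t n x - g x) < e" by blast
    qed
    then show "(\<lambda>n. d n x) \<longlonglongrightarrow> 0"
      unfolding d_def using tendsto_diff[OF s_lim[OF x]] by fastforce
  next
    fix A and \<epsilon> :: real assume A [measurable]: "A \<in> sets N" and \<epsilon>: "\<epsilon> > 0"
    obtain ZA where "ZA \<in> borel_measurable M" "converges_in_prob M (\<lambda>n. SI A (s n)) ZA" using s_conv[OF A] by blast
    then obtain n1 where n1: "\<And>m n. m \<ge> n1 \<Longrightarrow> n \<ge> n1 \<Longrightarrow> tail (\<lambda>\<omega>. SI A (s m) \<omega> - SI A (s n) \<omega>) (\<epsilon>/2) < \<epsilon>/2"
      using converges_in_prob_Cauchy[of "\<lambda>n. SI A (s n)" ZA "\<epsilon>/2"] A \<epsilon> by auto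
    obtain n2 where n2: "\<And>m n. m \<ge> n2 \<Longrightarrow> n \<ge> n2 \<Longrightarrow> tail (\<lambda>\<omega>. SI A (t m) \<omega> - SI A (t n) \<omega>) (\<epsilon>/2) \<le> \<epsilon>/2"
      using t_Cauchy[OF A, of "\<epsilon>/2"] \<epsilon> by auto
    have "tail (\<lambda>\<omega>. SI A (d m) \<omega> - SI A (d n) \<omega>) \<epsilon> < \<epsilon>" if "m \<ge> max n1 n2" "n \<ge> max n1 n2" for m n
    proof -
      let ?S = "\<lambda>\<omega>. SI A (s m) \<omega> - SI A (s n) \<omega>" and ?T = "\<lambda>\<omega>. SI A (t m) \<omega> - SI A (t n) \<omega>"
      have "AE \<omega> in M. SI A (d m) \<omega> - SI A (d n) \<omega> = ?S \<omega> - ?T \<omega>"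
        using dst[OF A, of m] dst[OF A, of n] by eventually_elim simp
      then have "tail (\<lambda>\<omega>. SI A (d m) \<omega> - SI A (d n) \<omega>) \<epsilon> = tail (\<lambda>\<omega>. ?S \<omega> - ?T \<omega>) (\<epsilon>/2 + \<epsilon>/2)"
        by (subst tail_cong_AE[where Y = "\<lambda>\<omega>. ?S \<omega> - ?T \<omega>"]) auto
      also have "\<dots> \<le> tail ?S (\<epsilon>/2) + tail ?T (\<epsilon>/2)" by (intro tail_diff) measurable
      also have "\<dots> < \<epsilon>/2 + \<epsilon>/2" using that by (intro add_less_le_mono n1 n2) auto
      finally show ?thesis by simp
    qed
    then show "\<exists>n0. \<forall>m\<ge>n0. \<forall>n\<ge>n0. tail (\<lambda>\<omega>. SI A (d m) \<omega> - SI A (d n) \<omega>) \<epsilon> < \<epsilon>" by blast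
  qed (use \<open>\<eta> > 0\<close> in simp)
  have s_lim': "(\<lambda>n. tail (\<lambda>\<omega>. SI (space N) (s n) \<omega> - Z \<omega>) (\<eta>/2)) \<longlonglongrightarrow> 0"
    using sZ \<open>\<eta> > 0\<close> by (auto simp: converges_in_prob_iff_tail)
  show ?thesis
  proof (rule Lim_null_comparison)
    show "\<forall>\<^sub>F n in sequentially. norm (tail (\<lambda>\<omega>. SI (space N) (t n) \<omega> - Z \<omega>) \<eta>) \<le>
      tail (\<lambda>\<omega>. SI (space N) (s n) \<omega> - Z \<omega>) (\<eta>/2) + tail (SI (space N) (d n)) (\<eta>/2)"
    proof (intro always_eventually allI)
      fix n
      have "AE \<omega> in M. SI (space N) (t n) \<omega> - Z \<omega> = (SI (space N) (s n) \<omega> - Z \<omega>) - SI (space N) (d n) \<omega>"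
        using dst[OF sets.top, of n] by eventually_elim simp
      then have "tail (\<lambda>\<omega>. SI (space N) (t n) \<omega> - Z \<omega>) \<eta> =
          tail (\<lambda>\<omega>. (SI (space N) (s n) \<omega> - Z \<omega>) - SI (space N) (d n) \<omega>) (\<eta>/2 + \<eta>/2)"
        by (subst tail_cong_AE[where Y = "\<lambda>\<omega>. (SI (space N) (s n) \<omega> - Z \<omega>) - SI (space N) (d n) \<omega>"]) auto
      also have "\<dots> \<le> tail (\<lambda>\<omega>. SI (space N) (s n) \<omega> - Z \<omega>) (\<eta>/2) + tail (SI (space N) (d n)) (\<eta>/2)"
        by (intro tail_diff) measurable
      finally show "norm (tail (\<lambda>\<omega>. SI (space N) (t n) \<omega> - Z \<omega>) \<eta>) \<le>
        tail (\<lambda>\<omega>. SI (space N) (s n) \<omega> - Z \<omega>) (\<eta>/2) + tail (SI (space N) (d n)) (\<eta>/2)"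
        unfolding real_norm_def abs_of_nonneg[OF tail_nonneg] .
    qed
    show "(\<lambda>n. tail (\<lambda>\<omega>. SI (space N) (s n) \<omega> - Z \<omega>) (\<eta>/2) + tail (SI (space N) (d n)) (\<eta>/2)) \<longlonglongrightarrow> 0"
      using tendsto_add[OF s_lim' d_lim] by simp
  qed
qed

text \<open>
  Boundedness of the coefficients on a common partition gives the hypothesis of
  \<open>square_function_bounded\<close>. The bound does not depend on the partition, hence not on the family.
\<close>
lemma simple_square_function_bounded:
  assumes "\<delta> > 0"
  shows "\<exists>R>0. \<forall>(n::nat) t K. (\<forall>k<n. simple_function N (t k)) \<longrightarrow> K > 0 \<longrightarrow>
    (\<forall>x\<in>space N. (\<Sum>k<n. (t k x)\<^sup>2) \<le> K\<^sup>2) \<longrightarrow>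
    prob {\<omega>\<in>space M. (\<Sum>k<n. (SI (space N) (t k) \<omega>)\<^sup>2) > (K * R)\<^sup>2} \<le> \<delta>"
proof -
  have "\<delta> / 4 > 0" using assms by simp
  then obtain R0 where R0: "R0 > 0" and bd: "\<And>(I::(nat \<Rightarrow> real) set) F c. meas_partition (space N) I F \<Longrightarrow> (\<forall>i\<in>I. \<bar>c i\<bar> \<le> 1) \<Longrightarrow>
    tail (\<lambda>\<omega>. \<Sum>i\<in>I. c i * \<mu> (F i) \<omega>) R0 \<le> \<delta> / 4" using coefficients_bounded by blast
  define R where "R = 9632/3 * R0 / (\<delta> / 2)"
  have R: "R > 0" using R0 assms by (simp add: R_def)
  have "prob {\<omega>\<in>space M. (\<Sum>k<n. (SI (space N) (t k) \<omega>)\<^sup>2) > (K * R)\<^sup>2} \<le> \<delta>"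
    if t: "\<forall>k<n. simple_function N (t k)" and K: "K > 0" and sq: "\<forall>x\<in>space N. (\<Sum>k<n. (t k x)\<^sup>2) \<le> K\<^sup>2" for n :: nat and t K
  proof -
    have "\<exists>(I::(nat \<Rightarrow> real) set) F. meas_partition (space N) I F \<and> (\<forall>i\<in>I. F i \<noteq> {}) \<and>
      (\<forall>k\<in>{..<n}. \<forall>i\<in>I. \<forall>x\<in>F i. t k x = i k)"
      using t by (intro simple_common_partition) auto
    then obtain I :: "(nat \<Rightarrow> real) set" and F where P: "meas_partition (space N) I F" and ne: "\<And>i. i \<in> I \<Longrightarrow> F i \<noteq> {}"
      and val: "\<And>k i x. k < n \<Longrightarrow> i \<in> I \<Longrightarrow> x \<in> F i \<Longrightarrow> t k x = i k" by blast
    have [measurable]: "\<mu> (F i) \<in> borel_measurable M" if "i \<in> I" for i using meas_partition_sets[OF P that] by simp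
    have c: "(\<Sum>k<n. (i k / K)\<^sup>2) \<le> 1" if i: "i \<in> I" for i
    proof -
      obtain x where x: "x \<in> F i" using ne[OF i] by auto
      then have "x \<in> space N" using sets.sets_into_space[OF meas_partition_sets[OF P i]] by auto
      then have "(\<Sum>k<n. (i k)\<^sup>2) \<le> K\<^sup>2" using sq val[OF _ i x] by auto
      then show ?thesis using K by (simp add: power_divide flip: sum_divide_distrib)
    qed
    have "prob {\<omega>\<in>space M. (\<Sum>k<n. (\<Sum>i\<in>I. (i k / K) * \<mu> (F i) \<omega>)\<^sup>2) > R\<^sup>2} \<le> 2 * (\<delta> / 4) + 9632/3 * R0 / R"
    proof (rule square_function_bounded)
      show "prob {\<omega>\<in>space M. \<bar>\<Sum>i\<in>I. c i * \<mu> (F i) \<omega>\<bar> > R0} \<le> \<delta> / 4" if "\<And>i. i \<in> I \<Longrightarrow> \<bar>c i\<bar> \<le> 1" for c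
        using bd[OF P, of c] that by (simp add: tail_def)
    qed (use meas_partition_finite[OF P] R0 R c in auto)
    also have "\<dots> = \<delta>" using R0 assms by (simp add: R_def)
    finally have le: "prob {\<omega>\<in>space M. (\<Sum>k<n. (\<Sum>i\<in>I. (i k / K) * \<mu> (F i) \<omega>)\<^sup>2) > R\<^sup>2} \<le> \<delta>" .
    have "AE \<omega> in M. \<forall>k\<in>{..<n}. SI (space N) (t k) \<omega> = (\<Sum>i\<in>I. i k * \<mu> (F i) \<omega>)"
    proof (subst AE_finite_all, simp, intro ballI)
      fix k assume k: "k \<in> {..<n}"
      have "AE \<omega> in M. SI (space N) (t k) \<omega> = (\<Sum>i\<in>I. i k * \<mu> (space N \<inter> F i) \<omega>)"
        using val k by (intro SI_partition[OF P ne]) auto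
      moreover have "space N \<inter> F i = F i" if "i \<in> I" for i
        using sets.sets_into_space[OF meas_partition_sets[OF P that]] by auto
      ultimately show "AE \<omega> in M. SI (space N) (t k) \<omega> = (\<Sum>i\<in>I. i k * \<mu> (F i) \<omega>)" by simp
    qed
    then have "AE \<omega> in M. (\<Sum>k<n. (SI (space N) (t k) \<omega>)\<^sup>2) > (K * R)\<^sup>2 \<longrightarrow>
      (\<Sum>k<n. (\<Sum>i\<in>I. (i k / K) * \<mu> (F i) \<omega>)\<^sup>2) > R\<^sup>2"
    proof eventually_elim
      case (elim \<omega>)
      have "SI (space N) (t k) \<omega> = K * (\<Sum>i\<in>I. (i k / K) * \<mu> (F i) \<omega>)" if "k < n" for k
        using elim that K by (simp add: sum_distrib_left)
      then have "(\<Sum>k<n. (SI (space N) (t k) \<omega>)\<^sup>2) = (\<Sum>k<n. (K * (\<Sum>i\<in>I. (i k / K) * \<mu> (F i) \<omega>))\<^sup>2)"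
        by (intro sum.cong refl) (simp only: lessThan_iff)
      also have "\<dots> = K\<^sup>2 * (\<Sum>k<n. (\<Sum>i\<in>I. (i k / K) * \<mu> (F i) \<omega>)\<^sup>2)"
        by (simp only: power_mult_distrib sum_distrib_left[symmetric])
      finally have "(\<Sum>k<n. (SI (space N) (t k) \<omega>)\<^sup>2) = K\<^sup>2 * (\<Sum>k<n. (\<Sum>i\<in>I. (i k / K) * \<mu> (F i) \<omega>)\<^sup>2)" .
      then show ?case using K by (simp add: power_mult_distrib)
    qed
    then have "prob {\<omega>\<in>space M. (\<Sum>k<n. (SI (space N) (t k) \<omega>)\<^sup>2) > (K * R)\<^sup>2} \<le>
      prob {\<omega>\<in>space M. (\<Sum>k<n. (\<Sum>i\<in>I. (i k / K) * \<mu> (F i) \<omega>)\<^sup>2) > R\<^sup>2}"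
      by (intro finite_measure_mono_AE) (auto elim!: eventually_mono)
    then show ?thesis using le by simp
  qed
  then show ?thesis using R by blast
qed

end

section \<open>Square functions of integrals\<close>

text \<open>
  Rounding towards zero: rounded functions are dominated by the original ones, so that the bound on the
  sum of squares is preserved.
\<close>
definition grid_round :: "nat \<Rightarrow> real \<Rightarrow> real" where
  "grid_round n y = of_int (if 0 \<le> y then \<lfloor>real (Suc n) * y\<rfloor> else \<lceil>real (Suc n) * y\<rceil>) / real (Suc n)"

lemma grid_round_abs_le: "\<bar>grid_round n y\<bar> \<le> \<bar>y\<bar>"
proof -
  have up: "\<bar>real_of_int \<lfloor>z\<rfloor>\<bar> \<le> z" if "0 \<le> z" for z :: real using that by simp
  have down: "\<bar>real_of_int \<lceil>z\<rceil>\<bar> \<le> - z" if "z \<le> 0" for z :: real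
  proof -
    have "real_of_int \<lceil>z\<rceil> \<le> 0" using that by simp
    then show ?thesis using le_of_int_ceiling[of z] by simp
  qed
  show ?thesis
  proof (cases "0 \<le> y")
    case True
    then have "0 \<le> real (Suc n) * y" by simp
    then have "\<bar>real_of_int \<lfloor>real (Suc n) * y\<rfloor>\<bar> \<le> real (Suc n) * y" by (rule up)
    then have "\<bar>real_of_int \<lfloor>real (Suc n) * y\<rfloor>\<bar> / real (Suc n) \<le> y"
      by (subst pos_divide_le_eq) (auto simp: mult.commute)
    then show ?thesis using True by (simp add: grid_round_def abs_divide)
  next
    case False
    then have "real (Suc n) * y \<le> 0" by (simp add: mult_nonneg_nonpos)
    then have "\<bar>real_of_int \<lceil>real (Suc n) * y\<rceil>\<bar> \<le> - (real (Suc n) * y)" by (rule down)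
    then have "\<bar>real_of_int \<lceil>real (Suc n) * y\<rceil>\<bar> / real (Suc n) \<le> - y"
      by (subst pos_divide_le_eq) (auto simp: mult.commute)
    then show ?thesis using False by (simp add: grid_round_def abs_divide)
  qed
qed

lemma grid_round_close: "\<bar>grid_round n y - y\<bar> \<le> 1 / real (Suc n)"
proof -
  let ?z = "real_of_int (if 0 \<le> y then \<lfloor>real (Suc n) * y\<rfloor> else \<lceil>real (Suc n) * y\<rceil>)"
  have "grid_round n y - y = (?z - real (Suc n) * y) / real (Suc n)"
    by (simp add: grid_round_def diff_divide_distrib)
  moreover have "\<bar>?z - real (Suc n) * y\<bar> \<le> 1" by (cases "0 \<le> y") (simp_all, linarith+)
  ultimately show ?thesis by (simp add: abs_divide divide_right_mono)
qed

lemma simple_function_grid_round: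
  assumes [measurable]: "f \<in> borel_measurable N" and bd: "\<And>x. x \<in> space N \<Longrightarrow> \<bar>f x\<bar> \<le> B"
  shows "simple_function N (\<lambda>x. grid_round n (f x))"
proof (rule simple_function_borel_measurable)
  show "(\<lambda>x. grid_round n (f x)) \<in> borel_measurable N" unfolding grid_round_def by measurable
  let ?m = "\<lceil>real (Suc n) * B\<rceil>"
  have "(\<lambda>x. grid_round n (f x)) ` space N \<subseteq> (\<lambda>z. real_of_int z / real (Suc n)) ` {- ?m..?m}"
  proof (intro image_subsetI)
    fix x assume x: "x \<in> space N"
    let ?z = "if 0 \<le> f x then \<lfloor>real (Suc n) * f x\<rfloor> else \<lceil>real (Suc n) * f x\<rceil>"
    have gr: "grid_round n (f x) = real_of_int ?z / real (Suc n)" by (simp add: grid_round_def)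
    have "\<bar>real_of_int ?z\<bar> = real (Suc n) * \<bar>grid_round n (f x)\<bar>" unfolding gr by (simp add: abs_divide)
    also have "\<dots> \<le> real (Suc n) * B"
      using grid_round_abs_le[of n "f x"] bd[OF x] by (intro mult_left_mono) auto
    finally have "?z \<in> {- ?m..?m}" unfolding atLeastAtMost_iff by linarith
    then show "grid_round n (f x) \<in> (\<lambda>z. real_of_int z / real (Suc n)) ` {- ?m..?m}"
      unfolding gr by (rule imageI)
  qed
  then show "finite ((\<lambda>x. grid_round n (f x)) ` space N)" by (rule finite_subset) auto
qed

context prob_space begin

text \<open>The partial sums increase, so they exceed a bound for some \<open>n\<close> with the same small probability as for each \<open>n\<close>.\<close>
lemma AE_summable_of_tight_partial_sums:
  fixes Z :: "nat \<Rightarrow> 'a \<Rightarrow> real"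
  assumes [measurable]: "\<And>k::nat. Z k \<in> borel_measurable M"
    and tight: "\<And>\<delta>. \<delta> > 0 \<Longrightarrow> \<exists>R. \<forall>n. prob {\<omega>\<in>space M. (\<Sum>k<n. (Z k \<omega>)\<^sup>2) > R} \<le> \<delta>"
  shows "AE \<omega> in M. summable (\<lambda>k. (Z k \<omega>)\<^sup>2)"
proof -
  let ?S = "\<lambda>n \<omega>. \<Sum>k<n. (Z k \<omega>)\<^sup>2"
  define B where "B = {\<omega>\<in>space M. \<forall>m::nat. \<exists>n. ?S n \<omega> > real m}"
  have B [measurable]: "B \<in> events" unfolding B_def by measurable
  have small: "prob B \<le> \<delta>" if "\<delta> > 0" for \<delta>
  proof -
    obtain R where R: "\<And>n. prob {\<omega>\<in>space M. ?S n \<omega> > R} \<le> \<delta>" using tight[OF \<open>\<delta> > 0\<close>] by blast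
    let ?E = "\<lambda>n. {\<omega>\<in>space M. ?S n \<omega> > R}"
    have mono: "?S n \<omega> \<le> ?S m \<omega>" if "n \<le> m" for n m \<omega>
      using that by (intro sum_mono2) auto
    have "(\<lambda>n. prob (?E n)) \<longlonglongrightarrow> prob (\<Union>n. ?E n)"
      by (intro finite_Lim_measure_incseq) (auto simp: incseq_def intro: less_le_trans mono)
    then have "prob (\<Union>n. ?E n) \<le> \<delta>" using R by (intro LIMSEQ_le_const2) auto
    moreover have "B \<subseteq> (\<Union>n. ?E n)"
    proof
      fix \<omega> assume \<omega>: "\<omega> \<in> B"
      obtain m where "R \<le> real m" using real_arch_simple by blast
      moreover obtain n where "?S n \<omega> > real m" using \<omega> by (auto simp: B_def)
      ultimately show "\<omega> \<in> (\<Union>n. ?E n)" using \<omega> by (auto simp: B_def intro!: exI[of _ n])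
    qed
    then have "prob B \<le> prob (\<Union>n. ?E n)" by (intro finite_measure_mono) auto
    ultimately show ?thesis by simp
  qed
  have "prob B \<le> 0"
  proof (rule field_le_epsilon)
    show "prob B \<le> 0 + e" if "e > 0" for e using small[OF that] by simp
  qed
  then have "B \<in> null_sets M" using B by (auto simp: null_sets_def emeasure_eq_measure measure_le_0_iff)
  then have "AE \<omega> in M. \<omega> \<notin> B" by (rule AE_not_in)
  then show ?thesis
  proof (rule AE_mp, intro AE_I2 impI)
    fix \<omega> assume "\<omega> \<in> space M" "\<omega> \<notin> B"
    then obtain m where "\<And>n. ?S n \<omega> \<le> real m" by (auto simp: B_def not_less)
    then show "summable (\<lambda>k. (Z k \<omega>)\<^sup>2)" by (intro summableI_nonneg_bounded) auto
  qed
qed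

end

context l0_measure begin

lemma integral_square_function_bounded:
  assumes f: "\<And>k. f k \<in> borel_measurable N"
    and K: "K > 0" and sq: "\<And>x n. x \<in> space N \<Longrightarrow> (\<Sum>k<n. (f k x)\<^sup>2) \<le> K\<^sup>2"
    and Z: "\<And>k::nat. has_sm_integral M N \<mu> (space N) (f k) (Z k)" and "\<delta> > 0"
  shows "\<exists>R. \<forall>n. prob {\<omega>\<in>space M. (\<Sum>k<n. (Z k \<omega>)\<^sup>2) > R} \<le> \<delta>"
proof -
  obtain R where R: "R > 0" and bd: "\<And>(n::nat) t K. (\<forall>k<n. simple_function N (t k)) \<Longrightarrow> K > 0 \<Longrightarrow>
    (\<forall>x\<in>space N. (\<Sum>k<n. (t k x)\<^sup>2) \<le> K\<^sup>2) \<Longrightarrow>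
    prob {\<omega>\<in>space M. (\<Sum>k<n. (SI (space N) (t k) \<omega>)\<^sup>2) > (K * R)\<^sup>2} \<le> \<delta>"
    using simple_square_function_bounded[OF \<open>\<delta> > 0\<close>] by blast
  have Z_meas [measurable]: "Z k \<in> borel_measurable M" for k using Z by (auto simp: has_sm_integral_def)
  have f_bd: "\<bar>f k x\<bar> \<le> K" if "x \<in> space N" for k x
  proof -
    have "(f k x)\<^sup>2 \<le> (\<Sum>j<Suc k. (f j x)\<^sup>2)" by (simp add: sum_nonneg)
    also have "\<dots> \<le> K\<^sup>2" by (rule sq[OF that])
    finally show ?thesis using K abs_le_square_iff[of "f k x" K] by simp
  qed
  define t where "t = (\<lambda>m k x. grid_round m (f k x))"
  have t: "simple_function N (t m k)" for m k
    unfolding t_def using f f_bd by (intro simple_function_grid_round[where B = K]) auto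
  note [measurable] = SI_measurable[OF t]
  have t_sq: "(\<Sum>k<n. (t m k x)\<^sup>2) \<le> K\<^sup>2" if "x \<in> space N" for m n x
  proof -
    have "(\<Sum>k<n. (t m k x)\<^sup>2) \<le> (\<Sum>k<n. (f k x)\<^sup>2)"
      by (intro sum_mono) (simp add: t_def grid_round_abs_le flip: abs_le_square_iff)
    then show ?thesis using sq[OF that, of n] by simp
  qed
  have t_unif: "\<exists>n0. \<forall>m\<ge>n0. \<forall>x\<in>space N. \<bar>t m k x - f k x\<bar> \<le> e" if "e > 0" for k and e :: real
  proof -
    obtain n0 where n0: "inverse (real (Suc n0)) < e" using reals_Archimedean[OF \<open>e > 0\<close>] by auto
    have "\<bar>t m k x - f k x\<bar> \<le> e" if "m \<ge> n0" for m x
    proof -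
      have "\<bar>t m k x - f k x\<bar> \<le> 1 / real (Suc m)" unfolding t_def by (rule grid_round_close)
      also have "\<dots> \<le> 1 / real (Suc n0)" using that by (intro divide_left_mono) auto
      finally show ?thesis using n0 by (simp add: inverse_eq_divide)
    qed
    then show ?thesis by blast
  qed
  have "prob {\<omega>\<in>space M. (\<Sum>k<n. (Z k \<omega>)\<^sup>2) > (2 * (K * R))\<^sup>2} \<le> \<delta>" for n
  proof -
    \<comment> \<open>\<open>n\<close> errors of size \<open>e\<close> contribute at most \<open>(K R)\<^sup>2\<close> to the sum of squares\<close>
    define e where "e = K * R / (real n + 1)"
    have e: "e > 0" using K R by (simp add: e_def)
    let ?S = "\<lambda>m k. SI (space N) (t m k)"
    let ?tail = "\<lambda>m k. tail (\<lambda>\<omega>. ?S m k \<omega> - Z k \<omega>) e"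
    have "(\<lambda>m. \<delta> + (\<Sum>k<n. ?tail m k)) \<longlonglongrightarrow> \<delta> + (\<Sum>k<n. 0)"
      using e t_unif by (intro tendsto_add tendsto_const tendsto_sum integral_limit_of_uniform_approximation[OF Z] t) auto
    then have lim: "(\<lambda>m. \<delta> + (\<Sum>k<n. ?tail m k)) \<longlonglongrightarrow> \<delta>" by simp
    have le: "prob {\<omega>\<in>space M. (\<Sum>k<n. (Z k \<omega>)\<^sup>2) > (2 * (K * R))\<^sup>2} \<le> \<delta> + (\<Sum>k<n. ?tail m k)" for m
    proof -
      let ?A = "{\<omega>\<in>space M. (\<Sum>k<n. (?S m k \<omega>)\<^sup>2) > (K * R)\<^sup>2}"
      let ?B = "\<lambda>k. {\<omega>\<in>space M. \<bar>?S m k \<omega> - Z k \<omega>\<bar> > e}"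
      have A: "?A \<in> events" and B: "?B k \<in> events" for k by measurable
      have "{\<omega>\<in>space M. (\<Sum>k<n. (Z k \<omega>)\<^sup>2) > (2 * (K * R))\<^sup>2} \<subseteq> ?A \<union> (\<Union>k<n. ?B k)"
      proof (intro subsetI, rule ccontr)
        fix \<omega> assume "\<omega> \<in> {\<omega>\<in>space M. (\<Sum>k<n. (Z k \<omega>)\<^sup>2) > (2 * (K * R))\<^sup>2}" and notin: "\<omega> \<notin> ?A \<union> (\<Union>k<n. ?B k)"
        then have \<omega>: "\<omega> \<in> space M" "(\<Sum>k<n. (Z k \<omega>)\<^sup>2) > (2 * (K * R))\<^sup>2" by auto
        have S: "(\<Sum>k<n. (?S m k \<omega>)\<^sup>2) \<le> (K * R)\<^sup>2" using notin \<omega>(1) by (simp add: not_less)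
        have D: "\<bar>?S m k \<omega> - Z k \<omega>\<bar> \<le> e" if "k < n" for k using notin \<omega>(1) that by (simp add: not_less)
        have "(\<Sum>k<n. (Z k \<omega>)\<^sup>2) \<le> (\<Sum>k<n. 2 * (?S m k \<omega>)\<^sup>2 + 2 * e\<^sup>2)"
        proof (rule sum_mono)
          fix k assume "k \<in> {..<n}"
          then have "(?S m k \<omega> - Z k \<omega>)\<^sup>2 \<le> e\<^sup>2" using D[of k] e by (simp flip: abs_le_square_iff)
          moreover have "0 \<le> (2 * ?S m k \<omega> - Z k \<omega>)\<^sup>2" by simp
          ultimately show "(Z k \<omega>)\<^sup>2 \<le> 2 * (?S m k \<omega>)\<^sup>2 + 2 * e\<^sup>2"
            by (simp add: power2_eq_square algebra_simps)
        qed
        also have "\<dots> = 2 * (\<Sum>k<n. (?S m k \<omega>)\<^sup>2) + 2 * (real n * e\<^sup>2)"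
          by (simp add: sum.distrib sum_distrib_left)
        also have "real n * e\<^sup>2 \<le> (K * R)\<^sup>2"
        proof -
          have "real n * e\<^sup>2 \<le> (real n + 1)\<^sup>2 * e\<^sup>2" by (intro mult_right_mono) (auto simp: power2_eq_square algebra_simps)
          also have "\<dots> = ((real n + 1) * e)\<^sup>2" by (simp add: power_mult_distrib)
          also have "(real n + 1) * e = K * R" by (simp add: e_def)
          finally show ?thesis .
        qed
        finally show False using \<omega>(2) S by (simp add: power_mult_distrib)
      qed
      then have "prob {\<omega>\<in>space M. (\<Sum>k<n. (Z k \<omega>)\<^sup>2) > (2 * (K * R))\<^sup>2} \<le> prob (?A \<union> (\<Union>k<n. ?B k))"
        using A B by (intro finite_measure_mono) auto
      also have "\<dots> \<le> prob ?A + prob (\<Union>k<n. ?B k)" using A B by (intro measure_Un_le) auto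
      also have "prob ?A \<le> \<delta>" using t t_sq K by (intro bd) auto
      also have "prob (\<Union>k<n. ?B k) \<le> (\<Sum>k<n. ?tail m k)"
        unfolding tail_def using B by (intro measure_UNION_le) auto
      finally show ?thesis by simp
    qed
    show ?thesis by (rule LIMSEQ_le_const[OF lim]) (use le in blast)
  qed
  then show ?thesis by blast
qed

end

theorem lemma2:
  fixes M :: "'w measure" and N :: "'x measure"
    and \<mu> :: "'x set \<Rightarrow> 'w \<Rightarrow> real" and f :: "nat \<Rightarrow> 'x \<Rightarrow> real"
  assumes "prob_space M" and "complete_measure M"
    and "stochastic_measure M N \<mu>"
    and "\<exists>m :: 'x measure. finite_measure m \<and> sets m = sets N \<and>
           (\<forall>g\<in>borel_measurable N.
              (\<forall>l::real. l > 0 \<longrightarrow> (\<integral>\<^sup>+x. ennreal (2 powr (l * \<bar>g x\<bar>)) \<partial>m) < \<infinity>)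
              \<longrightarrow> sm_integrable M N \<mu> g)"
    and "\<And>k. f k \<in> borel_measurable N"
    and "(SUP x\<in>space N. \<Sum>k. ennreal ((f k x)\<^sup>2)) < \<infinity>"
  shows "AE \<omega> in M. summable (\<lambda>k. (sm_integral M N \<mu> (space N) (f k) \<omega>)\<^sup>2)"
proof -
  interpret l0_measure M N \<mu>
    using assms(1,3) by (simp add: l0_measure_def l0_measure_axioms_def)
  let ?s = "SUP x\<in>space N. \<Sum>k. ennreal ((f k x)\<^sup>2)"
  define K where "K = sqrt (enn2real ?s) + 1"
  have K: "K > 0" "enn2real ?s \<le> K\<^sup>2"
    by (auto simp: K_def power2_sum add_nonneg_pos)
  have sq: "(\<Sum>k<n. (f k x)\<^sup>2) \<le> K\<^sup>2" if x: "x \<in> space N" for x n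
  proof -
    have "ennreal (\<Sum>k<n. (f k x)\<^sup>2) = (\<Sum>k<n. ennreal ((f k x)\<^sup>2))" by (simp add: sum_ennreal)
    also have "\<dots> \<le> (\<Sum>k. ennreal ((f k x)\<^sup>2))" by (rule sum_le_suminf) auto
    also have "\<dots> \<le> ?s" using x by (rule SUP_upper)
    also have "\<dots> = ennreal (enn2real ?s)" using assms(6) by simp
    finally have "(\<Sum>k<n. (f k x)\<^sup>2) \<le> enn2real ?s" by (simp add: ennreal_le_iff)
    then show ?thesis using K(2) by simp
  qed
  have "sm_integrable M N \<mu> (f k)" for k
  proof -
    obtain m :: "'x measure" where m: "finite_measure m" "sets m = sets N"
      and intg: "\<And>g. g \<in> borel_measurable N \<Longrightarrow>
        (\<And>l::real. l > 0 \<Longrightarrow> (\<integral>\<^sup>+x. ennreal (2 powr (l * \<bar>g x\<bar>)) \<partial>m) < \<infinity>) \<Longrightarrow> sm_integrable M N \<mu> g"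
      using assms(4) by blast
    show ?thesis
    proof (rule intg[OF assms(5)])
      fix l :: real assume l: "l > 0"
      have "(\<integral>\<^sup>+x. ennreal (2 powr (l * \<bar>f k x\<bar>)) \<partial>m) \<le> (\<integral>\<^sup>+x. ennreal (2 powr (l * K)) \<partial>m)"
      proof (intro nn_integral_mono ennreal_leI)
        fix x assume "x \<in> space m"
        then have x: "x \<in> space N" using sets_eq_imp_space_eq[OF m(2)] by simp
        have "(f k x)\<^sup>2 \<le> (\<Sum>j<Suc k. (f j x)\<^sup>2)" by (simp add: sum_nonneg)
        also have "\<dots> \<le> K\<^sup>2" by (rule sq[OF x])
        finally have "\<bar>f k x\<bar> \<le> K" using K(1) abs_le_square_iff[of "f k x" K] by simp
        then show "2 powr (l * \<bar>f k x\<bar>) \<le> 2 powr (l * K)" using l by simp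
      qed
      also have "\<dots> < \<infinity>"
        using finite_measure.emeasure_finite[OF m(1)] by (simp add: ennreal_mult_less_top less_top)
      finally show "(\<integral>\<^sup>+x. ennreal (2 powr (l * \<bar>f k x\<bar>)) \<partial>m) < \<infinity>" .
    qed
  qed
  then have Z: "has_sm_integral M N \<mu> (space N) (f k) (sm_integral M N \<mu> (space N) (f k))" for k
    by (intro has_sm_integral_sm_integral) auto
  show ?thesis
  proof (rule AE_summable_of_tight_partial_sums)
    show "sm_integral M N \<mu> (space N) (f k) \<in> borel_measurable M" for k
      using Z[of k] by (simp add: has_sm_integral_def)
    show "\<exists>R. \<forall>n. prob {\<omega>\<in>space M. (\<Sum>k<n. (sm_integral M N \<mu> (space N) (f k) \<omega>)\<^sup>2) > R} \<le> \<delta>"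
      if "\<delta> > 0" for \<delta>
      by (rule integral_square_function_bounded[OF assms(5) K(1) sq Z that])
  qed
qed

end
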